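(* Let $T>0$, $0<\beta<2$ and $f(x)=|x|^{-\beta}$ for $x\in\mathbb{R}^3$, with spectral measure $\mu$. Then: (i) For every $\gamma\in\left(0,\frac{2-\beta}{2}\right)$, the Fourier transform of the tempered measure $|\zeta|^{2\gamma}\mu(d\zeta)$ is a non-negative locally integrable function and $\int_{\mathbb{R}^3}\frac{\mu(d\zeta)}{1+|\zeta|^{2-2\gamma}}<\infty$. (ii) With $\nu=2-\beta$, there is a constant $C$ such that $\int_{|z|\le h}\frac{f(z)}{|z|}dz\le Ch^{\nu}$ for all $0<h\le2T$. (iii) For every $0<\rho_1<\min(2-\beta,1)$ there is a constant $C$ such that for all $0<h\le1$ $$\int_0^T\int_{S^2}\int_{S^2}\left|f\big(s(\xi+\eta)+h(\xi+\eta)\big)-f\big(s(\xi+\eta)+h\eta\big)\right|s\,\sigma(d\xi)\sigma(d\eta)\,ds\le Ch^{\rho_1}.$$ (iv) For every $0<\rho_2<2-\beta$ there is a constant $C$ such that for all $0<h\le1$ $$\int_0^T\int_{S^2}\int_{S^2}\Big|f\big(s(\xi+\eta)+h(\xi+\eta)\big)-f\big(s(\xi+\eta)+h\xi\big)-f\big(s(\xi+\eta)+h\eta\big)+f\big(s(\xi+\eta)\big)\Big|s^2\,\sigma(d\xi)\sigma(d\eta)\,ds\le Ch^{\rho_2}.$$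
   Context: $S^2$ is the unit sphere in $\mathbb{R}^3$ and $\sigma(d\xi)$ the uniform surface measure on it. $\mathcal{F}\varphi(\xi)=\int_{\mathbb{R}^3}\varphi(x)e^{-i\xi\cdot x}dx$. The spectral measure $\mu$ of $f$ is the non-negative tempered measure with $\int f(x)\varphi(x)\,dx=\int\mathcal{F}\varphi(\xi)\,\mu(d\xi)$ for all $\varphi\in\mathcal{S}(\mathbb{R}^3)$. The Fourier transform of a tempered measure $\nu$ is the function $g$ if $\int g\varphi\,dx=\int\mathcal{F}\varphi\,d\nu$ for all $\varphi\in\mathcal{S}(\mathbb{R}^3)$. *)

theory Defs
  imports "HOL-Analysis.Analysis"
begin

definition partial_deriv :: "'n::finite \<Rightarrow> (real^'n \<Rightarrow> complex) \<Rightarrow> real^'n \<Rightarrow> complex" where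
  "partial_deriv i \<phi> = (\<lambda>x. frechet_derivative \<phi> (at x) (axis i 1))"

text \<open>Mixed partial derivatives are indexed by finite sequences of coordinates rather than by
  multi-indices. Differentiability of all of them amounts to smoothness of \<open>\<phi>\<close>; the case of the
  empty sequence is \<open>\<phi>\<close> itself.\<close>

definition schwartz_fun :: "(real^'n::finite \<Rightarrow> complex) \<Rightarrow> bool" where
  "schwartz_fun \<phi> \<longleftrightarrow>
     (\<forall>js. (\<forall>x. foldr partial_deriv js \<phi> differentiable (at x)) \<and>
           (\<forall>k::nat. \<exists>C. \<forall>x. norm x ^ k * norm (foldr partial_deriv js \<phi> x) \<le> C))"

definition fourier :: "(real^'n::finite \<Rightarrow> complex) \<Rightarrow> real^'n \<Rightarrow> complex" where
  "fourier \<phi> \<xi> = (LINT x|lborel. \<phi> x * exp (- \<i> * complex_of_real (\<xi> \<bullet> x)))"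

definition tempered_measure :: "(real^'n::finite) measure \<Rightarrow> bool" where
  "tempered_measure \<nu> \<longleftrightarrow> sets \<nu> = sets borel \<and>
     (\<exists>k::nat. (\<integral>\<^sup>+ x. ennreal (1 / (1 + (norm x)\<^sup>2) ^ k) \<partial>\<nu>) < \<infinity>)"

text \<open>The integrability clauses make sure that both sides of the defining identity are genuine
  integrals, the Bochner integral being \<open>0\<close> by convention on non-integrable functions.\<close>

definition has_fourier_transform ::
    "(real^'n::finite) measure \<Rightarrow> (real^'n \<Rightarrow> real) \<Rightarrow> bool" where
  "has_fourier_transform \<nu> g \<longleftrightarrow> tempered_measure \<nu> \<and>
     (\<forall>\<phi>. schwartz_fun \<phi> \<longrightarrow>
        integrable lborel (\<lambda>x. complex_of_real (g x) * \<phi> x) \<and> integrable \<nu> (fourier \<phi>) \<and>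
        (LINT x|lborel. complex_of_real (g x) * \<phi> x) = (LINT \<xi>|\<nu>. fourier \<phi> \<xi>))"

definition is_spectral_measure ::
    "(real^'n::finite \<Rightarrow> real) \<Rightarrow> (real^'n) measure \<Rightarrow> bool" where
  "is_spectral_measure f \<mu> \<longleftrightarrow> has_fourier_transform \<mu> f"

definition locally_integrable :: "(real^'n::finite \<Rightarrow> real) \<Rightarrow> bool" where
  "locally_integrable g \<longleftrightarrow> (\<forall>K. compact K \<longrightarrow> set_integrable lborel K g)"

text \<open>Surface measure of the unit sphere of \<open>\<real>\<^sup>3\<close>, as a Borel measure on the whole space
  concentrated on the sphere. A Borel set \<open>A\<close> of unit vectors gets three times the Lebesgue
  measure of the cone \<open>{r \<xi> | 0 < r < 1, \<xi> \<in> A}\<close>, so the total mass is \<open>4 \<pi>\<close>.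
  Here \<open>sgn x = x /\<^sub>R norm x\<close>; the origin, which is sent to \<open>0\<close>, is a null set.\<close>

definition sphere_measure :: "(real^3) measure" where
  "sphere_measure = distr (scale_measure 3 (restrict_space lborel (ball 0 1))) borel sgn"

end

(* (iii) and (iv) hold pointwise up to a singular weight: with r = |xi + eta|, m = s^2 r^2,
   x = h/s and y = h^2/m the squared norms of the arguments of f are m (1 + x)^2, m (1 + x + y)
   and m, so Taylor expansion bounds the first and the second difference by a multiple of
   m^(-beta/2) (x^rho + y^(rho/2)), that is, of h^rho (s r)^(-beta-rho). This is integrable because
   beta + rho < 2 and |xi + eta|^(-p) is integrable over the sphere for p < 2.

   For (i), |x|^(-a) and |zeta|^(a-3) are mixtures over t of Gaussians that the Fourier transform
   exchanges, so the transform of a multiple of |zeta|^(a-3) d zeta is |x|^(-a) for 0 < a < 3.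
   A tempered measure is determined by its Fourier transform, since its integrals against
   all translated Gaussians are. Hence mu is a multiple of |zeta|^(beta-3) d zeta, and
   |zeta|^(2 gamma) mu has a transform that is a multiple of |x|^(-beta-2 gamma). *)
theory Submission
  imports Defs "HOL-Probability.Probability"
begin

section \<open>Radial integrals and the surface measure\<close>

text \<open>No polar coordinates occur. Since |x . b| <= |x| for every basis vector b, a radial
  weight in dimension n is dominated by a product of weights in single coordinates, each with the
  n-th part of the exponent, and finiteness becomes a one-dimensional matter. On the sphere, the
  cone definition of the surface measure turns |\<xi> + e|^(-p) into an integral over the ball; only
  the two coordinates transversal to e control that singularity, each with exponent p/2, and this is
  the origin of p < 2. The integral in s converges under the same condition.

  In (iv) the exponent may exceed 1 because the terms linear in h/s cancel in the second difference.

  The obstacle to uniqueness is that a tempered measure can have infinite mass. A Gaussian weight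
  makes it finite, and because a product of two Gaussians is again a Gaussian, the weighted measure
  is still determined by Gaussian tests.

  The constants in the two transforms are never evaluated. It is enough that they are positive and
  finite, since only their ratio enters the transform of the weighted measure.\<close>

lemma ennreal_inverse_antimono: "x \<le> y \<Longrightarrow> inverse y \<le> inverse (x::ennreal)"
proof (cases "x = 0 \<or> y = top")
  case False
  assume "x \<le> y"
  with False obtain a b where "x = ennreal a" "y = ennreal b" "0 < a" "a \<le> b"
    by (cases x rule: ennreal_cases; cases y rule: ennreal_cases) (auto simp: less_le top_unique)
  then show ?thesis
    by (auto simp: inverse_ennreal intro!: ennreal_leI le_imp_inverse_le)
qed auto

lemma ball_cball_sets_borel [measurable]:
  "ball c r \<in> sets (borel :: 'a::metric_space measure)" "cball c r \<in> sets (borel :: 'a::metric_space measure)"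
  by auto

text \<open>The inverse is taken in the extended reals, where it is \<open>\<infinity>\<close> at \<open>0\<close>; the real-valued
  \<open>0 powr (- q) = 0\<close> would falsify the pointwise bounds on the coordinate hyperplanes.\<close>

lemma nn_integral_inverse_abs_powr_finite:
  assumes "q < 1"
  shows "(\<integral>\<^sup>+ t\<in>{-1..1::real}. inverse (ennreal (\<bar>t\<bar> powr q)) \<partial>lborel) < \<infinity>"
proof -
  have AE0: "AE t in lborel. t \<noteq> (0::real)"
    by (rule AE_lborel_singleton)
  have *: "(\<integral>\<^sup>+ t\<in>{0..1::real}. inverse (ennreal (\<bar>t\<bar> powr q)) \<partial>lborel) < \<infinity>" (is "?I < _")
  proof -
    have "?I = (\<integral>\<^sup>+ t. ennreal (t powr (-q) * indicator {0..1} t) \<partial>lborel)"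
    proof (rule nn_integral_cong_AE)
      show "AE x in lborel. inverse (ennreal (\<bar>x\<bar> powr q)) * indicator {0..1} x =
              ennreal (x powr - q * indicator {0..1} x)"
        using AE0 by eventually_elim
          (auto simp: indicator_def inverse_ennreal powr_minus)
    qed
    also have "\<dots> = ennreal (1 / (1 - q))"
      using nn_integral_has_integral_lebesgue[OF _ has_integral_powr_from_0[of "-q" 1]] assms
      by (simp add: mult.commute[of "indicator _ _"] add.commute)
    finally show ?thesis by simp
  qed
  have neg: "(\<integral>\<^sup>+ t\<in>{-1..0::real}. inverse (ennreal (\<bar>t\<bar> powr q)) \<partial>lborel) < \<infinity>"
  proof -
    have "(\<integral>\<^sup>+ t\<in>{-1..0::real}. inverse (ennreal (\<bar>t\<bar> powr q)) \<partial>lborel)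
        = (\<integral>\<^sup>+ t\<in>{0..1::real}. inverse (ennreal (\<bar>t\<bar> powr q)) \<partial>lborel)"
      by (subst nn_integral_real_affine[where c="-1" and t=0])
         (auto simp: indicator_def intro!: nn_integral_cong)
    with * show ?thesis by simp
  qed
  have "(\<integral>\<^sup>+ t\<in>{-1..1::real}. inverse (ennreal (\<bar>t\<bar> powr q)) \<partial>lborel)
      \<le> (\<integral>\<^sup>+ t. inverse (ennreal (\<bar>t\<bar> powr q)) * indicator {-1..0} t
             + inverse (ennreal (\<bar>t\<bar> powr q)) * indicator {0..1} t \<partial>lborel)"
    by (intro nn_integral_mono) (auto simp: indicator_def)
  also have "\<dots> < \<infinity>"
    using * neg by (subst nn_integral_add) auto
  finally show ?thesis .
qed

lemma nn_integral_one_plus_square_powr_finite: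
  assumes "q > 1 / 2"
  shows "(\<integral>\<^sup>+ t. ennreal ((1 + t\<^sup>2) powr (- q)) \<partial>(lborel::real measure)) < \<infinity>"
proof -
  have tail: "(\<integral>\<^sup>+ t. ennreal (t powr (-2*q) * indicator {1..} t) \<partial>lborel) < \<infinity>"
  proof -
    have "(\<integral>\<^sup>+ t. ennreal (t powr (-2*q) * indicator {1..} t) \<partial>lborel) = ennreal (1 / (2*q - 1))"
    proof -
      have "- (1 powr (- 2 * q + 1)) / (- 2 * q + 1) = 1 / (2 * q - 1)"
        using assms by (simp add: divide_simps)
      then show ?thesis
        using nn_integral_has_integral_lebesgue[OF _ has_integral_powr_to_inf[of "-2*q" 1]] assms
        by (simp add: mult.commute[of "indicator _ _"])
    qed
    then show ?thesis by simp
  qed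
  have tail': "(\<integral>\<^sup>+ t. ennreal ((-t) powr (-2*q) * indicator {..-1} t) \<partial>lborel) < \<infinity>"
  proof -
    have "(\<integral>\<^sup>+ t. ennreal ((-t) powr (-2*q) * indicator {..-1} t) \<partial>lborel)
        = (\<integral>\<^sup>+ t. ennreal (t powr (-2*q) * indicator {1..} t) \<partial>lborel)"
      by (subst nn_integral_real_affine[where c="-1" and t=0])
         (auto simp: indicator_def intro!: nn_integral_cong)
    with tail show ?thesis by simp
  qed
  have pw: "(1 + t\<^sup>2) powr (- q) \<le> indicator {-1..1} t + t powr (-2*q) * indicator {1..} t
      + (-t) powr (-2*q) * indicator {..-1} t" for t :: real
  proof -
    have sq: "(1 + t\<^sup>2) powr (- q) \<le> \<bar>t\<bar> powr (-2*q)" if "t \<noteq> 0"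
    proof -
      have "(1 + t\<^sup>2) powr (- q) \<le> (\<bar>t\<bar> powr 2) powr (-q)"
        using that assms by (intro powr_mono2') (auto simp: powr_numeral)
      also have "(\<bar>t\<bar> powr 2) powr (-q) = \<bar>t\<bar> powr (-2*q)"
        unfolding powr_powr by simp
      finally show ?thesis .
    qed
    have one: "(1 + t\<^sup>2) powr (- q) \<le> 1"
      using assms powr_mono[of "-q" 0 "1 + t\<^sup>2"] by (simp split: if_splits)
    consider "t \<in> {-1..1}" | "t > 1" | "t < -1" by fastforce
    then show ?thesis
      by cases (use sq one in \<open>auto simp: indicator_def intro: order_trans[OF one]\<close>)
  qed
  have "(\<integral>\<^sup>+ t. ennreal ((1 + t\<^sup>2) powr (- q)) \<partial>(lborel::real measure))
      \<le> (\<integral>\<^sup>+ t. indicator {-1..1} t + ennreal (t powr (-2*q) * indicator {1..} t)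
      + ennreal ((-t) powr (-2*q) * indicator {..-1} t) \<partial>lborel)"
  proof (intro nn_integral_mono)
    fix t :: real
    have "ennreal ((1 + t\<^sup>2) powr (- q)) \<le> ennreal (indicator {-1..1} t + t powr (-2*q) * indicator {1..} t
      + (-t) powr (-2*q) * indicator {..-1} t)"
      by (rule ennreal_leI) (rule pw)
    then show "ennreal ((1 + t\<^sup>2) powr (- q)) \<le> indicator {-1..1} t + ennreal (t powr (-2*q) * indicator {1..} t)
      + ennreal ((-t) powr (-2*q) * indicator {..-1} t)"
      by (simp add: ennreal_plus ennreal_indicator)
  qed
  also have "\<dots> < \<infinity>"
    using tail tail' by (subst nn_integral_add, simp, simp)+ simp
  finally show ?thesis .
qed

section \<open>Rotations and integrals over the sphere\<close>

lemma lborel_distr_orthogonal: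
  fixes T :: "real^'n::{finite,wellorder} \<Rightarrow> real^'n::_"
  assumes T: "orthogonal_transformation T"
  shows "distr lborel borel T = lborel"
proof (rule lborel_eqI[symmetric])
  have lin: "linear T" using T by (simp add: orthogonal_transformation_linear)
  then have [measurable]: "T \<in> borel_measurable borel"
    by (intro borel_measurable_continuous_onI linear_continuous_on linear_conv_bounded_linear[THEN iffD1])
  obtain S where S: "orthogonal_transformation S" "\<And>x. S (T x) = x" "\<And>x. T (S x) = x"
    using T orthogonal_transformation_inv orthogonal_transformation_bij
    by (metis bij_inv_eq_iff)
  fix l u :: "real^'n::_" assume lu: "\<And>b. b \<in> Basis \<Longrightarrow> l \<bullet> b \<le> u \<bullet> b"
  have "T -` box l u = S ` box l u"
    using S by (auto simp: image_iff) metis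
  moreover have "emeasure lborel (S ` box l u) = emeasure lborel (box l u)"
  proof -
    have B: "S ` box l u \<in> sets borel"
      using \<open>T -` box l u = S ` box l u\<close> measurable_sets[of T borel borel "box l u"] by simp
    have "emeasure lborel (S ` box l u) = emeasure lebesgue (S ` box l u)"
      using B by simp
    also have "\<dots> = ennreal (measure lebesgue (S ` box l u))"
      using measurable_orthogonal_image[OF S(1), of "box l u"] by (simp add: emeasure_eq_measure2)
    also have "measure lebesgue (S ` box l u) = measure lebesgue (box l u)"
      by (rule measure_orthogonal_image[OF S(1)]) simp
    also have "ennreal \<dots> = emeasure lborel (box l u)"
      using lmeasurable_box[of l u] by (simp add: emeasure_eq_measure2)
    finally show ?thesis .
  qed
  ultimately show "emeasure (distr lborel borel T) (box l u) = (\<Prod>b\<in>Basis. (u - l) \<bullet> b)"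
    using lu by (simp add: emeasure_distr)
qed simp



lemma prod_Basis_vec:
  "(\<Prod>b\<in>Basis. g b) = (\<Prod>i\<in>UNIV. g (axis i (1::real)))" for g :: "real^'n::finite \<Rightarrow> 'b::comm_monoid_mult"
proof -
  have "Basis = range (\<lambda>i::'n. axis i (1::real))"
    by (auto simp: Basis_vec_def)
  moreover have "inj (\<lambda>i::'n. axis i (1::real))"
    by (simp add: inj_def axis_eq_axis)
  ultimately show ?thesis
    using prod.reindex[of "\<lambda>i::'n. axis i (1::real)" UNIV g] by (simp add: comp_def)
qed

text \<open>For |x| < 1 the vector x + |x| e is shorter than sgn x + e, and its second and third
  coordinates are those of x. Hence |sgn x + e|^2 is at least x_2^2 + x_3^2, so at least |x_2|
  |x_3|, and the integrand is at most |x_2|^(-p/2) |x_3|^(-p/2). Both factors are integrable on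
  [-1, 1] because p/2 < 1.\<close>

lemma nn_integral_cone_powr:
  assumes "0 < p" "p < 2"
  shows "(\<integral>\<^sup>+ x\<in>ball 0 1. inverse (ennreal (norm (sgn x + axis 1 1 :: real^3) powr p)) \<partial>lborel) < \<infinity>"
proof -
  let ?e = "axis 1 1 :: real^3"
  \<comment> \<open>The coordinate along \<open>?e\<close> only gets a cutoff; the other two share
    the singularity.\<close>
  define f :: "real^3 \<Rightarrow> real \<Rightarrow> ennreal" where "f b t = (if b = ?e then indicator {-1..1} t else
    inverse (ennreal (\<bar>t\<bar> powr (p / 2))) * indicator {-1..1} t)" for b t
  have [measurable]: "f b \<in> borel_measurable borel" for b
    unfolding f_def[abs_def] by (cases "b = ?e") simp_all
  have "inverse (ennreal (norm (sgn x + ?e) powr p)) * indicator (ball 0 1) x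
        \<le> (\<Prod>b\<in>Basis. f b (x \<bullet> b))" for x :: "real^3"
  proof (cases "x \<in> ball 0 1")
    case True
    then have "norm x < 1" by simp
    then have le1: "\<bar>x $ i\<bar> \<le> 1" for i
      using component_le_norm_cart[of x i] by simp
    have "\<bar>x $ 2\<bar> * \<bar>x $ 3\<bar> \<le> (norm (sgn x + ?e))\<^sup>2"
    proof (cases "x = 0")
      case False
      have "x + norm x *\<^sub>R ?e = norm x *\<^sub>R (sgn x + ?e)"
        using False by (simp add: scaleR_add_right sgn_div_norm)
      then have "norm (x + norm x *\<^sub>R ?e) = norm x * norm (sgn x + ?e)"
        by simp
      also have "\<dots> \<le> norm (sgn x + ?e)"
        using \<open>norm x < 1\<close> by (simp add: mult_left_le_one_le)
      finally have *: "norm (x + norm x *\<^sub>R ?e) \<le> norm (sgn x + ?e)" .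
      have "2 * (\<bar>x $ 2\<bar> * \<bar>x $ 3\<bar>) \<le> (x $ 2)\<^sup>2 + (x $ 3)\<^sup>2"
        using sum_squares_bound[of "\<bar>x $ 2\<bar>" "\<bar>x $ 3\<bar>"] by simp
      then have "\<bar>x $ 2\<bar> * \<bar>x $ 3\<bar> \<le> (x $ 2)\<^sup>2 + (x $ 3)\<^sup>2"
        using mult_nonneg_nonneg[of "\<bar>x $ 2\<bar>" "\<bar>x $ 3\<bar>"] by linarith
      also have "\<dots> \<le> (norm (x + norm x *\<^sub>R ?e))\<^sup>2"
        unfolding power2_norm_eq_inner by (simp add: inner_vec_def sum_3 axis_def power2_eq_square)
      also have "\<dots> \<le> (norm (sgn x + ?e))\<^sup>2"
        using * by (intro power_mono) auto
      finally show ?thesis .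
    qed auto
    then have "(\<bar>x $ 2\<bar> * \<bar>x $ 3\<bar>) powr (p/2) \<le> ((norm (sgn x + ?e))\<^sup>2) powr (p/2)"
      using assms by (intro powr_mono2) auto
    also have "\<dots> = norm (sgn x + ?e) powr p"
      by (cases "sgn x + ?e = 0") (simp_all add: powr_powr flip: powr_numeral)
    finally have "inverse (ennreal (norm (sgn x + ?e) powr p)) \<le>
        inverse (ennreal (\<bar>x $ 2\<bar> powr (p/2) * \<bar>x $ 3\<bar> powr (p/2)))"
      by (intro ennreal_inverse_antimono ennreal_leI) (simp add: powr_mult)
    also have "\<dots> = (\<Prod>b\<in>Basis. f b (x \<bullet> b))"
    proof -
      have "(\<Prod>b\<in>Basis. f b (x \<bullet> b)) = f (axis 1 1) (x $ 1) * (f (axis 2 1) (x $ 2) * f (axis 3 1) (x $ 3))"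
        unfolding prod_Basis_vec UNIV_3 by (simp add: inner_axis)
      moreover have "x $ i \<in> {-1..1}" for i
        using le1[of i] by auto
      moreover have "axis 2 1 \<noteq> ?e" "axis 3 1 \<noteq> ?e"
        by (simp_all add: axis_eq_axis)
      ultimately show ?thesis
        by (simp only: f_def if_True if_False indicator_simps mult_1 mult_1_right)
           (simp add: ennreal_mult ennreal_inverse_mult)
    qed
    finally show ?thesis using True by simp
  qed simp
  then have "(\<integral>\<^sup>+ x\<in>ball 0 1. inverse (ennreal (norm (sgn x + ?e) powr p)) \<partial>lborel)
      \<le> (\<integral>\<^sup>+ x. (\<Prod>b\<in>Basis. f b (x \<bullet> b)) \<partial>lborel)"
    by (rule nn_integral_mono)
  also have "\<dots> = (\<Prod>b\<in>Basis. \<integral>\<^sup>+ t. f b t \<partial>lborel)"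
    by (rule nn_integral_lborel_prod) auto
  also have "\<dots> < \<infinity>"
  proof -
    have "(\<integral>\<^sup>+ t. f b t \<partial>lborel) < \<infinity>" for b
      using nn_integral_inverse_abs_powr_finite[of "p/2"] assms
      by (cases "b = ?e") (simp_all add: f_def)
    then show ?thesis
      by (simp add: less_top[symmetric] ennreal_prod_eq_top)
  qed
  finally show ?thesis .
qed

lemma measurable_sgn [measurable]: "sgn \<in> borel_measurable (borel :: 'a::euclidean_space measure)"
  unfolding sgn_div_norm[abs_def] by measurable

text \<open>Integrals over the sphere become integrals over the solid ball of functions constant
  along rays, where coordinate bounds and rotations of Lebesgue measure apply.\<close>

lemma nn_integral_sphere_measure:
  assumes [measurable]: "F \<in> borel_measurable borel"
  shows "(\<integral>\<^sup>+ \<xi>. F \<xi> \<partial>sphere_measure) = 3 * (\<integral>\<^sup>+ x\<in>ball 0 1. F (sgn x) \<partial>lborel)"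
proof -
  have "(\<integral>\<^sup>+ \<xi>. F \<xi> \<partial>sphere_measure) = (\<integral>\<^sup>+ x. F (sgn x) \<partial>scale_measure 3 (restrict_space lborel (ball 0 1)))"
    unfolding sphere_measure_def
    by (intro nn_integral_distr) (simp_all add: measurable_cong_sets[OF sets_scale_measure refl] measurable_restrict_space1)
  also have "\<dots> = 3 * (\<integral>\<^sup>+ x. F (sgn x) \<partial>restrict_space lborel (ball 0 1))"
    by (intro nn_integral_scale_measure) (auto intro!: measurable_restrict_space1)
  finally show ?thesis
    by (simp add: nn_integral_restrict_space)
qed

lemma sets_sphere_measure [measurable_cong, simp]: "sets sphere_measure = sets borel"
  by (simp add: sphere_measure_def)

lemma emeasure_sphere_measure_finite: "emeasure sphere_measure UNIV < \<infinity>"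
proof -
  have "emeasure sphere_measure UNIV = (\<integral>\<^sup>+ \<xi>. 1 \<partial>sphere_measure)"
    by (simp add: sphere_measure_def)
  also have "\<dots> = 3 * emeasure lborel (ball (0::real^3) 1)"
    by (subst nn_integral_sphere_measure) auto
  also have "\<dots> < \<infinity>"
    using emeasure_lborel_ball_finite[of "0::real^3" 1] by (simp add: ennreal_mult_less_top)
  finally show ?thesis .
qed

text \<open>The measure lives on the whole space, so estimates proved for unit vectors enter the
  integrals through this fact.\<close>

lemma AE_sphere_measure: "AE \<xi> in sphere_measure. norm \<xi> = 1"
proof -
  have "(\<integral>\<^sup>+ \<xi>. indicator {\<xi>. norm \<xi> \<noteq> 1} \<xi> \<partial>sphere_measure) = 3 * (\<integral>\<^sup>+ x\<in>ball 0 1. indicator {\<xi>::real^3. norm \<xi> \<noteq> 1} (sgn x) \<partial>lborel)"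
    by (intro nn_integral_sphere_measure) measurable
  also have "(\<integral>\<^sup>+ x\<in>ball 0 1. indicator {\<xi>::real^3. norm \<xi> \<noteq> 1} (sgn x) \<partial>lborel) = 0"
    using AE_lborel_singleton[of "0::real^3"]
    by (subst nn_integral_0_iff_AE) (auto elim!: eventually_mono simp: norm_sgn indicator_def)
  finally have "(\<integral>\<^sup>+ \<xi>. indicator {\<xi>. norm \<xi> \<noteq> 1} \<xi> \<partial>sphere_measure) = 0"
    by simp
  then show ?thesis
    by (subst (asm) nn_integral_0_iff_AE) (auto elim!: eventually_mono simp: indicator_def)
qed

text \<open>The integral does not depend on the unit vector \<eta>: a rotation taking
  \<open>axis 1 1\<close> to \<eta> preserves Lebesgue measure and the ball and commutes with
  \<open>sgn\<close>. One finite integral over the cone therefore serves as \<open>M\<close> for all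
  \<eta>.\<close>

lemma nn_integral_sphere_measure_powr_bounded:
  assumes "0 < p" "p < 2"
  shows "\<exists>M<\<infinity>. \<forall>\<eta>. norm \<eta> = 1 \<longrightarrow> (\<integral>\<^sup>+ \<xi>. inverse (ennreal (norm (\<xi> + \<eta>) powr p)) \<partial>sphere_measure) \<le> M"
proof -
  let ?e = "axis 1 1 :: real^3"
  define \<Phi> where "\<Phi> z = inverse (ennreal (norm z powr p))" for z :: "real^3"
  have [measurable]: "\<Phi> \<in> borel_measurable borel"
    unfolding \<Phi>_def[abs_def] by measurable
  have "(\<integral>\<^sup>+ \<xi>. \<Phi> (\<xi> + \<eta>) \<partial>sphere_measure) = 3 * (\<integral>\<^sup>+ x\<in>ball 0 1. \<Phi> (sgn x + ?e) \<partial>lborel)"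
    if "norm \<eta> = 1" for \<eta>
  proof -
    obtain T where T: "orthogonal_transformation T" "T ?e = \<eta>"
      by (rule orthogonal_transformation_exists_1[of ?e \<eta>]) (use \<open>norm \<eta> = 1\<close> in \<open>auto simp: norm_axis_1\<close>)
    have lin: "linear T" using T(1) by (rule orthogonal_transformation_linear)
    have nT: "norm (T x) = norm x" for x
      using T(1) by (rule orthogonal_transformation_norm)
    have [measurable]: "T \<in> borel_measurable borel"
      using lin by (intro borel_measurable_continuous_onI linear_continuous_on) (simp add: linear_conv_bounded_linear)
    have "(\<integral>\<^sup>+ x\<in>ball 0 1. \<Phi> (sgn x + \<eta>) \<partial>lborel) = (\<integral>\<^sup>+ x\<in>ball 0 1. \<Phi> (sgn x + \<eta>) \<partial>distr lborel borel T)"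
      using T(1) by (simp add: lborel_distr_orthogonal)
    also have "\<dots> = (\<integral>\<^sup>+ x. \<Phi> (sgn (T x) + \<eta>) * indicator (ball 0 1) (T x) \<partial>lborel)"
      by (intro nn_integral_distr) measurable
    also have "\<dots> = (\<integral>\<^sup>+ x\<in>ball 0 1. \<Phi> (sgn x + ?e) \<partial>lborel)"
    proof (intro nn_integral_cong)
      fix x :: "real^3"
      have "sgn (T x) + \<eta> = T (sgn x + ?e)"
        using lin T(2) by (simp add: sgn_div_norm nT linear_add linear_scale)
      then show "\<Phi> (sgn (T x) + \<eta>) * indicator (ball 0 1) (T x) = \<Phi> (sgn x + ?e) * indicator (ball 0 1) x"
        by (simp add: \<Phi>_def nT indicator_def)
    qed
    finally show ?thesis
      by (subst nn_integral_sphere_measure) auto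
  qed
  moreover have "3 * (\<integral>\<^sup>+ x\<in>ball 0 1. \<Phi> (sgn x + ?e) \<partial>lborel) < \<infinity>"
    using nn_integral_cone_powr[OF assms] by (simp add: \<Phi>_def ennreal_mult_less_top)
  ultimately show ?thesis
    unfolding \<Phi>_def
    by (intro exI[of _ "3 * (\<integral>\<^sup>+ x\<in>ball 0 1. inverse (ennreal (norm (sgn x + ?e) powr p)) \<partial>lborel)"]) auto
qed


section \<open>Integrable power weights on Euclidean space\<close>

text \<open>The product of |x . b|^q over the basis, with q = p / DIM, is at most |x|^p. Taking
  inverses bounds the weight by a product of one-dimensional weights of exponent q < 1.\<close>

lemma nn_integral_cball_norm_powr_finite:
  fixes p :: real
  assumes "0 < p" "p < DIM('a)"
  shows "(\<integral>\<^sup>+ x\<in>cball 0 1. ennreal (norm (x::'a::euclidean_space) powr (- p)) \<partial>lborel) < \<infinity>"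
proof -
  define q where "q = p / DIM('a)"
  have q: "0 < q" "q < 1" using assms by (auto simp: q_def field_simps)
  have "ennreal (norm x powr (- p)) * indicator (cball 0 1) x
    \<le> (\<Prod>b\<in>Basis. inverse (ennreal (\<bar>x \<bullet> b\<bar> powr q)) * indicator {-1..1} (x \<bullet> b))" for x :: 'a
  \<comment> \<open>At the origin the left side is 0, because \<open>0 powr y = 0\<close>; on the
    remaining coordinate hyperplanes the right side is infinite.\<close>
  proof (cases "x \<in> cball 0 1 \<and> x \<noteq> 0")
    case True
    then have x: "norm x \<le> 1" "0 < norm x" by auto
    have le1: "indicator {-1..1} (x \<bullet> b) = (1::ennreal)" if "b \<in> Basis" for b
      using Basis_le_norm[OF that, of x] x by (auto simp: indicator_def)
    have "(\<Prod>b\<in>Basis. \<bar>x \<bullet> b\<bar> powr q) \<le> (\<Prod>b\<in>(Basis::'a set). norm x powr q)"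
      using q by (intro prod_mono conjI powr_mono2) (auto simp: Basis_le_norm)
    also have "\<dots> = norm x powr p"
      using x by (simp add: q_def powr_power)
    finally have *: "(\<Prod>b\<in>Basis. \<bar>x \<bullet> b\<bar> powr q) \<le> norm x powr p" .
    have "ennreal (norm x powr (- p)) = inverse (ennreal (norm x powr p))"
      using x by (simp add: inverse_ennreal powr_minus)
    also have "\<dots> \<le> inverse (ennreal (\<Prod>b\<in>Basis. \<bar>x \<bullet> b\<bar> powr q))"
      using * by (intro ennreal_inverse_antimono ennreal_leI)
    also have "\<dots> = (\<Prod>b\<in>Basis. inverse (ennreal (\<bar>x \<bullet> b\<bar> powr q)))"
    proof -
      have "inverse (ennreal (\<Prod>b\<in>B. \<bar>x \<bullet> b\<bar> powr q)) = (\<Prod>b\<in>B. inverse (ennreal (\<bar>x \<bullet> b\<bar> powr q)))"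
        if "finite B" for B
        using that by (induction B) (simp_all add: ennreal_mult prod_nonneg ennreal_inverse_mult)
      then show ?thesis by simp
    qed
    finally show ?thesis using True by (simp add: le1)
  qed auto
  then have "(\<integral>\<^sup>+ x\<in>cball 0 1. ennreal (norm (x::'a) powr (- p)) \<partial>lborel)
      \<le> (\<integral>\<^sup>+ x. (\<Prod>b\<in>Basis. inverse (ennreal (\<bar>x \<bullet> b\<bar> powr q)) * indicator {-1..1} (x \<bullet> b)) \<partial>(lborel :: 'a measure))"
    by (rule nn_integral_mono)
  also have "\<dots> = (\<Prod>b\<in>(Basis::'a set). (\<integral>\<^sup>+ t. inverse (ennreal (\<bar>t\<bar> powr q)) * indicator {-1..1} t \<partial>lborel))"
    by (rule nn_integral_lborel_prod) auto
  also have "\<dots> < \<infinity>"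
    using nn_integral_inverse_abs_powr_finite[OF q(2)]
    by (simp add: less_top[symmetric] power_eq_top_ennreal_iff)
  finally show ?thesis .
qed

text \<open>The same distribution of the exponent over the coordinates, now from 1 + |x|^2 >= 1 + (x
  . b)^2; each factor has exponent above 1/2.\<close>

lemma nn_integral_one_plus_norm_square_powr_finite:
  fixes p :: real
  assumes "p > DIM('a) / 2"
  shows "(\<integral>\<^sup>+ x. ennreal ((1 + (norm (x::'a::euclidean_space))\<^sup>2) powr (- p)) \<partial>lborel) < \<infinity>"
proof -
  define q where "q = p / DIM('a)"
  have q: "1 / 2 < q" using assms by (auto simp: q_def field_simps)
  have "ennreal ((1 + (norm x)\<^sup>2) powr (- p)) \<le> (\<Prod>b\<in>Basis. ennreal ((1 + (x \<bullet> b)\<^sup>2) powr (- q)))" for x :: 'a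
  proof -
    have "(1 + (norm x)\<^sup>2) powr (- p) = (\<Prod>b\<in>(Basis::'a set). (1 + (norm x)\<^sup>2) powr (- q))"
      using add_pos_nonneg[of 1 "(norm x)\<^sup>2"] by (simp add: q_def powr_power)
    also have "\<dots> \<le> (\<Prod>b\<in>Basis. (1 + (x \<bullet> b)\<^sup>2) powr (- q))"
      using q by (intro prod_mono conjI powr_mono2')
        (auto simp: add_pos_nonneg Basis_le_norm abs_le_square_iff[symmetric])
    finally show ?thesis by (simp add: prod_ennreal ennreal_leI)
  qed
  then have "(\<integral>\<^sup>+ x. ennreal ((1 + (norm (x::'a))\<^sup>2) powr (- p)) \<partial>lborel)
      \<le> (\<integral>\<^sup>+ x. (\<Prod>b\<in>Basis. ennreal ((1 + (x \<bullet> b)\<^sup>2) powr (- q))) \<partial>(lborel :: 'a measure))"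
    by (rule nn_integral_mono)
  also have "\<dots> = (\<Prod>b\<in>(Basis::'a set). (\<integral>\<^sup>+ t. ennreal ((1 + t\<^sup>2) powr (- q)) \<partial>lborel))"
    by (rule nn_integral_lborel_prod) auto
  also have "\<dots> < \<infinity>"
    using nn_integral_one_plus_square_powr_finite[OF q]
    by (simp add: less_top[symmetric] power_eq_top_ennreal_iff)
  finally show ?thesis .
qed

text \<open>Inside the unit ball only the singular factor matters. Outside, |x|^2 >= (1 + |x|^2) / 2
  merges both factors into (1 + |x|^2)^(-(p/2 + r)) at the cost of 2^(p/2). This one weight serves
  for temperedness, for integrability against rapidly decaying functions and for the integral in
  (i).\<close>

lemma nn_integral_norm_powr_weight_finite:
  fixes p r :: real
  assumes "0 < p" "p < DIM('a)" "DIM('a) < p + 2 * r"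
  shows "(\<integral>\<^sup>+ x. ennreal (norm (x::'a::euclidean_space) powr (- p) * (1 + (norm x)\<^sup>2) powr (- r)) \<partial>lborel) < \<infinity>"
proof -
  let ?A = "\<lambda>x::'a. ennreal (norm x powr (- p)) * indicator (cball 0 1) x"
  let ?B = "\<lambda>x::'a. ennreal (2 powr (p / 2)) * ennreal ((1 + (norm x)\<^sup>2) powr (- (p / 2 + r)))"
  have r: "0 < r" using assms by simp
  have "ennreal (norm x powr (- p) * (1 + (norm x)\<^sup>2) powr (- r)) \<le> ?A x + ?B x" for x :: 'a
  proof (cases "norm x \<le> 1")
    case True
    have "(1 + (norm x)\<^sup>2) powr (- r) \<le> 1"
      using r powr_mono[of "-r" 0 "1 + (norm x)\<^sup>2"] by (simp split: if_splits)
    then have "norm x powr (- p) * (1 + (norm x)\<^sup>2) powr (- r) \<le> norm x powr (- p)"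
      by (simp add: mult_left_le)
    then show ?thesis using True
      by (auto intro!: add_increasing2 ennreal_leI)
  next
    case False
    have "norm x powr (- p) = ((norm x)\<^sup>2) powr (- (p/2))"
      using False by (simp add: powr_powr flip: powr_numeral)
    also have "\<dots> \<le> ((1 + (norm x)\<^sup>2) / 2) powr (- (p/2))"
      using False assms by (intro powr_mono2') (auto simp: add_pos_nonneg)
    also have "\<dots> = 2 powr (p/2) * (1 + (norm x)\<^sup>2) powr (- (p/2))"
      by (simp add: powr_divide powr_minus divide_simps)
    finally have "norm x powr (- p) * (1 + (norm x)\<^sup>2) powr (- r)
        \<le> 2 powr (p/2) * (1 + (norm x)\<^sup>2) powr (- (p/2)) * (1 + (norm x)\<^sup>2) powr (- r)"
      by (intro mult_right_mono) auto
    also have "\<dots> = 2 powr (p/2) * (1 + (norm x)\<^sup>2) powr (- (p/2 + r))"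
      using powr_add[of "1 + (norm x)\<^sup>2" "- (p/2)" "-r"] by (simp only: minus_add_distrib mult.assoc)
    finally have "ennreal (norm x powr (- p) * (1 + (norm x)\<^sup>2) powr (- r))
        \<le> ennreal (2 powr (p/2) * (1 + (norm x)\<^sup>2) powr (- (p/2 + r)))"
      by (rule ennreal_leI)
    also have "\<dots> = ?B x"
      by (rule ennreal_mult) auto
    finally show ?thesis
      by (rule add_increasing[rotated]) simp
  qed
  then have "(\<integral>\<^sup>+ x. ennreal (norm (x::'a) powr (- p) * (1 + (norm x)\<^sup>2) powr (- r)) \<partial>lborel)
      \<le> (\<integral>\<^sup>+ x. ?A x + ?B x \<partial>lborel)"
    by (rule nn_integral_mono)
  also have "\<dots> = (\<integral>\<^sup>+ x. ?A x \<partial>lborel) + (\<integral>\<^sup>+ x. ?B x \<partial>lborel)"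
    by (rule nn_integral_add) auto
  also have "\<dots> < \<infinity>"
    using nn_integral_cball_norm_powr_finite[OF assms(1,2)]
      nn_integral_one_plus_norm_square_powr_finite[where 'a='a, of "p/2 + r"] assms(3)
    by (simp add: nn_integral_cmult ennreal_mult_less_top)
  finally show ?thesis .
qed

section \<open>Differences of the Riesz kernel along sums of unit vectors\<close>

lemma nn_integral_lborel_scaleR:
  fixes f :: "'a::euclidean_space \<Rightarrow> ennreal"
  assumes [measurable]: "f \<in> borel_measurable borel" and c: "c \<noteq> 0"
  shows "(\<integral>\<^sup>+ x. f x \<partial>lborel) = ennreal (\<bar>c\<bar> ^ DIM('a)) * (\<integral>\<^sup>+ x. f (t + c *\<^sub>R x) \<partial>lborel)"
  by (subst lborel_affine[OF c, of t]) (simp add: nn_integral_density nn_integral_distr nn_integral_cmult)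

text \<open>Homogeneity yields the exact power of \<open>h\<close>. In dimension 3 with
  \<open>p = \<beta> + 1\<close> it is the exponent 2 - \<beta> of (ii).\<close>

lemma nn_integral_cball_norm_powr:
  fixes p h :: real
  assumes p: "0 < p" "p < DIM('a)" and h: "0 < h"
  shows "(\<integral>\<^sup>+ x\<in>cball 0 h. ennreal (norm (x::'a::euclidean_space) powr (- p)) \<partial>lborel)
    = ennreal (h powr (DIM('a) - p)) * (\<integral>\<^sup>+ x\<in>cball 0 1. ennreal (norm (x::'a) powr (- p)) \<partial>lborel)"
proof -
  have "(\<integral>\<^sup>+ x\<in>cball 0 h. ennreal (norm (x::'a) powr (- p)) \<partial>lborel)
      = ennreal (h ^ DIM('a)) * (\<integral>\<^sup>+ x. ennreal (norm (h *\<^sub>R x::'a) powr (- p)) * indicator (cball 0 h) (h *\<^sub>R x) \<partial>lborel)"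
    using h by (subst nn_integral_lborel_scaleR[where c=h and t=0]) auto
  also have "(\<integral>\<^sup>+ x. ennreal (norm (h *\<^sub>R x::'a) powr (- p)) * indicator (cball 0 h) (h *\<^sub>R x) \<partial>lborel)
     = (\<integral>\<^sup>+ x. ennreal (h powr (-p)) * (ennreal (norm (x::'a) powr (- p)) * indicator (cball 0 1) x) \<partial>lborel)"
    using h by (intro nn_integral_cong) (auto simp: powr_mult indicator_def ennreal_mult)
  also have "\<dots> = ennreal (h powr (-p)) * (\<integral>\<^sup>+ x\<in>cball 0 1. ennreal (norm (x::'a) powr (- p)) \<partial>lborel)"
    by (intro nn_integral_cmult) auto
  finally show ?thesis
    using h by (simp add: powr_diff powr_minus_divide powr_realpow flip: mult.assoc ennreal_mult')
qed

section \<open>Taylor bounds and scalar differences of a power\<close>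

text \<open>The graph of a convex function lies above its tangent at 0.\<close>

lemma one_minus_le_powr_minus:
  fixes t b :: real
  assumes "0 \<le> t" "0 < b"
  shows "1 - b * t \<le> (1 + t) powr (- b)"
proof -
  have "(1 + 0) powr (-b) + b * 0 \<le> (1 + t) powr (-b) + b * t"
  proof (rule DERIV_nonneg_imp_nondecreasing[OF assms(1)])
    fix x assume x: "0 \<le> x" "x \<le> t"
    have "(1 + x) powr (-b - 1) \<le> 1"
      using x assms powr_mono[of "-b-1" 0 "1 + x"] by simp
    then have "0 \<le> -b * (1 + x) powr (-b - 1) + b"
      using assms by (simp add: mult_left_le)
    moreover have "((\<lambda>x. (1 + x) powr (-b) + b * x) has_real_derivative (-b * (1 + x) powr (-b - 1) + b)) (at x)"
      using x by (auto intro!: derivative_eq_intros)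
    ultimately show "\<exists>y. ((\<lambda>x. (1 + x) powr (-b) + b * x) has_real_derivative y) (at x) \<and> 0 \<le> y"
      by blast
  qed
  then show ?thesis by simp
qed

text \<open>The derivative of right side minus left side is \<open>b\<close> times the tangent
  inequality for the exponent \<open>b + 1\<close>, so the difference increases from its value 0 at
  0.\<close>

lemma powr_minus_le_Taylor2:
  fixes t b :: real
  assumes "0 \<le> t" "0 < b"
  shows "(1 + t) powr (- b) \<le> 1 - b * t + b * (b + 1) / 2 * t\<^sup>2"
proof -
  have "1 - b * 0 + b * (b + 1) / 2 * 0\<^sup>2 - (1 + 0) powr (- b) \<le> 1 - b * t + b * (b + 1) / 2 * t\<^sup>2 - (1 + t) powr (- b)"
  proof (rule DERIV_nonneg_imp_nondecreasing[OF assms(1)])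
    fix x assume x: "0 \<le> x" "x \<le> t"
    have "0 \<le> b * ((1 + x) powr (- (b + 1)) - (1 - (b + 1) * x))"
      using one_minus_le_powr_minus[of x "b + 1"] x assms by simp
    also have "- (b + 1) = - b - 1"
      by simp
    also have "b * ((1 + x) powr (- b - 1) - (1 - (b + 1) * x)) = - b + b * (b + 1) * x - (-b) * (1 + x) powr (-b - 1)"
      by (simp add: algebra_simps)
    finally have "0 \<le> - b + b * (b + 1) * x - (-b) * (1 + x) powr (-b - 1)" .
    moreover have "((\<lambda>x. 1 - b * x + b * (b + 1) / 2 * x\<^sup>2 - (1 + x) powr (- b)) has_real_derivative
        (- b + b * (b + 1) * x - (-b) * (1 + x) powr (-b - 1))) (at x)"
      using x by (auto intro!: derivative_eq_intros)
    ultimately show "\<exists>y. ((\<lambda>x. 1 - b * x + b * (b + 1) / 2 * x\<^sup>2 - (1 + x) powr (- b)) has_real_derivative y) (at x) \<and> 0 \<le> y"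
      by blast
  qed
  then show ?thesis by simp
qed

lemma one_plus_powr_minus_le_1:
  fixes t b :: real
  shows "0 \<le> t \<Longrightarrow> 0 < b \<Longrightarrow> (1 + t) powr (- b) \<le> 1"
  using powr_mono[of "-b" 0 "1 + t"] by simp

text \<open>For x, y < 1 both powers differ from 1 by at most 2x + x^2 <= 3x and x + y respectively,
  and x <= x^\<rho>, y <= y^(\<rho>/2) as \<rho> <= 1. Otherwise the right side is at least 3, while
  two numbers in [0, 1] differ by at most 1.\<close>

lemma first_difference_bound:
  fixes b x y \<rho> :: real
  assumes "0 < b" "b < 1" "0 \<le> x" "0 \<le> y" "0 < \<rho>" "\<rho> \<le> 1"
  shows "\<bar>((1 + x)\<^sup>2) powr (- b) - (1 + x + y) powr (- b)\<bar> \<le> 3 * (x powr \<rho> + y powr (\<rho> / 2))"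
proof -
  have eq: "(1 + x)\<^sup>2 = 1 + (2 * x + x\<^sup>2)" "1 + x + y = 1 + (x + y)"
    by (auto simp: power2_eq_square algebra_simps)
  have u: "(1 + (2 * x + x\<^sup>2)) powr (- b) \<le> 1" "(1 + (x + y)) powr (- b) \<le> 1"
    using assms by (auto intro!: one_plus_powr_minus_le_1)
  show ?thesis
  proof (cases "x < 1 \<and> y < 1")
    case True
    have "x\<^sup>2 \<le> x" using True assms by (simp add: power2_eq_square mult_left_le)
    moreover have "x \<le> x powr \<rho>" "y \<le> y powr (\<rho> / 2)"
      using True assms powr_mono'[of \<rho> 1 x] powr_mono'[of "\<rho> / 2" 1 y] by simp_all
    moreover have "1 - b * (2 * x + x\<^sup>2) \<le> (1 + (2 * x + x\<^sup>2)) powr (- b)" "1 - b * (x + y) \<le> (1 + (x + y)) powr (- b)"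
      using assms by (auto intro!: one_minus_le_powr_minus)
    moreover have "b * (2 * x + x\<^sup>2) \<le> 2 * x + x\<^sup>2" "b * (x + y) \<le> x + y"
      using assms by (auto intro!: mult_left_le_one_le)
    ultimately show ?thesis unfolding eq using u assms by simp
  next
    case False
    then have "1 \<le> x powr \<rho> + y powr (\<rho> / 2)"
      using assms ge_one_powr_ge_zero[of x \<rho>] ge_one_powr_ge_zero[of y "\<rho>/2"]
      by (smt (verit) powr_ge_zero half_gt_zero)
    moreover have "\<bar>(1 + (2 * x + x\<^sup>2)) powr (- b) - (1 + (x + y)) powr (- b)\<bar> \<le> 1"
      using u powr_ge_zero[of "1 + (2 * x + x\<^sup>2)" "-b"] powr_ge_zero[of "1 + (x + y)" "-b"] by linarith
    ultimately show ?thesis unfolding eq by argo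
  qed
qed

text \<open>To first order the two powers are 1 - 2bx and 1 - bx - by, so the terms linear in x
  cancel and only x^2 and y remain. Hence \<rho> may go up to 2: for x, y < 1, x^2 <= x^\<rho> and y
  <= y^(\<rho>/2). The remainders add up to at most 9 x^2 + 4 y; the factor 16 is merely
  generous.\<close>

lemma second_difference_bound:
  fixes b x y \<rho> :: real
  assumes "0 < b" "b < 1" "0 \<le> x" "0 \<le> y" "0 < \<rho>" "\<rho> \<le> 2"
  shows "\<bar>((1 + x)\<^sup>2) powr (- b) - 2 * (1 + x + y) powr (- b) + 1\<bar> \<le> 16 * (x powr \<rho> + y powr (\<rho> / 2))"
proof -
  have eq: "(1 + x)\<^sup>2 = 1 + (2 * x + x\<^sup>2)" "1 + x + y = 1 + (x + y)"
    by (auto simp: power2_eq_square algebra_simps)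
  have u: "(1 + (2 * x + x\<^sup>2)) powr (- b) \<le> 1" "(1 + (x + y)) powr (- b) \<le> 1"
    using assms by (auto intro!: one_plus_powr_minus_le_1)
  show ?thesis
  proof (cases "x < 1 \<and> y < 1")
    case True
    have xx: "x\<^sup>2 \<le> x" "y\<^sup>2 \<le> y" using True assms by (simp_all add: power2_eq_square mult_left_le)
    have xp: "x\<^sup>2 \<le> x powr \<rho>"
      using True assms powr_mono'[of \<rho> 2 x] by (simp add: powr_numeral)
    have yp: "y \<le> y powr (\<rho> / 2)"
      using True assms powr_mono'[of "\<rho>/2" 1 y] by simp
    have l: "1 - b * (2 * x + x\<^sup>2) \<le> (1 + (2 * x + x\<^sup>2)) powr (- b)" "1 - b * (x + y) \<le> (1 + (x + y)) powr (- b)"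
      using assms by (auto intro!: one_minus_le_powr_minus)
    have coeff: "b * (b + 1) / 2 * s \<le> s" if "0 \<le> s" for s
    proof -
      have "b * (b + 1) \<le> 1 * 2" using assms by (intro mult_mono) auto
      then show ?thesis using that assms by (intro mult_left_le_one_le) auto
    qed
    have "(2 * x + x\<^sup>2)\<^sup>2 \<le> (3 * x)\<^sup>2"
      using xx assms by (intro power_mono) auto
    then have r1: "(1 + (2 * x + x\<^sup>2)) powr (- b) \<le> 1 - b * (2 * x + x\<^sup>2) + 9 * x\<^sup>2"
      using powr_minus_le_Taylor2[of "2 * x + x\<^sup>2" b] coeff[of "(2 * x + x\<^sup>2)\<^sup>2"] assms
      by (simp add: power_mult_distrib)
    have "(x + y)\<^sup>2 \<le> 2 * x\<^sup>2 + 2 * y\<^sup>2"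
      using sum_squares_bound[of x y] by (simp add: power2_sum)
    then have r2: "(1 + (x + y)) powr (- b) \<le> 1 - b * (x + y) + 2 * x\<^sup>2 + 2 * y"
      using powr_minus_le_Taylor2[of "x + y" b] coeff[of "(x + y)\<^sup>2"] assms xx by simp
    have b: "0 \<le> b * y" "b * y \<le> y" "0 \<le> b * x\<^sup>2" "b * x\<^sup>2 \<le> x\<^sup>2"
      using assms by (auto intro!: mult_left_le_one_le)
    have lin: "b * (2 * x + x\<^sup>2) = 2 * (b * x) + b * x\<^sup>2" "b * (x + y) = b * x + b * y"
      by (auto simp: algebra_simps)
    have "\<bar>(1 + (2 * x + x\<^sup>2)) powr - b - 2 * (1 + (x + y)) powr - b + 1\<bar> \<le> 9 * x\<^sup>2 + 4 * y"
    proof (rule abs_leI)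
      show "(1 + (2 * x + x\<^sup>2)) powr - b - 2 * (1 + (x + y)) powr - b + 1 \<le> 9 * x\<^sup>2 + 4 * y"
        using l(2) r1 b assms(4) zero_le_power2[of x] unfolding lin by linarith
      show "- ((1 + (2 * x + x\<^sup>2)) powr - b - 2 * (1 + (x + y)) powr - b + 1) \<le> 9 * x\<^sup>2 + 4 * y"
        using l(1) r2 b assms(4) zero_le_power2[of x] unfolding lin by linarith
    qed
    also have "\<dots> \<le> 16 * x powr \<rho> + 16 * y powr (\<rho> / 2)"
      using xp yp assms(4) zero_le_power2[of x] by (intro add_mono) linarith+
    finally show ?thesis unfolding eq by (simp add: distrib_left)
  next
    case False
    then have "1 \<le> x powr \<rho> + y powr (\<rho> / 2)"
      using assms ge_one_powr_ge_zero[of x \<rho>] ge_one_powr_ge_zero[of y "\<rho>/2"]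
      by (smt (verit) powr_ge_zero half_gt_zero)
    moreover have "\<bar>(1 + (2 * x + x\<^sup>2)) powr (- b) - 2 * (1 + (x + y)) powr (- b) + 1\<bar> \<le> 2"
      using u powr_ge_zero[of "1 + (2 * x + x\<^sup>2)" "-b"] powr_ge_zero[of "1 + (x + y)" "-b"] by linarith
    ultimately show ?thesis unfolding eq by argo
  qed
qed

text \<open>For unit vectors 2 \<eta> . (\<xi> + \<eta>) = |\<xi> + \<eta>|^2, so the mixed term of
  the square is again a multiple of |\<xi> + \<eta>|^2. The value is symmetric in \<xi> and \<eta>,
  so the two middle terms of the second difference coincide.\<close>

lemma norm_combination_sphere:
  fixes \<xi> \<eta> :: "'a::real_inner"
  assumes "norm \<xi> = 1" "norm \<eta> = 1"
  shows "(norm (s *\<^sub>R (\<xi> + \<eta>) + h *\<^sub>R \<eta>))\<^sup>2 = h\<^sup>2 + s * (s + h) * (norm (\<xi> + \<eta>))\<^sup>2"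
proof -
  have "\<xi> \<bullet> \<xi> = 1" "\<eta> \<bullet> \<eta> = 1" using assms by (auto simp: dot_square_norm)
  then show ?thesis
    unfolding power2_norm_eq_inner
    by (simp add: inner_simps inner_commute algebra_simps power2_eq_square)
qed

text \<open>With \<open>r = norm (\<xi> + \<eta>)\<close> at most 2, passing from x and y to h / (s
  r) costs a factor 1 + 2^\<rho>. The constants are 9 = 3 (1 + 2) for \<rho> <= 1 and 80 = 16 (1 +
  4) for \<rho> <= 2.\<close>

lemma riesz_difference_bounds:
  fixes \<xi> \<eta> :: "'a::real_inner" and \<beta> \<rho> s h :: real
  assumes \<beta>: "0 < \<beta>" "\<beta> < 2" and sh: "0 < s" "0 < h"
    and sph: "norm \<xi> = 1" "norm \<eta> = 1" and nz: "\<xi> + \<eta> \<noteq> 0" and \<rho>: "0 < \<rho>"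
  defines "f \<equiv> \<lambda>x::'a. norm x powr (- \<beta>)"
  defines "R \<equiv> h powr \<rho> * (s powr (- (\<beta> + \<rho>)) * norm (\<xi> + \<eta>) powr (- (\<beta> + \<rho>)))"
  shows "\<rho> \<le> 1 \<Longrightarrow> \<bar>f (s *\<^sub>R (\<xi> + \<eta>) + h *\<^sub>R (\<xi> + \<eta>)) - f (s *\<^sub>R (\<xi> + \<eta>) + h *\<^sub>R \<eta>)\<bar> \<le> 9 * R"
    and "\<rho> \<le> 2 \<Longrightarrow> \<bar>f (s *\<^sub>R (\<xi> + \<eta>) + h *\<^sub>R (\<xi> + \<eta>)) - f (s *\<^sub>R (\<xi> + \<eta>) + h *\<^sub>R \<xi>)
                 - f (s *\<^sub>R (\<xi> + \<eta>) + h *\<^sub>R \<eta>) + f (s *\<^sub>R (\<xi> + \<eta>))\<bar> \<le> 80 * R"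
proof -
  define r where "r = norm (\<xi> + \<eta>)"
  define m where "m = (s * r)\<^sup>2"
  define x where "x = h / s"
  define y where "y = h\<^sup>2 / m"
  define b where "b = \<beta> / 2"
  have r: "0 < r" "r \<le> 2"
    using nz norm_triangle_ineq[of \<xi> \<eta>] sph by (auto simp: r_def)
  have m: "0 < m" using r sh by (simp add: m_def)
  have xy: "0 \<le> x" "0 \<le> y" using sh m by (auto simp: x_def y_def)
  have b: "0 < b" "b < 1" using \<beta> by (auto simp: b_def)
  have f: "f z = ((norm z)\<^sup>2) powr (-b)" for z
    by (cases "z = 0") (simp_all add: f_def b_def powr_powr flip: powr_numeral)
  have f1: "f (s *\<^sub>R (\<xi> + \<eta>) + h *\<^sub>R (\<xi> + \<eta>)) = m powr (-b) * ((1 + x)\<^sup>2) powr (-b)"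
  proof -
    have "(norm (s *\<^sub>R (\<xi> + \<eta>) + h *\<^sub>R (\<xi> + \<eta>)))\<^sup>2 = ((s + h) * r)\<^sup>2"
      using sh by (simp add: r_def flip: scaleR_add_left)
    also have "\<dots> = m * (1 + x)\<^sup>2"
      using sh by (simp add: m_def x_def power2_eq_square field_simps)
    finally show ?thesis using m by (simp add: f powr_mult)
  qed
  have mxy: "h\<^sup>2 + s * (s + h) * r\<^sup>2 = m * (1 + x + y)"
    using sh r by (simp add: m_def x_def y_def power2_eq_square field_simps)
  have f2: "f (s *\<^sub>R (\<xi> + \<eta>) + h *\<^sub>R \<eta>) = m powr (-b) * (1 + x + y) powr (-b)"
    using m mxy xy norm_combination_sphere[OF sph, of s h] by (simp add: f r_def powr_mult)
  have f3: "f (s *\<^sub>R (\<xi> + \<eta>) + h *\<^sub>R \<xi>) = m powr (-b) * (1 + x + y) powr (-b)"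
    using m mxy xy norm_combination_sphere[OF sph(2,1), of s h] by (simp add: f r_def powr_mult add.commute[of \<xi>])
  have f4: "f (s *\<^sub>R (\<xi> + \<eta>)) = m powr (-b)"
    using sh by (simp add: f m_def r_def power_mult_distrib)
  have bd: "m powr (-b) * (x powr \<rho> + y powr (\<rho> / 2)) \<le> (1 + 2 powr \<rho>) * R"
  proof -
    have mb: "m powr (-b) = s powr (-\<beta>) * r powr (-\<beta>)"
      using sh r by (simp add: m_def b_def powr_powr powr_mult flip: powr_numeral)
    have yb: "y powr (\<rho> / 2) = h powr \<rho> * (s powr (-\<rho>) * r powr (-\<rho>))"
    proof -
      have "y = (h * (1 / (s * r))) powr 2" using sh r by (simp add: y_def m_def powr_numeral power_mult_distrib power_divide)
      then have "y powr (\<rho> / 2) = (h * (1 / (s * r))) powr \<rho>" by (simp add: powr_powr)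
      then show ?thesis using sh r by (simp add: powr_mult powr_divide powr_minus_divide)
    qed
    \<comment> \<open>x = h / s has no factor 1 / r; inserting one, to match the power of y, costs
      r^\<rho>.\<close>
    have xb: "x powr \<rho> = r powr \<rho> * (h powr \<rho> * (s powr (-\<rho>) * r powr (-\<rho>)))"
      using sh r by (simp add: x_def powr_divide powr_minus_divide)
    have "m powr (-b) * (x powr \<rho> + y powr (\<rho> / 2)) = (1 + r powr \<rho>) * R"
      unfolding mb yb xb R_def r_def[symmetric] minus_add_distrib powr_add by (simp add: algebra_simps)
    also have "\<dots> \<le> (1 + 2 powr \<rho>) * R"
      using r \<rho> by (intro mult_right_mono add_left_mono powr_mono2) (auto simp: R_def)
    finally show ?thesis .
  qed
  have R0: "0 \<le> R" by (simp add: R_def)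
  show "\<bar>f (s *\<^sub>R (\<xi> + \<eta>) + h *\<^sub>R (\<xi> + \<eta>)) - f (s *\<^sub>R (\<xi> + \<eta>) + h *\<^sub>R \<eta>)\<bar> \<le> 9 * R" if "\<rho> \<le> 1"
  proof -
    have "\<bar>f (s *\<^sub>R (\<xi> + \<eta>) + h *\<^sub>R (\<xi> + \<eta>)) - f (s *\<^sub>R (\<xi> + \<eta>) + h *\<^sub>R \<eta>)\<bar>
        = m powr (-b) * \<bar>((1 + x)\<^sup>2) powr (- b) - (1 + x + y) powr (- b)\<bar>"
      unfolding f1 f2 by (simp add: abs_mult flip: right_diff_distrib)
    also have "\<dots> \<le> m powr (-b) * (3 * (x powr \<rho> + y powr (\<rho> / 2)))"
      using first_difference_bound[OF b xy \<rho> that] by (intro mult_left_mono) auto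
    also have "\<dots> \<le> 3 * ((1 + 2 powr \<rho>) * R)"
      using mult_left_mono[OF bd, of 3] by (simp only: mult.left_commute[of "m powr -b" 3])
    also have "\<dots> \<le> 3 * ((1 + 2 powr 1) * R)"
      using that R0 by (intro mult_left_mono mult_right_mono add_left_mono powr_mono) auto
    finally show ?thesis by simp
  qed
  show "\<bar>f (s *\<^sub>R (\<xi> + \<eta>) + h *\<^sub>R (\<xi> + \<eta>)) - f (s *\<^sub>R (\<xi> + \<eta>) + h *\<^sub>R \<xi>)
                 - f (s *\<^sub>R (\<xi> + \<eta>) + h *\<^sub>R \<eta>) + f (s *\<^sub>R (\<xi> + \<eta>))\<bar> \<le> 80 * R" if "\<rho> \<le> 2"
  proof -
    have "\<bar>f (s *\<^sub>R (\<xi> + \<eta>) + h *\<^sub>R (\<xi> + \<eta>)) - f (s *\<^sub>R (\<xi> + \<eta>) + h *\<^sub>R \<xi>)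
                 - f (s *\<^sub>R (\<xi> + \<eta>) + h *\<^sub>R \<eta>) + f (s *\<^sub>R (\<xi> + \<eta>))\<bar>
        = \<bar>m powr (-b) * (((1 + x)\<^sup>2) powr (- b) - 2 * (1 + x + y) powr (- b) + 1)\<bar>"
      unfolding f1 f2 f3 f4 by (simp add: algebra_simps)
    also have "\<dots> = m powr (-b) * \<bar>((1 + x)\<^sup>2) powr (- b) - 2 * (1 + x + y) powr (- b) + 1\<bar>"
      by (simp add: abs_mult)
    also have "\<dots> \<le> m powr (-b) * (16 * (x powr \<rho> + y powr (\<rho> / 2)))"
      using second_difference_bound[OF b xy \<rho> that] by (intro mult_left_mono) auto
    also have "\<dots> \<le> 16 * ((1 + 2 powr \<rho>) * R)"
      using mult_left_mono[OF bd, of 16] by (simp only: mult.left_commute[of "m powr -b" 16])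
    also have "\<dots> \<le> 16 * ((1 + 2 powr 2) * R)"
      using that R0 by (intro mult_left_mono mult_right_mono add_left_mono powr_mono) auto
    finally show ?thesis by (simp add: powr_numeral)
  qed
qed

text \<open>The bound separates the variables: a supremum over \<eta> of the \<xi>-integral, the
  total mass of the sphere, and the integral of s^(k - p), finite because k - p > -1. None of the
  three depends on \<open>h\<close>. The abstract \<open>G\<close> and \<open>k\<close> let first
  and second differences share the argument.\<close>

lemma triple_sphere_integral_bound:
  fixes G :: "real \<Rightarrow> real \<Rightarrow> real^3 \<Rightarrow> real^3 \<Rightarrow> real"
  assumes T: "0 < T" and p: "0 < p" "p < 2" and k: "1 \<le> k" and K: "0 < K"
    and bound: "\<And>h s \<eta> \<xi>. \<lbrakk>0 < h; 0 < s; norm \<eta> = 1; norm \<xi> = 1; \<xi> + \<eta> \<noteq> 0\<rbrakk>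
      \<Longrightarrow> G h s \<eta> \<xi> \<le> K * (h powr \<rho> * (s powr (- p) * norm (\<xi> + \<eta>) powr (- p)))"
  shows "\<exists>C::real. \<forall>h. 0 < h \<and> h \<le> 1 \<longrightarrow>
    (\<integral>\<^sup>+ s \<in> {0..T}. (\<integral>\<^sup>+ \<eta>. (\<integral>\<^sup>+ \<xi>. ennreal (G h s \<eta> \<xi> * s ^ k) \<partial>sphere_measure) \<partial>sphere_measure) \<partial>lborel)
      \<le> ennreal (C * h powr \<rho>)"
proof -
  obtain M where M: "M < \<infinity>"
    "\<And>\<eta>. norm \<eta> = 1 \<Longrightarrow> (\<integral>\<^sup>+ \<xi>. inverse (ennreal (norm (\<xi> + \<eta>) powr p)) \<partial>sphere_measure) \<le> M"
    using nn_integral_sphere_measure_powr_bounded[OF p] by blast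
  define A where "A = emeasure sphere_measure UNIV"
  define J where "J = (\<integral>\<^sup>+ s \<in> {0..T}. ennreal (s powr (k - p)) \<partial>lborel)"
  have J: "J < \<infinity>"
  proof -
    have "J = ennreal (T powr (k - p + 1) / (k - p + 1))"
      unfolding J_def
      using T k p by (intro nn_integral_has_integral_lebesgue' has_integral_powr_from_0) auto
    then show ?thesis by simp
  qed
  have sp: "space sphere_measure = UNIV" by (simp add: sphere_measure_def)
  have inner: "(\<integral>\<^sup>+ \<eta>. (\<integral>\<^sup>+ \<xi>. ennreal (G h s \<eta> \<xi> * s ^ k) \<partial>sphere_measure) \<partial>sphere_measure)
      \<le> ennreal (K * h powr \<rho> * s powr (k - p)) * (M * A)" if h: "0 < h" and s: "0 \<le> s" for h s
  proof (cases "s = 0")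
    case True
    \<comment> \<open>At s = 0, where no bound on \<open>G\<close> is assumed, the factor
      \<open>s ^ k\<close> vanishes since k >= 1.\<close>
    then show ?thesis using k by (simp add: power_0_left)
  next
    case False
    with s have s: "0 < s" by simp
    let ?c = "ennreal (K * h powr \<rho> * s powr (k - p))"
    have 1: "(\<integral>\<^sup>+ \<xi>. ennreal (G h s \<eta> \<xi> * s ^ k) \<partial>sphere_measure) \<le> ?c * M" if \<eta>: "norm \<eta> = 1" for \<eta>
    proof -
      have "(\<integral>\<^sup>+ \<xi>. ennreal (G h s \<eta> \<xi> * s ^ k) \<partial>sphere_measure)
          \<le> (\<integral>\<^sup>+ \<xi>. ?c * inverse (ennreal (norm (\<xi> + \<eta>) powr p)) \<partial>sphere_measure)"
        using AE_sphere_measure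
      proof (intro nn_integral_mono_AE, eventually_elim)
        case (elim \<xi>)
        show ?case
        proof (cases "\<xi> + \<eta> = 0")
          case True
          have "0 < K * h powr \<rho> * s powr (k - p)" using K h s by simp
          then have "?c \<noteq> 0" by (metis ennreal_eq_0_iff not_le)
          then show ?thesis using True by (simp add: ennreal_mult_top)
        next
          case nz: False
          have "G h s \<eta> \<xi> * s ^ k \<le> K * (h powr \<rho> * (s powr (- p) * norm (\<xi> + \<eta>) powr (- p))) * s ^ k"
            using bound[OF h s \<eta> elim(2) nz] s by (intro mult_right_mono) auto
          also have "\<dots> = K * h powr \<rho> * s powr (k - p) * inverse (norm (\<xi> + \<eta>) powr p)"
            using s by (simp add: powr_diff powr_minus powr_realpow divide_simps)
          finally have "ennreal (G h s \<eta> \<xi> * s ^ k) \<le> ennreal (K * h powr \<rho> * s powr (k - p) * inverse (norm (\<xi> + \<eta>) powr p))"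
            by (rule ennreal_leI)
          also have "\<dots> = ?c * inverse (ennreal (norm (\<xi> + \<eta>) powr p))"
            using nz K by (simp add: inverse_ennreal ennreal_mult)
          finally show ?thesis .
        qed
      qed
      also have "\<dots> = ?c * (\<integral>\<^sup>+ \<xi>. inverse (ennreal (norm (\<xi> + \<eta>) powr p)) \<partial>sphere_measure)"
        by (intro nn_integral_cmult) auto
      also have "\<dots> \<le> ?c * M"
        using M(2)[OF \<eta>] by (intro mult_left_mono) auto
      finally show ?thesis .
    qed
    have "(\<integral>\<^sup>+ \<eta>. (\<integral>\<^sup>+ \<xi>. ennreal (G h s \<eta> \<xi> * s ^ k) \<partial>sphere_measure) \<partial>sphere_measure)
        \<le> (\<integral>\<^sup>+ \<eta>. ?c * M \<partial>sphere_measure)"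
      using AE_sphere_measure by (intro nn_integral_mono_AE, eventually_elim) (rule 1)
    also have "\<dots> = ?c * (M * A)"
      by (simp add: A_def sp mult.assoc)
    finally show ?thesis .
  qed
  define C where "C = K * enn2real (J * (M * A))"
  have fin: "J * (M * A) < \<infinity>"
    using J M emeasure_sphere_measure_finite by (simp add: A_def ennreal_mult_less_top)
  have "(\<integral>\<^sup>+ s \<in> {0..T}. (\<integral>\<^sup>+ \<eta>. (\<integral>\<^sup>+ \<xi>. ennreal (G h s \<eta> \<xi> * s ^ k) \<partial>sphere_measure) \<partial>sphere_measure) \<partial>lborel)
      \<le> ennreal (C * h powr \<rho>)" if h: "0 < h" for h
  proof -
    have "(\<integral>\<^sup>+ s \<in> {0..T}. (\<integral>\<^sup>+ \<eta>. (\<integral>\<^sup>+ \<xi>. ennreal (G h s \<eta> \<xi> * s ^ k) \<partial>sphere_measure) \<partial>sphere_measure) \<partial>lborel)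
      \<le> (\<integral>\<^sup>+ s. ennreal (K * h powr \<rho>) * (M * A) * (ennreal (s powr (k - p)) * indicator {0..T} s) \<partial>lborel)"
      using inner[OF h] K by (intro nn_integral_mono)
        (auto simp: indicator_def ennreal_mult mult_ac)
    also have "\<dots> = ennreal (K * h powr \<rho>) * (M * A) * J"
      unfolding J_def by (intro nn_integral_cmult) auto
    also have "\<dots> = ennreal (K * h powr \<rho>) * (J * (M * A))"
      by (simp add: mult_ac)
    also have "J * (M * A) = ennreal (enn2real (J * (M * A)))"
      using fin by simp
    also have "ennreal (K * h powr \<rho>) * ennreal (enn2real (J * (M * A))) = ennreal (C * h powr \<rho>)"
      using K unfolding C_def by (subst ennreal_mult[symmetric]) (auto simp: mult_ac)
    finally show ?thesis .
  qed
  then show ?thesis by blast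
qed

section \<open>Fourier transforms of Schwartz functions\<close>

lemma schwartz_fun_partial_deriv:
  assumes "schwartz_fun \<phi>"
  shows "schwartz_fun (partial_deriv j \<phi>)"
proof -
  have "foldr partial_deriv js (partial_deriv j \<phi>) = foldr partial_deriv (js @ [j]) \<phi>" for js
    by simp
  then show ?thesis
    using assms unfolding schwartz_fun_def by metis
qed

lemma schwartz_fun_has_derivative:
  assumes "schwartz_fun \<phi>"
  shows "(\<phi> has_derivative frechet_derivative \<phi> (at x)) (at x)"
  using assms unfolding schwartz_fun_def
  by (metis foldr_Nil frechet_derivative_works id_apply)

lemma schwartz_fun_continuous:
  assumes "schwartz_fun \<phi>"
  shows "continuous_on UNIV \<phi>"
  using schwartz_fun_has_derivative[OF assms]
  by (meson continuous_at_imp_continuous_on has_derivative_continuous)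

lemma schwartz_fun_measurable:
  assumes "schwartz_fun \<phi>"
  shows "\<phi> \<in> borel_measurable borel"
  using schwartz_fun_continuous[OF assms] by (rule borel_measurable_continuous_onI)

lemma one_plus_square_power_bound:
  fixes a :: real
  assumes "0 \<le> a"
  shows "(1 + a\<^sup>2) ^ k \<le> 2 ^ k * (1 + a ^ (2 * k))"
proof (cases "a \<le> 1")
  case True
  then have "a\<^sup>2 \<le> 1" using assms by (simp add: power_le_one)
  then have "(1 + a\<^sup>2) ^ k \<le> 2 ^ k" by (intro power_mono) auto
  also have "\<dots> \<le> 2 ^ k * (1 + a ^ (2 * k))" using assms by simp
  finally show ?thesis .
next
  case False
  then have "1 \<le> a\<^sup>2" by (simp add: one_le_power)
  then have "(1 + a\<^sup>2) ^ k \<le> (2 * a\<^sup>2) ^ k" by (intro power_mono) auto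
  also have "\<dots> = 2 ^ k * a ^ (2 * k)" by (simp add: power_mult_distrib power_mult)
  also have "\<dots> \<le> 2 ^ k * (1 + a ^ (2 * k))" by simp
  finally show ?thesis .
qed

lemma schwartz_fun_decay:
  assumes "schwartz_fun \<phi>"
  obtains C where "0 \<le> C" "\<And>x. norm (\<phi> x) \<le> C / (1 + (norm x)\<^sup>2) ^ k"
proof -
  have "\<exists>C. \<forall>x. norm x ^ n * norm (\<phi> x) \<le> C" for n
    using assms unfolding schwartz_fun_def by (metis foldr_Nil id_apply)
  then obtain B where B: "\<And>n x. norm x ^ n * norm (\<phi> x) \<le> B n" by metis
  define C where "C = 2 ^ k * (B 0 + B (2 * k))"
  have "norm (\<phi> x) \<le> C / (1 + (norm x)\<^sup>2) ^ k" for x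
  proof -
    have "(1 + (norm x)\<^sup>2) ^ k * norm (\<phi> x) \<le> 2 ^ k * (1 + norm x ^ (2 * k)) * norm (\<phi> x)"
      by (intro mult_right_mono one_plus_square_power_bound) auto
    also have "\<dots> = 2 ^ k * (norm x ^ 0 * norm (\<phi> x) + norm x ^ (2 * k) * norm (\<phi> x))"
      by (simp add: algebra_simps)
    also have "\<dots> \<le> C"
      unfolding C_def by (intro mult_left_mono add_mono B) auto
    finally show ?thesis
      by (simp add: pos_le_divide_eq add_pos_nonneg mult.commute)
  qed
  moreover have "0 \<le> C"
  proof -
    have "0 \<le> B n" for n using order_trans[OF _ B[of 0 n]] by simp
    then show ?thesis by (simp add: C_def)
  qed
  ultimately show ?thesis by (rule that[rotated])
qed

lemma integrable_one_plus_norm_square_power: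
  assumes "DIM('a) < 2 * k"
  shows "integrable lborel (\<lambda>x::'a::euclidean_space. C / (1 + (norm x)\<^sup>2) ^ k)"
proof -
  have "integrable lborel (\<lambda>x::'a. (1 + (norm x)\<^sup>2) powr (- real k))"
  proof (rule integrableI_nonneg)
    show "(\<integral>\<^sup>+ x. ennreal ((1 + (norm (x::'a))\<^sup>2) powr - real k) \<partial>lborel) < \<infinity>"
      using assms by (intro nn_integral_one_plus_norm_square_powr_finite) linarith
  qed auto
  then have "integrable lborel (\<lambda>x::'a. C * (1 + (norm x)\<^sup>2) powr (- real k))"
    by (rule integrable_mult_right)
  moreover have "C * (1 + (norm x)\<^sup>2) powr (- real k) = C / (1 + (norm x)\<^sup>2) ^ k" for x :: 'a
    by (simp add: powr_minus powr_realpow add_pos_nonneg divide_inverse)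
  ultimately show ?thesis by simp
qed

lemma schwartz_fun_integrable:
  fixes \<phi> :: "real^'n::finite \<Rightarrow> complex"
  assumes "schwartz_fun \<phi>"
  shows "integrable lborel \<phi>"
proof -
  obtain C where "0 \<le> C" and C: "\<And>x. norm (\<phi> x) \<le> C / (1 + (norm x)\<^sup>2) ^ CARD('n)"
    using schwartz_fun_decay[OF assms] by metis
  show ?thesis
  proof (rule Bochner_Integration.integrable_bound)
    show "integrable lborel (\<lambda>x::real^'n. C / (1 + (norm x)\<^sup>2) ^ CARD('n))"
      by (rule integrable_one_plus_norm_square_power) simp
    show "AE x in lborel. norm (\<phi> x) \<le> norm (C / (1 + (norm x)\<^sup>2) ^ CARD('n))"
      using C \<open>0 \<le> C\<close> by simp
  qed (use schwartz_fun_measurable[OF assms] in simp)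
qed

lemma integrable_times_exp_ii:
  fixes \<phi> :: "'a::euclidean_space \<Rightarrow> complex"
  assumes "integrable lborel \<phi>"
  shows "integrable lborel (\<lambda>x. \<phi> x * exp (- \<i> * complex_of_real (\<xi> \<bullet> x)))"
proof (rule Bochner_Integration.integrable_bound[OF integrable_norm[OF assms]])
  show "(\<lambda>x. \<phi> x * exp (- \<i> * complex_of_real (\<xi> \<bullet> x))) \<in> borel_measurable lborel"
    using assms by (intro borel_measurable_times) (auto simp: borel_measurable_integrable)
  show "AE x in lborel. norm (\<phi> x * exp (- \<i> * complex_of_real (\<xi> \<bullet> x))) \<le> norm (norm (\<phi> x))"
    by (simp add: norm_mult norm_exp_eq_Re)
qed

lemma norm_fourier_le:
  "norm (fourier \<phi> \<xi>) \<le> (LINT x|lborel. norm (\<phi> x))"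
proof -
  have "norm (fourier \<phi> \<xi>) \<le> (LINT x|lborel. norm (\<phi> x * exp (- \<i> * complex_of_real (\<xi> \<bullet> x))))"
    unfolding fourier_def by (rule integral_norm_bound)
  then show ?thesis
    by (simp add: norm_mult norm_exp_eq_Re)
qed

lemma integral_lborel_translate:
  fixes f :: "'a::euclidean_space \<Rightarrow> 'b::{banach, second_countable_topology}"
  assumes [measurable]: "f \<in> borel_measurable borel"
  shows "(LINT x|lborel. f (x + t)) = (LINT x|lborel. f x)"
proof -
  have "(LINT x|lborel. f x) = (LINT x|distr lborel borel ((+) t). f x)"
    by (simp add: lborel_distr_plus)
  also have "\<dots> = (LINT x|lborel. f (t + x))"
    by (rule integral_distr) auto
  finally show ?thesis by (simp add: add.commute)
qed

lemma fourier_translate: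
  fixes \<phi> :: "real^'n::finite \<Rightarrow> complex"
  assumes [measurable]: "\<phi> \<in> borel_measurable borel"
  shows "fourier (\<lambda>x. \<phi> (x + t)) \<xi> = exp (\<i> * complex_of_real (\<xi> \<bullet> t)) * fourier \<phi> \<xi>"
proof -
  have "fourier (\<lambda>x. \<phi> (x + t)) \<xi> =
     (LINT x|lborel. exp (\<i> * complex_of_real (\<xi> \<bullet> t)) * (\<phi> (x + t) * exp (- \<i> * complex_of_real (\<xi> \<bullet> (x + t)))))"
    unfolding fourier_def
    by (intro Bochner_Integration.integral_cong refl)
       (simp add: inner_add_right algebra_simps flip: exp_add)
  also have "\<dots> = exp (\<i> * complex_of_real (\<xi> \<bullet> t)) * (LINT x|lborel. (\<phi> (x + t) * exp (- \<i> * complex_of_real (\<xi> \<bullet> (x + t)))))"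
    by simp
  also have "(LINT x|lborel. (\<phi> (x + t) * exp (- \<i> * complex_of_real (\<xi> \<bullet> (x + t))))) = fourier \<phi> \<xi>"
    unfolding fourier_def by (intro integral_lborel_translate[where t=t]) measurable
  finally show ?thesis .
qed

text \<open>The difference quotients of \<open>\<phi>\<close> are dominated by an integrable function, so the
  transform of the partial derivative is the derivative of the transform of the translates.\<close>

lemma fourier_partial_deriv:
  fixes \<phi> :: "real^'n::finite \<Rightarrow> complex"
  assumes \<phi>: "schwartz_fun \<phi>"
  shows "fourier (partial_deriv j \<phi>) \<xi> = \<i> * complex_of_real (\<xi> $ j) * fourier \<phi> \<xi>"
proof -
  let ?e = "axis j 1 :: real^'n"
  let ?E = "\<lambda>x. exp (- \<i> * complex_of_real (\<xi> \<bullet> x))"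
  define h where "h n = 1 / real (Suc n)" for n
  have h: "0 < h n" "h n \<le> 1" "h n \<noteq> 0" for n by (auto simp: h_def)
  have h0: "h \<longlonglongrightarrow> 0" unfolding h_def using LIMSEQ_inverse_real_of_nat by (simp add: inverse_eq_divide)
  have [measurable]: "\<phi> \<in> borel_measurable borel" by (rule schwartz_fun_measurable[OF \<phi>])
  define q where "q n x = (\<phi> (x + h n *\<^sub>R ?e) - \<phi> x) / complex_of_real (h n)" for n x
  obtain C where C: "0 \<le> C" "\<And>x. norm (partial_deriv j \<phi> x) \<le> C / (1 + (norm x)\<^sup>2) ^ CARD('n)"
    using schwartz_fun_decay[OF schwartz_fun_partial_deriv[OF \<phi>]] by metis
  have deriv: "((\<lambda>t. \<phi> (x + t *\<^sub>R ?e)) has_vector_derivative partial_deriv j \<phi> (x + t *\<^sub>R ?e)) (at t)" for x t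
  proof -
    have "((\<lambda>t. \<phi> (x + t *\<^sub>R ?e)) has_derivative (\<lambda>s. frechet_derivative \<phi> (at (x + t *\<^sub>R ?e)) (s *\<^sub>R ?e))) (at t)"
      by (rule has_derivative_compose[OF _ schwartz_fun_has_derivative[OF \<phi>]])
         (auto intro!: derivative_eq_intros)
    moreover have "linear (frechet_derivative \<phi> (at (x + t *\<^sub>R ?e)))"
      using schwartz_fun_has_derivative[OF \<phi>] by (rule has_derivative_linear)
    ultimately show ?thesis
      unfolding has_vector_derivative_def partial_deriv_def by (simp add: linear_scale)
  qed
  have lim: "(\<lambda>n. q n x) \<longlonglongrightarrow> partial_deriv j \<phi> x" for x
  proof -
    have "((\<lambda>t. norm (\<phi> (x + t *\<^sub>R ?e) - \<phi> x - t *\<^sub>R partial_deriv j \<phi> x) / norm t) \<longlongrightarrow> 0) (at 0)"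
      using deriv[of x 0] unfolding has_vector_derivative_def has_derivative_at by simp
    then have "(\<lambda>n. norm (\<phi> (x + h n *\<^sub>R ?e) - \<phi> x - h n *\<^sub>R partial_deriv j \<phi> x) / norm (h n)) \<longlonglongrightarrow> 0"
      by (rule filterlim_compose) (use h(3) h0 in \<open>auto simp: filterlim_at intro!: always_eventually\<close>)
    moreover have "norm (\<phi> (x + h n *\<^sub>R ?e) - \<phi> x - h n *\<^sub>R partial_deriv j \<phi> x) / norm (h n) = norm (q n x - partial_deriv j \<phi> x)" for n
    proof -
      have "\<phi> (x + h n *\<^sub>R ?e) - \<phi> x - h n *\<^sub>R partial_deriv j \<phi> x = complex_of_real (h n) * (q n x - partial_deriv j \<phi> x)"
        using h(3)[of n]
        by (simp add: q_def scaleR_conv_of_real[of _ "partial_deriv j \<phi> x"] right_diff_distrib[of _ "_ / _"])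
      then show ?thesis using h(1)[of n] by (simp add: norm_mult)
    qed
    ultimately have "(\<lambda>n. norm (q n x - partial_deriv j \<phi> x)) \<longlonglongrightarrow> 0" by simp
    then show ?thesis by (simp add: LIM_zero_cancel tendsto_norm_zero_iff)
  qed
  have bound: "norm (q n x) \<le> C * 3 ^ CARD('n) / (1 + (norm x)\<^sup>2) ^ CARD('n)" for n x
  proof -
    let ?B = "C * 3 ^ CARD('n) / (1 + (norm x)\<^sup>2) ^ CARD('n)"
    have pd: "norm (partial_deriv j \<phi> (x + t *\<^sub>R ?e)) \<le> ?B" if "t \<in> {0..1}" for t
    proof -
      \<comment> \<open>A shift by at most 1 changes 1 + |x|^2 by a factor of at most 3; this is the
        3 in the dominating function.\<close>
      have "norm x \<le> norm (x + t *\<^sub>R ?e) + 1"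
        using norm_triangle_ineq4[of "x + t *\<^sub>R ?e" "t *\<^sub>R ?e"] that by simp
      then have "(norm x)\<^sup>2 \<le> (norm (x + t *\<^sub>R ?e) + 1)\<^sup>2"
        by (intro power_mono) auto
      also have "\<dots> \<le> 2 * (norm (x + t *\<^sub>R ?e))\<^sup>2 + 2"
        using sum_squares_bound[of "norm (x + t *\<^sub>R ?e)" 1] by (simp add: power2_sum)
      finally have "1 + (norm x)\<^sup>2 \<le> 3 * (1 + (norm (x + t *\<^sub>R ?e))\<^sup>2)"
        using zero_le_power2[of "norm (x + t *\<^sub>R ?e)"] unfolding distrib_left by linarith
      then have "(1 + (norm x)\<^sup>2) ^ CARD('n) \<le> 3 ^ CARD('n) * (1 + (norm (x + t *\<^sub>R ?e))\<^sup>2) ^ CARD('n)"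
        unfolding power_mult_distrib[symmetric] by (intro power_mono) auto
      then have "C * (1 + (norm x)\<^sup>2) ^ CARD('n) \<le> C * (3 ^ CARD('n) * (1 + (norm (x + t *\<^sub>R ?e))\<^sup>2) ^ CARD('n))"
        using C(1) by (rule mult_left_mono)
      then have "C / (1 + (norm (x + t *\<^sub>R ?e))\<^sup>2) ^ CARD('n) \<le> ?B"
        by (simp add: pos_divide_le_eq pos_le_divide_eq add_pos_nonneg mult.assoc mult.commute mult.left_commute)
      then show ?thesis using C(2)[of "x + t *\<^sub>R ?e"] by linarith
    qed
    have "norm (\<phi> (x + h n *\<^sub>R ?e) - \<phi> (x + 0 *\<^sub>R ?e)) \<le> ?B * norm (h n - 0)"
    proof (rule differentiable_bound[where S="{0..1}" and f'="\<lambda>t s. s *\<^sub>R partial_deriv j \<phi> (x + t *\<^sub>R ?e)"])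
      show "((\<lambda>t. \<phi> (x + t *\<^sub>R ?e)) has_derivative (\<lambda>s. s *\<^sub>R partial_deriv j \<phi> (x + t *\<^sub>R ?e))) (at t within {0..1})" for t
        using deriv[of x t] unfolding has_vector_derivative_def by (rule has_derivative_at_withinI)
      show "onorm (\<lambda>s. s *\<^sub>R partial_deriv j \<phi> (x + t *\<^sub>R ?e)) \<le> ?B" if "t \<in> {0..1}" for t
      proof (rule onorm_le)
        fix s :: real
        show "norm (s *\<^sub>R partial_deriv j \<phi> (x + t *\<^sub>R ?e)) \<le> ?B * norm s"
          using mult_right_mono[OF pd[OF that], of "\<bar>s\<bar>"] by (simp add: mult.commute)
      qed
    qed (use h[of n] in auto)
    then show ?thesis using h(1)[of n]
      by (simp add: q_def norm_divide pos_divide_le_eq)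
  qed
  have q_meas [measurable]: "q n \<in> borel_measurable borel" for n
    unfolding q_def by measurable
  have "(\<lambda>n. fourier (q n) \<xi>) \<longlonglongrightarrow> fourier (partial_deriv j \<phi>) \<xi>"
    unfolding fourier_def
  proof (rule integral_dominated_convergence[where w="\<lambda>x. C * 3 ^ CARD('n) / (1 + (norm x)\<^sup>2) ^ CARD('n)"])
    show "(\<lambda>x. partial_deriv j \<phi> x * ?E x) \<in> borel_measurable lborel"
      using schwartz_fun_measurable[OF schwartz_fun_partial_deriv[OF \<phi>, of j]] by simp
    show "integrable lborel (\<lambda>x::real^'n. C * 3 ^ CARD('n) / (1 + (norm x)\<^sup>2) ^ CARD('n))"
      by (rule integrable_one_plus_norm_square_power) simp
    show "AE x in lborel. (\<lambda>n. q n x * ?E x) \<longlonglongrightarrow> partial_deriv j \<phi> x * ?E x"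
      by (intro AE_I2 tendsto_mult lim tendsto_const)
    show "AE x in lborel. norm (q n x * ?E x) \<le> C * 3 ^ CARD('n) / (1 + (norm x)\<^sup>2) ^ CARD('n)" for n
      using bound by (simp add: norm_mult norm_exp_eq_Re)
  qed measurable
  \<comment> \<open>A translation multiplies the transform by a character, so the limit of these
    quotients is the derivative at 0 of z -> exp (i \<xi>_j z).\<close>
  moreover have "fourier (q n) \<xi> = (exp (\<i> * \<xi> $ j * h n) - 1) / h n * fourier \<phi> \<xi>" for n
  proof -
    have int: "integrable lborel (\<lambda>x. \<phi> x * ?E x)"
      by (intro integrable_times_exp_ii schwartz_fun_integrable \<phi>)
    have "integrable lborel (\<lambda>x. \<phi> (x + h n *\<^sub>R ?e))"
    proof -
      have "integrable (distr lborel borel ((+) (h n *\<^sub>R ?e))) \<phi>"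
        using schwartz_fun_integrable[OF \<phi>] by (simp add: lborel_distr_plus)
      then show ?thesis
        by (subst (asm) integrable_distr_eq) (auto simp: add.commute)
    qed
    then have int': "integrable lborel (\<lambda>x. \<phi> (x + h n *\<^sub>R ?e) * ?E x)"
      by (rule integrable_times_exp_ii)
    have "fourier (q n) \<xi> = (LINT x|lborel. (\<phi> (x + h n *\<^sub>R ?e) * ?E x - \<phi> x * ?E x) / complex_of_real (h n))"
      unfolding fourier_def q_def by (intro Bochner_Integration.integral_cong refl) (simp add: left_diff_distrib)
    also have "\<dots> = (fourier (\<lambda>x. \<phi> (x + h n *\<^sub>R ?e)) \<xi> - fourier \<phi> \<xi>) / h n"
      unfolding fourier_def using int int' by (simp add: Bochner_Integration.integral_diff)
    also have "fourier (\<lambda>x. \<phi> (x + h n *\<^sub>R ?e)) \<xi> = exp (\<i> * complex_of_real (\<xi> \<bullet> (h n *\<^sub>R ?e))) * fourier \<phi> \<xi>"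
      by (rule fourier_translate) measurable
    finally show ?thesis
      by (simp add: inner_axis algebra_simps diff_divide_distrib)
  qed
  moreover have "(\<lambda>n. (exp (\<i> * \<xi> $ j * h n) - 1) / h n * fourier \<phi> \<xi>) \<longlonglongrightarrow> \<i> * complex_of_real (\<xi> $ j) * fourier \<phi> \<xi>"
  proof (intro tendsto_mult tendsto_const)
    have "((\<lambda>z. exp (\<i> * \<xi> $ j * z)) has_field_derivative (\<i> * complex_of_real (\<xi> $ j))) (at 0)"
      by (auto intro!: derivative_eq_intros)
    then have "((\<lambda>z. (exp (\<i> * \<xi> $ j * z) - 1) / z) \<longlongrightarrow> \<i> * complex_of_real (\<xi> $ j)) (at 0)"
      by (simp add: has_field_derivative_iff)
    then show "(\<lambda>n. (exp (\<i> * \<xi> $ j * h n) - 1) / h n) \<longlonglongrightarrow> \<i> * complex_of_real (\<xi> $ j)"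
    proof (rule filterlim_compose)
      show "LIM n sequentially. complex_of_real (h n) :> at 0"
        using h(3) tendsto_of_real[OF h0, where 'a=complex]
        by (auto simp: filterlim_at intro!: always_eventually)
    qed
  qed
  ultimately show ?thesis
    by (simp add: LIMSEQ_unique)
qed

lemma schwartz_fun_partial_deriv_funpow:
  "schwartz_fun \<phi> \<Longrightarrow> schwartz_fun ((partial_deriv j ^^ n) \<phi>)"
  by (induction n) (auto intro: schwartz_fun_partial_deriv)

lemma fourier_partial_deriv_funpow:
  "schwartz_fun \<phi> \<Longrightarrow> fourier ((partial_deriv j ^^ n) \<phi>) \<xi> = (\<i> * complex_of_real (\<xi> $ j)) ^ n * fourier \<phi> \<xi>"
  by (induction n) (simp_all add: fourier_partial_deriv schwartz_fun_partial_deriv_funpow mult.assoc)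

text \<open>Pure derivatives are enough: \<xi>_j^(2k) times the transform is bounded by the L1 norm
  of the 2k-th derivative in direction j, and |\<xi>| <= n |\<xi>_j| for the coordinate of largest
  modulus. That coordinate varies with \<xi>, hence the sum of all \<open>B j\<close> in
  \<open>C\<close>.\<close>

lemma fourier_decay:
  fixes \<phi> :: "real^'n::finite \<Rightarrow> complex"
  assumes \<phi>: "schwartz_fun \<phi>"
  obtains C where "0 \<le> C" "\<And>\<xi>. norm (fourier \<phi> \<xi>) \<le> C / (1 + (norm \<xi>)\<^sup>2) ^ k"
proof -
  define B where "B j = (LINT x|lborel. norm ((partial_deriv j ^^ (2 * k)) \<phi> x))" for j
  define A where "A = (LINT x|lborel. norm (\<phi> x))"
  have B: "0 \<le> B j" "\<bar>\<xi> $ j\<bar> ^ (2 * k) * norm (fourier \<phi> \<xi>) \<le> B j" for j \<xi>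
    using norm_fourier_le[of "(partial_deriv j ^^ (2 * k)) \<phi>" \<xi>]
    by (auto simp: fourier_partial_deriv_funpow[OF \<phi>] norm_mult norm_power B_def)
  have A: "0 \<le> A" "norm (fourier \<phi> \<xi>) \<le> A" for \<xi>
    using norm_fourier_le[of \<phi>] by (auto simp: A_def)
  define C where "C = 2 ^ k * (A + CARD('n) ^ (2 * k) * (\<Sum>j\<in>UNIV. B j))"
  have C0: "0 \<le> C" using A B by (auto simp: C_def intro!: mult_nonneg_nonneg add_nonneg_nonneg sum_nonneg)
  have "norm (fourier \<phi> \<xi>) \<le> C / (1 + (norm \<xi>)\<^sup>2) ^ k" for \<xi>
  proof -
    obtain j where j: "\<And>i. \<bar>\<xi> $ i\<bar> \<le> \<bar>\<xi> $ j\<bar>"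
    proof -
      have "Max (range (\<lambda>i. \<bar>\<xi> $ i\<bar>)) \<in> range (\<lambda>i. \<bar>\<xi> $ i\<bar>)" by (intro Max_in) auto
      then obtain j where "Max (range (\<lambda>i. \<bar>\<xi> $ i\<bar>)) = \<bar>\<xi> $ j\<bar>" by (rule rangeE)
      moreover have "\<bar>\<xi> $ i\<bar> \<le> Max (range (\<lambda>i. \<bar>\<xi> $ i\<bar>))" for i by (intro Max_ge) auto
      ultimately show ?thesis using that by metis
    qed
    have "norm \<xi> \<le> (\<Sum>i\<in>UNIV. \<bar>\<xi> $ i\<bar>)" by (rule norm_le_l1_cart)
    also have "\<dots> \<le> CARD('n) * \<bar>\<xi> $ j\<bar>"
      using sum_bounded_above[of UNIV "\<lambda>i. \<bar>\<xi> $ i\<bar>" "\<bar>\<xi> $ j\<bar>"] j by simp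
    finally have "norm \<xi> ^ (2 * k) \<le> CARD('n) ^ (2 * k) * \<bar>\<xi> $ j\<bar> ^ (2 * k)"
      unfolding of_nat_power power_mult_distrib[symmetric] by (intro power_mono) auto
    then have "norm \<xi> ^ (2 * k) * norm (fourier \<phi> \<xi>) \<le> CARD('n) ^ (2 * k) * \<bar>\<xi> $ j\<bar> ^ (2 * k) * norm (fourier \<phi> \<xi>)"
      by (rule mult_right_mono) auto
    also have "\<dots> = CARD('n) ^ (2 * k) * (\<bar>\<xi> $ j\<bar> ^ (2 * k) * norm (fourier \<phi> \<xi>))"
      by simp
    also have "\<dots> \<le> CARD('n) ^ (2 * k) * (\<Sum>j\<in>UNIV. B j)"
      by (intro mult_left_mono order_trans[OF B(2)[of \<xi> j]] member_le_sum B) auto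
    finally have "norm (fourier \<phi> \<xi>) + norm \<xi> ^ (2 * k) * norm (fourier \<phi> \<xi>) \<le> A + CARD('n) ^ (2 * k) * (\<Sum>j\<in>UNIV. B j)"
      using A by (intro add_mono) auto
    then have "2 ^ k * ((1 + norm \<xi> ^ (2 * k)) * norm (fourier \<phi> \<xi>)) \<le> C"
      unfolding C_def by (intro mult_left_mono) (auto simp: distrib_right)
    moreover have "(1 + (norm \<xi>)\<^sup>2) ^ k * norm (fourier \<phi> \<xi>) \<le> 2 ^ k * (1 + norm \<xi> ^ (2 * k)) * norm (fourier \<phi> \<xi>)"
      by (intro mult_right_mono one_plus_square_power_bound) auto
    ultimately show ?thesis
      by (simp add: pos_le_divide_eq add_pos_nonneg mult_ac)
  qed
  with C0 show ?thesis by (rule that)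
qed

lemma fourier_measurable:
  fixes \<phi> :: "real^'n::finite \<Rightarrow> complex"
  assumes [measurable]: "\<phi> \<in> borel_measurable borel"
  shows "fourier \<phi> \<in> borel_measurable borel"
proof -
  have "(\<lambda>\<xi>. LINT x|lborel. \<phi> x * exp (- \<i> * complex_of_real (\<xi> \<bullet> x))) \<in> borel_measurable borel"
    by (intro lborel.borel_measurable_lebesgue_integral) measurable
  then show ?thesis by (simp add: fourier_def[abs_def])
qed

section \<open>Gaussians\<close>

lemma lborel_prod_Basis:
  fixes f :: "'a::euclidean_space \<Rightarrow> real \<Rightarrow> 'b::{real_normed_field, banach, second_countable_topology}"
  assumes "\<And>b. b \<in> Basis \<Longrightarrow> integrable lborel (f b)"
  shows integrable_lborel_prod_Basis: "integrable lborel (\<lambda>x. \<Prod>b\<in>Basis. f b (x \<bullet> b))"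
    and integral_lborel_prod_Basis: "(LINT x|lborel. (\<Prod>b\<in>Basis. f b (x \<bullet> b))) = (\<Prod>b\<in>Basis. (LINT t|lborel. f b t))"
proof -
  interpret product_sigma_finite "\<lambda>_::'a. lborel :: real measure" ..
  have [measurable]: "\<And>b. b \<in> Basis \<Longrightarrow> f b \<in> borel_measurable borel"
    using assms borel_measurable_integrable by fastforce
  have coord: "(\<Sum>b\<in>Basis. g b *\<^sub>R b) \<bullet> b' = g b'" if "b' \<in> Basis" for g and b' :: 'a
    using that by simp
  have M: "(\<lambda>g. \<Sum>b\<in>Basis. g b *\<^sub>R b) \<in> (\<Pi>\<^sub>M b\<in>(Basis::'a set). lborel) \<rightarrow>\<^sub>M borel"
    by measurable
  have M': "(\<lambda>x. \<Prod>b\<in>Basis. f b (x \<bullet> b)) \<in> borel_measurable borel"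
    by measurable
  have "integrable (\<Pi>\<^sub>M b\<in>(Basis::'a set). lborel) (\<lambda>g. \<Prod>b\<in>Basis. f b (g b))"
    by (rule product_integrable_prod) (auto intro: assms)
  then show "integrable lborel (\<lambda>x. \<Prod>b\<in>Basis. f b (x \<bullet> b))"
    by (subst lborel_eq, subst integrable_distr_eq[OF M M']) (simp add: coord cong: prod.cong)
  have "(LINT x|lborel. (\<Prod>b\<in>Basis. f b (x \<bullet> b))) = (LINT g|(\<Pi>\<^sub>M b\<in>(Basis::'a set). lborel). (\<Prod>b\<in>Basis. f b (g b)))"
    by (subst lborel_eq, subst integral_distr[OF M M']) (simp add: coord cong: prod.cong)
  also have "\<dots> = (\<Prod>b\<in>Basis. (LINT t|lborel. f b t))"
    by (rule product_integral_prod) (auto intro: assms)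
  finally show "(LINT x|lborel. (\<Prod>b\<in>Basis. f b (x \<bullet> b))) = (\<Prod>b\<in>Basis. (LINT t|lborel. f b t))" .
qed

text \<open>After the substitution s = sqrt l * t this is the characteristic function of the
  standard normal distribution at \<theta> / sqrt l.\<close>

lemma gaussian_fourier_real:
  fixes \<theta> l :: real
  assumes l: "0 < l"
  defines "g \<equiv> \<lambda>t. exp (complex_of_real (- (l * t\<^sup>2 / 2)) + \<i> * complex_of_real (\<theta> * t))"
  shows "integrable lborel g"
    and "(LINT t|lborel. g t) = sqrt (2 * pi / l) * exp (- (\<theta>\<^sup>2 / (2 * l)))"
proof -
  define s where "s = sqrt l"
  have s: "0 < s" "s\<^sup>2 = l" using l by (auto simp: s_def)
  define k where "k t = complex_of_real (std_normal_density t) * iexp (\<theta> / s * t)" for t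
  have k_int: "integrable lborel k"
    unfolding k_def
    by (rule Bochner_Integration.integrable_bound[OF integrable_normal_moment[of 1 0 0]])
       (auto simp: norm_mult abs_of_nonneg)
  have g_eq: "g t = complex_of_real (sqrt (2 * pi)) * k (0 + s * t)" for t
  proof -
    have "g t = complex_of_real (exp (- (s * t)\<^sup>2 / 2)) * iexp (\<theta> / s * (s * t))"
      unfolding g_def exp_add exp_of_real using s by (simp add: power_mult_distrib)
    then show ?thesis
      by (simp add: k_def std_normal_density_def)
  qed
  show "integrable lborel g"
    unfolding g_eq[abs_def]
    using s by (intro integrable_mult_right lborel_integrable_real_affine k_int) simp
  have "(LINT t|lborel. k t) = char std_normal_distribution (\<theta> / s)"
    unfolding char_def k_def
    by (subst integral_density) (auto simp: scaleR_conv_of_real)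
  also have "\<dots> = complex_of_real (exp (- ((\<theta> / s)\<^sup>2) / 2))"
    by (simp add: char_std_normal_distribution)
  finally have K: "(LINT t|lborel. k t) = complex_of_real (exp (- ((\<theta> / s)\<^sup>2) / 2))" .
  have "(LINT t|lborel. k t) = \<bar>s\<bar> *\<^sub>R (LINT t|lborel. k (0 + s * t))"
    using s by (intro lborel_integral_real_affine) simp
  then have "(LINT t|lborel. g t) = complex_of_real (sqrt (2 * pi)) * ((LINT t|lborel. k t) / s)"
    unfolding g_eq[abs_def] using s by (simp add: scaleR_conv_of_real)
  moreover have "- ((\<theta> / s)\<^sup>2) / 2 = - (\<theta>\<^sup>2 / (2 * l))"
    using s by (simp add: power_divide)
  ultimately show "(LINT t|lborel. g t) = sqrt (2 * pi / l) * exp (- (\<theta>\<^sup>2 / (2 * l)))"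
    unfolding K by (simp add: s_def real_sqrt_divide)
qed

text \<open>A Gaussian of precision \<open>l\<close> times the plane wave of frequency
  \<open>a\<close>. The wave becomes a translation on the Fourier side, so these test functions
  probe a measure with Gaussians centred at every point \<open>a\<close>.\<close>

definition modulated_gaussian :: "real \<Rightarrow> real^'n::finite \<Rightarrow> real^'n \<Rightarrow> complex" where
  "modulated_gaussian l a x = exp (complex_of_real (- (l * (norm x)\<^sup>2 / 2)) + \<i> * complex_of_real (a \<bullet> x))"

lemma modulated_gaussian_eq_prod:
  "modulated_gaussian l a x = (\<Prod>b\<in>Basis. exp (complex_of_real (- (l * (x \<bullet> b)\<^sup>2 / 2)) + \<i> * complex_of_real ((a \<bullet> b) * (x \<bullet> b))))"
proof -
  have "(norm x)\<^sup>2 = (\<Sum>b\<in>Basis. (x \<bullet> b)\<^sup>2)"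
    unfolding power2_norm_eq_inner by (subst euclidean_inner) (simp add: power2_eq_square)
  moreover have "a \<bullet> x = (\<Sum>b\<in>Basis. (a \<bullet> b) * (x \<bullet> b))"
    by (rule euclidean_inner)
  ultimately show ?thesis
    by (simp add: modulated_gaussian_def exp_sum[symmetric] sum.distrib sum_distrib_left sum_divide_distrib sum_negf sum_subtractf)
qed

lemma modulated_gaussian_integral:
  assumes "0 < l"
  shows "integrable lborel (modulated_gaussian l (a :: real^'n::finite))"
    and "(LINT x|lborel. modulated_gaussian l a x) = complex_of_real (sqrt (2 * pi / l) ^ CARD('n) * exp (- ((norm a)\<^sup>2 / (2 * l))))"
proof -
  show "integrable lborel (modulated_gaussian l a)"
    unfolding modulated_gaussian_eq_prod[abs_def]
    by (rule integrable_lborel_prod_Basis, rule gaussian_fourier_real(1)[OF assms])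
  have "(LINT x|lborel. modulated_gaussian l a x) = (\<Prod>b\<in>Basis. complex_of_real (sqrt (2 * pi / l) * exp (- ((a \<bullet> b)\<^sup>2 / (2 * l)))))"
    unfolding modulated_gaussian_eq_prod
    by (subst integral_lborel_prod_Basis) (simp_all only: gaussian_fourier_real[OF assms])
  also have "\<dots> = complex_of_real (sqrt (2 * pi / l) ^ CARD('n) * exp (\<Sum>b\<in>(Basis::(real^'n) set). - ((a \<bullet> b)\<^sup>2 / (2 * l))))"
    by (simp add: prod.distrib exp_sum)
  also have "(\<Sum>b\<in>(Basis::(real^'n) set). - ((a \<bullet> b)\<^sup>2 / (2 * l))) = - ((norm a)\<^sup>2 / (2 * l))"
    unfolding power2_norm_eq_inner by (subst euclidean_inner) (simp add: power2_eq_square sum_negf sum_divide_distrib)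
  finally show "(LINT x|lborel. modulated_gaussian l a x) = complex_of_real (sqrt (2 * pi / l) ^ CARD('n) * exp (- ((norm a)\<^sup>2 / (2 * l))))" .
qed

lemma fourier_modulated_gaussian:
  fixes a :: "real^'n::finite"
  assumes "0 < l"
  shows "fourier (modulated_gaussian l a) \<xi> = complex_of_real (sqrt (2 * pi / l) ^ CARD('n) * exp (- ((norm (\<xi> - a))\<^sup>2 / (2 * l))))"
proof -
  have "fourier (modulated_gaussian l a) \<xi> = (LINT x|lborel. modulated_gaussian l (a - \<xi>) x)"
    unfolding fourier_def modulated_gaussian_def mult_exp_exp
    by (intro Bochner_Integration.integral_cong refl arg_cong[of _ _ exp]) (simp add: inner_diff_left right_diff_distrib)
  then show ?thesis
    using assms by (simp add: modulated_gaussian_integral norm_minus_commute)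
qed

text \<open>Polynomial multiples of one modulated Gaussian, with the coefficients forgotten. The
  class is closed under partial derivatives, which lets the Schwartz property be proved by induction
  over the sequence of derivatives.\<close>

inductive gaussian_poly :: "real \<Rightarrow> real^'n::finite \<Rightarrow> (real^'n \<Rightarrow> complex) \<Rightarrow> bool"
  for l :: real and a :: "real^'n" where
  base: "gaussian_poly l a (modulated_gaussian l a)"
| coord: "gaussian_poly l a \<psi> \<Longrightarrow> gaussian_poly l a (\<lambda>x. complex_of_real (x $ i) * \<psi> x)"
| scale: "gaussian_poly l a \<psi> \<Longrightarrow> gaussian_poly l a (\<lambda>x. c * \<psi> x)"
| add: "gaussian_poly l a \<psi> \<Longrightarrow> gaussian_poly l a \<psi>' \<Longrightarrow> gaussian_poly l a (\<lambda>x. \<psi> x + \<psi>' x)"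

lemma partial_deriv_eq:
  assumes "\<And>x. (\<psi> has_derivative D x) (at x)"
  shows "partial_deriv j \<psi> = (\<lambda>x. D x (axis j 1))"
  using frechet_derivative_at[OF assms] unfolding partial_deriv_def by (simp add: fun_eq_iff)

lemma gaussian_poly_partial_deriv:
  assumes "gaussian_poly l a \<psi>"
  shows "(\<forall>x. \<psi> differentiable (at x)) \<and> gaussian_poly l a (partial_deriv j \<psi>)"
  using assms
proof induction
  case base
  let ?m = "modulated_gaussian l a"
  have D: "(?m has_derivative (\<lambda>v. ?m x * (complex_of_real (- (l * (x \<bullet> v))) + \<i> * complex_of_real (a \<bullet> v)))) (at x)" for x
  proof -
    have "((\<lambda>x. complex_of_real (- (l * (x \<bullet> x) / 2)) + \<i> * complex_of_real (a \<bullet> x)) has_derivative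
        (\<lambda>v. complex_of_real (- (l * (x \<bullet> v))) + \<i> * complex_of_real (a \<bullet> v))) (at x)"
      by (auto intro!: derivative_eq_intros simp: inner_commute)
    from has_derivative_compose[OF this has_field_derivative_imp_has_derivative[OF DERIV_exp]] show ?thesis
      unfolding modulated_gaussian_def[abs_def] power2_norm_eq_inner by (simp add: mult.commute)
  qed
  have "partial_deriv j ?m = (\<lambda>x. complex_of_real (x $ j) * (complex_of_real (-l) * ?m x) + (\<i> * complex_of_real (a $ j)) * ?m x)"
    by (subst partial_deriv_eq[OF D]) (simp add: inner_axis fun_eq_iff algebra_simps)
  moreover have "gaussian_poly l a \<dots>"
    by (intro gaussian_poly.intros)
  ultimately show ?case using D by (auto simp: differentiable_def)
next
  case (coord \<psi> i)
  then have D': "(\<psi> has_derivative frechet_derivative \<psi> (at x)) (at x)" for x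
    using frechet_derivative_works by blast
  have D: "((\<lambda>x. complex_of_real (x $ i) * \<psi> x) has_derivative
      (\<lambda>v. complex_of_real (x $ i) * frechet_derivative \<psi> (at x) v + complex_of_real (v $ i) * \<psi> x)) (at x)" for x
    by (intro has_derivative_mult[OF _ D'] bounded_linear_imp_has_derivative
        bounded_linear_compose[OF bounded_linear_of_real bounded_linear_vec_nth])
  have "partial_deriv j (\<lambda>x. complex_of_real (x $ i) * \<psi> x) =
     (\<lambda>x. complex_of_real (x $ i) * partial_deriv j \<psi> x + complex_of_real (axis j 1 $ i) * \<psi> x)"
    by (subst partial_deriv_eq[OF D]) (simp add: partial_deriv_def)
  moreover have "gaussian_poly l a \<dots>"
    using coord by (intro gaussian_poly.intros) auto
  ultimately show ?case using D by (auto simp: differentiable_def)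
next
  case (scale \<psi> c)
  then have D': "(\<psi> has_derivative frechet_derivative \<psi> (at x)) (at x)" for x
    using frechet_derivative_works by blast
  have D: "((\<lambda>x. c * \<psi> x) has_derivative (\<lambda>v. c * frechet_derivative \<psi> (at x) v)) (at x)" for x
    by (rule has_derivative_mult_right[OF D'])
  have "partial_deriv j (\<lambda>x. c * \<psi> x) = (\<lambda>x. c * partial_deriv j \<psi> x)"
    by (subst partial_deriv_eq[OF D]) (simp add: partial_deriv_def)
  moreover have "gaussian_poly l a \<dots>"
    using scale by (intro gaussian_poly.intros) auto
  ultimately show ?case using D by (auto simp: differentiable_def)
next
  case (add \<psi> \<psi>')
  then have D': "(\<psi> has_derivative frechet_derivative \<psi> (at x)) (at x)" "(\<psi>' has_derivative frechet_derivative \<psi>' (at x)) (at x)" for x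
    using frechet_derivative_works by blast+
  have D: "((\<lambda>x. \<psi> x + \<psi>' x) has_derivative (\<lambda>v. frechet_derivative \<psi> (at x) v + frechet_derivative \<psi>' (at x) v)) (at x)" for x
    by (rule has_derivative_add[OF D'])
  have "partial_deriv j (\<lambda>x. \<psi> x + \<psi>' x) = (\<lambda>x. partial_deriv j \<psi> x + partial_deriv j \<psi>' x)"
    by (subst partial_deriv_eq[OF D]) (simp add: partial_deriv_def)
  moreover have "gaussian_poly l a \<dots>"
    using add by (intro gaussian_poly.intros) auto
  ultimately show ?case using D by (auto simp: differentiable_def)
qed

lemma power_le_fact_exp:
  fixes u :: real
  assumes "0 \<le> u"
  shows "u ^ k \<le> fact k * exp u"
proof -
  have "u ^ k / fact k = (\<Sum>n\<in>{k}. u ^ n /\<^sub>R fact n)"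
    by (simp add: divide_inverse mult.commute)
  also have "\<dots> \<le> (\<Sum>n. u ^ n /\<^sub>R fact n)"
    using assms exp_converges[of u] by (intro sum_le_suminf) (auto simp: sums_iff)
  also have "\<dots> = exp u"
    using exp_converges[of u] by (simp add: sums_iff)
  finally show ?thesis by (simp add: field_simps)
qed

text \<open>The weight \<open>k\<close> is generalised because multiplying by a coordinate uses the
  bound for k + 1. For the Gaussian itself, with u = l |x|^2 / 2, the bounds |x|^k <= 1 + |x|^(2k)
  and u^k <= k! exp u suffice.\<close>

lemma gaussian_poly_bounded:
  assumes "gaussian_poly l a \<psi>" and l: "0 < l"
  shows "\<exists>C. \<forall>x. norm x ^ k * norm (\<psi> x) \<le> C"
  using assms(1)
proof (induction arbitrary: k)
  case base
  have "norm x ^ k * norm (modulated_gaussian l a x) \<le> 1 + (2 / l) ^ k * fact k" for x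
  proof -
    define u where "u = l * (norm x)\<^sup>2 / 2"
    have u: "0 \<le> u" using l by (simp add: u_def)
    have "norm x ^ k \<le> 1 + (norm x ^ 2) ^ k"
    proof (cases "norm x \<le> 1")
      case True then show ?thesis by (simp add: power_le_one add_increasing2)
    next
      case False
      then have "norm x ^ k \<le> norm x ^ (2 * k)" by (intro power_increasing) auto
      then show ?thesis by (simp add: power_mult)
    qed
    also have "norm x ^ 2 = 2 / l * u" using l by (simp add: u_def)
    finally have "norm x ^ k \<le> 1 + (2 / l) ^ k * u ^ k"
      by (simp only: power_mult_distrib)
    also have "\<dots> \<le> exp u + (2 / l) ^ k * (fact k * exp u)"
      using l u power_le_fact_exp[OF u, of k] by (intro add_mono mult_left_mono) auto
    finally have "norm x ^ k \<le> (1 + (2 / l) ^ k * fact k) * exp u"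
      by (simp add: algebra_simps)
    then have "norm x ^ k * exp (- u) \<le> 1 + (2 / l) ^ k * fact k"
      by (simp add: exp_minus field_simps)
    moreover have "norm (modulated_gaussian l a x) = exp (- u)"
      by (simp add: modulated_gaussian_def norm_exp_eq_Re u_def)
    ultimately show ?thesis by simp
  qed
  then show ?case by blast
next
  case (coord \<psi> i)
  obtain C where C: "\<And>x. norm x ^ Suc k * norm (\<psi> x) \<le> C" using coord.IH[of "Suc k"] by blast
  have "norm x ^ k * norm (complex_of_real (x $ i) * \<psi> x) \<le> C" for x
  proof -
    have "norm x ^ k * norm (complex_of_real (x $ i) * \<psi> x) \<le> norm x ^ k * (norm x * norm (\<psi> x))"
      unfolding norm_mult by (intro mult_left_mono mult_right_mono) (auto simp: component_le_norm_cart)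
    also have "\<dots> \<le> C" using C[of x] by (simp add: mult_ac)
    finally show ?thesis .
  qed
  then show ?case by blast
next
  case (scale \<psi> c)
  obtain C where C: "\<And>x. norm x ^ k * norm (\<psi> x) \<le> C" using scale.IH[of k] by blast
  have "norm x ^ k * norm (c * \<psi> x) \<le> norm c * C" for x
    using mult_left_mono[OF C[of x], of "norm c"] by (simp add: norm_mult mult_ac)
  then show ?case by blast
next
  case (add \<psi> \<psi>')
  obtain C where C: "\<And>x. norm x ^ k * norm (\<psi> x) \<le> C" using add.IH(1)[of k] by blast
  obtain C' where C': "\<And>x. norm x ^ k * norm (\<psi>' x) \<le> C'" using add.IH(2)[of k] by blast
  have "norm x ^ k * norm (\<psi> x + \<psi>' x) \<le> C + C'" for x
  proof -
    have "norm x ^ k * norm (\<psi> x + \<psi>' x) \<le> norm x ^ k * (norm (\<psi> x) + norm (\<psi>' x))"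
      by (intro mult_left_mono norm_triangle_ineq) auto
    also have "\<dots> \<le> C + C'" using C[of x] C'[of x] by (simp add: distrib_left)
    finally show ?thesis .
  qed
  then show ?case by blast
qed

lemma schwartz_fun_modulated_gaussian:
  assumes "0 < l"
  shows "schwartz_fun (modulated_gaussian l a)"
proof -
  have "gaussian_poly l a (foldr partial_deriv js (modulated_gaussian l a))" for js
    by (induction js) (simp_all add: gaussian_poly.base gaussian_poly_partial_deriv)
  then show ?thesis
    unfolding schwartz_fun_def
    using gaussian_poly_partial_deriv gaussian_poly_bounded assms by blast
qed

section \<open>Uniqueness of the spectral measure\<close>

lemma gaussian_nn_integral_finite:
  "(\<integral>\<^sup>+ y. ennreal (exp (- ((norm (y :: real^'n::finite))\<^sup>2 / 2))) \<partial>lborel) < \<infinity>"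
proof -
  have "integrable lborel (\<lambda>y::real^'n. norm (modulated_gaussian 1 0 y))"
    using modulated_gaussian_integral(1)[of 1 "0::real^'n"] by (intro integrable_norm) simp
  then have "integrable lborel (\<lambda>y::real^'n. exp (- ((norm y)\<^sup>2 / 2)))"
    by (simp add: modulated_gaussian_def norm_exp_eq_Re)
  then show ?thesis
    by (simp add: integrable_iff_bounded)
qed

text \<open>The Gaussian averages of \<open>\<psi>\<close> converge boundedly to \<open>\<psi>\<close>, and their integrals
  are determined by the Gaussian transforms of the measure.\<close>

lemma nn_integral_eq_if_gaussian_transform_eq:
  fixes M N :: "(real^'n::finite) measure" and \<psi> :: "real^'n \<Rightarrow> real"
  assumes fin: "finite_measure M" "finite_measure N"
    and [measurable_cong]: "sets M = sets borel" "sets N = sets borel"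
    and eq: "\<And>t a. 0 < t \<Longrightarrow> (\<integral>\<^sup>+ \<xi>. ennreal (exp (- ((norm (\<xi> - a))\<^sup>2 / (2 * t)))) \<partial>M)
        = (\<integral>\<^sup>+ \<xi>. ennreal (exp (- ((norm (\<xi> - a))\<^sup>2 / (2 * t)))) \<partial>N)"
    and \<psi>: "continuous_on UNIV \<psi>" "\<And>x. 0 \<le> \<psi> x" "\<And>x. \<psi> x \<le> 1"
  shows "(\<integral>\<^sup>+ \<xi>. ennreal (\<psi> \<xi>) \<partial>M) = (\<integral>\<^sup>+ \<xi>. ennreal (\<psi> \<xi>) \<partial>N)"
proof -
  have [measurable]: "\<psi> \<in> borel_measurable borel"
    using \<psi>(1) by (rule borel_measurable_continuous_onI)
  define g where "g y = exp (- ((norm y)\<^sup>2 / 2))" for y :: "real^'n"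
  have [measurable]: "g \<in> borel_measurable borel" unfolding g_def[abs_def] by measurable
  define \<gamma> where "\<gamma> = (\<integral>\<^sup>+ y. ennreal (g y) \<partial>lborel)"
  \<comment> \<open>The Gaussian stays unnormalised, and its mass \<open>\<gamma>\<close> is
    cancelled in the last line; finiteness and nonvanishing permit this.\<close>
  have \<gamma>: "\<gamma> < \<infinity>" "\<gamma> \<noteq> 0"
  proof -
    show "\<gamma> < \<infinity>" unfolding \<gamma>_def g_def by (rule gaussian_nn_integral_finite)
    have "\<not> (AE y::real^'n in lborel. False)"
      by (simp add: eventually_False ae_filter_eq_bot_iff)
    then show "\<gamma> \<noteq> 0" unfolding \<gamma>_def by (subst nn_integral_0_iff_AE) (auto simp: g_def)
  qed
  define J where "J K m = (\<integral>\<^sup>+ \<xi>. (\<integral>\<^sup>+ y. ennreal (\<psi> (\<xi> + (1 / real (Suc m)) *\<^sub>R y) * g y) \<partial>lborel) \<partial>K)"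
    for K :: "(real^'n) measure" and m :: nat
  have lim: "J K \<longlonglongrightarrow> \<gamma> * (\<integral>\<^sup>+ \<xi>. ennreal (\<psi> \<xi>) \<partial>K)" if K: "finite_measure K" and [measurable_cong]: "sets K = sets borel" for K
  proof -
    interpret finite_measure K by fact
    have inner: "(\<lambda>m. (\<integral>\<^sup>+ y. ennreal (\<psi> (\<xi> + (1 / real (Suc m)) *\<^sub>R y) * g y) \<partial>lborel)) \<longlonglongrightarrow> (\<integral>\<^sup>+ y. ennreal (\<psi> \<xi> * g y) \<partial>lborel)" for \<xi>
    proof (rule nn_integral_dominated_convergence[where w="\<lambda>y. ennreal (g y)"])
      show "AE y in lborel. (\<lambda>m. ennreal (\<psi> (\<xi> + (1 / real (Suc m)) *\<^sub>R y) * g y)) \<longlonglongrightarrow> ennreal (\<psi> \<xi> * g y)"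
      proof (intro AE_I2 tendsto_ennrealI tendsto_mult tendsto_const)
        fix y :: "real^'n"
        have "(\<lambda>m. 1 / real (Suc m)) \<longlonglongrightarrow> 0"
          using LIMSEQ_inverse_real_of_nat by (simp add: inverse_eq_divide)
        then have "(\<lambda>m. \<xi> + (1 / real (Suc m)) *\<^sub>R y) \<longlonglongrightarrow> \<xi> + 0 *\<^sub>R y"
          by (intro tendsto_intros)
        moreover have "isCont \<psi> \<xi>"
          using \<psi>(1) by (simp add: continuous_on_eq_continuous_at)
        ultimately show "(\<lambda>m. \<psi> (\<xi> + (1 / real (Suc m)) *\<^sub>R y)) \<longlonglongrightarrow> \<psi> \<xi>"
          by (intro isCont_tendsto_compose[of \<xi> \<psi>]) auto
      qed
      show "AE y in lborel. ennreal (\<psi> (\<xi> + (1 / real (Suc m)) *\<^sub>R y) * g y) \<le> ennreal (g y)" for m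
        using \<psi> by (intro AE_I2 ennreal_leI) (simp add: g_def mult_left_le_one_le)
      show "(\<integral>\<^sup>+ y. ennreal (g y) \<partial>lborel) < \<infinity>"
        using \<gamma> by (simp add: \<gamma>_def)
    qed measurable
    have "J K \<longlonglongrightarrow> (\<integral>\<^sup>+ \<xi>. (\<integral>\<^sup>+ y. ennreal (\<psi> \<xi> * g y) \<partial>lborel) \<partial>K)"
      unfolding J_def
    proof (rule nn_integral_dominated_convergence[where w="\<lambda>_. \<gamma>"])
      show "AE \<xi> in K. (\<integral>\<^sup>+ y. ennreal (\<psi> (\<xi> + (1 / real (Suc m)) *\<^sub>R y) * g y) \<partial>lborel) \<le> \<gamma>" for m
        unfolding \<gamma>_def using \<psi>
        by (intro AE_I2 nn_integral_mono ennreal_leI) (simp add: g_def mult_left_le_one_le)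
      show "(\<integral>\<^sup>+ \<xi>. \<gamma> \<partial>K) < \<infinity>"
        using \<gamma> by (simp add: ennreal_mult_less_top emeasure_eq_measure)
      show "AE \<xi> in K. (\<lambda>m. (\<integral>\<^sup>+ y. ennreal (\<psi> (\<xi> + (1 / real (Suc m)) *\<^sub>R y) * g y) \<partial>lborel)) \<longlonglongrightarrow> (\<integral>\<^sup>+ y. ennreal (\<psi> \<xi> * g y) \<partial>lborel)"
        by (intro AE_I2 inner)
    qed measurable
    also have "(\<integral>\<^sup>+ \<xi>. (\<integral>\<^sup>+ y. ennreal (\<psi> \<xi> * g y) \<partial>lborel) \<partial>K) = (\<integral>\<^sup>+ \<xi>. \<gamma> * ennreal (\<psi> \<xi>) \<partial>K)"
      using \<psi>(2) by (intro nn_integral_cong) (simp add: ennreal_mult' nn_integral_cmult \<gamma>_def mult.commute)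
    also have "\<dots> = \<gamma> * (\<integral>\<^sup>+ \<xi>. ennreal (\<psi> \<xi>) \<partial>K)"
      by (intro nn_integral_cmult) measurable
    finally show ?thesis .
  qed
  \<comment> \<open>The substitution y = r (a - \<xi>) with r = m + 1 makes \<psi> depend on
    \<open>a\<close> alone and turns g into the Gaussian of variance 1 / r^2 in \<xi> - a. After
    exchanging the integrals, \<open>K\<close> enters only through its Gaussian transform.\<close>
  have J_eq: "J K m = ennreal (real (Suc m) ^ CARD('n)) * (\<integral>\<^sup>+ a. ennreal (\<psi> a) *
      (\<integral>\<^sup>+ \<xi>. ennreal (exp (- ((norm (\<xi> - a))\<^sup>2 / (2 * (1 / (real (Suc m))\<^sup>2))))) \<partial>K) \<partial>lborel)"
    if K: "finite_measure K" and [measurable_cong]: "sets K = sets borel" for K m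
  proof -
    interpret finite_measure K by fact
    interpret pair_sigma_finite K lborel ..
    let ?r = "real (Suc m)"
    let ?E = "\<lambda>\<xi> a. exp (- ((norm (\<xi> - a))\<^sup>2 / (2 * (1 / ?r\<^sup>2))))"
    have "(\<integral>\<^sup>+ y. ennreal (\<psi> (\<xi> + (1 / ?r) *\<^sub>R y) * g y) \<partial>lborel)
        = ennreal (?r ^ CARD('n)) * (\<integral>\<^sup>+ a. ennreal (\<psi> a) * ennreal (?E \<xi> a) \<partial>lborel)" for \<xi>
    proof -
      have "(\<integral>\<^sup>+ y. ennreal (\<psi> (\<xi> + (1 / ?r) *\<^sub>R y) * g y) \<partial>lborel)
          = ennreal (\<bar>?r\<bar> ^ DIM(real^'n)) * (\<integral>\<^sup>+ a. ennreal (\<psi> (\<xi> + (1 / ?r) *\<^sub>R (?r *\<^sub>R (-\<xi>) + ?r *\<^sub>R a)) * g (?r *\<^sub>R (-\<xi>) + ?r *\<^sub>R a)) \<partial>lborel)"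
        by (rule nn_integral_lborel_scaleR) auto
      also have "(\<integral>\<^sup>+ a. ennreal (\<psi> (\<xi> + (1 / ?r) *\<^sub>R (?r *\<^sub>R (-\<xi>) + ?r *\<^sub>R a)) * g (?r *\<^sub>R (-\<xi>) + ?r *\<^sub>R a)) \<partial>lborel)
         = (\<integral>\<^sup>+ a. ennreal (\<psi> a) * ennreal (?E \<xi> a) \<partial>lborel)"
      proof (intro nn_integral_cong)
        fix a
        have 1: "\<xi> + (1 / ?r) *\<^sub>R (?r *\<^sub>R (-\<xi>) + ?r *\<^sub>R a) = a"
          unfolding scaleR_add_right[symmetric] scaleR_scaleR by simp
        have "norm (?r *\<^sub>R (-\<xi>) + ?r *\<^sub>R a) = ?r * norm (\<xi> - a)"
          unfolding scaleR_add_right[symmetric] norm_scaleR by (simp add: norm_minus_commute)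
        then have 2: "g (?r *\<^sub>R (-\<xi>) + ?r *\<^sub>R a) = ?E \<xi> a"
          unfolding g_def by (simp add: power_mult_distrib mult.commute)
        show "ennreal (\<psi> (\<xi> + (1 / ?r) *\<^sub>R (?r *\<^sub>R (-\<xi>) + ?r *\<^sub>R a)) * g (?r *\<^sub>R (-\<xi>) + ?r *\<^sub>R a)) = ennreal (\<psi> a) * ennreal (?E \<xi> a)"
          unfolding 1 2 using \<psi>(2) by (rule ennreal_mult) simp
      qed
      finally show ?thesis by simp
    qed
    then have "J K m = (\<integral>\<^sup>+ \<xi>. ennreal (?r ^ CARD('n)) * (\<integral>\<^sup>+ a. ennreal (\<psi> a) * ennreal (?E \<xi> a) \<partial>lborel) \<partial>K)"
      unfolding J_def by simp
    also have "\<dots> = ennreal (?r ^ CARD('n)) * (\<integral>\<^sup>+ \<xi>. (\<integral>\<^sup>+ a. ennreal (\<psi> a) * ennreal (?E \<xi> a) \<partial>lborel) \<partial>K)"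
      by (intro nn_integral_cmult) measurable
    also have "(\<integral>\<^sup>+ \<xi>. (\<integral>\<^sup>+ a. ennreal (\<psi> a) * ennreal (?E \<xi> a) \<partial>lborel) \<partial>K)
       = (\<integral>\<^sup>+ a. (\<integral>\<^sup>+ \<xi>. ennreal (\<psi> a) * ennreal (?E \<xi> a) \<partial>K) \<partial>lborel)"
      by (rule Fubini'[symmetric]) measurable
    also have "\<dots> = (\<integral>\<^sup>+ a. ennreal (\<psi> a) * (\<integral>\<^sup>+ \<xi>. ennreal (?E \<xi> a) \<partial>K) \<partial>lborel)"
      by (intro nn_integral_cong nn_integral_cmult) measurable
    finally show ?thesis .
  qed
  have "J M m = J N m" for m
  proof -
    have "0 < 1 / (real (Suc m))\<^sup>2" by simp
    then show ?thesis
      unfolding J_eq[OF fin(1) assms(3)] J_eq[OF fin(2) assms(4)] by (simp only: eq)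
  qed
  then have "J M = J N" by blast
  then have "\<gamma> * (\<integral>\<^sup>+ \<xi>. ennreal (\<psi> \<xi>) \<partial>M) = \<gamma> * (\<integral>\<^sup>+ \<xi>. ennreal (\<psi> \<xi>) \<partial>N)"
    using lim[of M] lim[of N] assms by (metis LIMSEQ_unique)
  then show ?thesis
    using \<gamma> by (auto simp: ennreal_mult_cancel_left)
qed

text \<open>The indicator of an open set is the limit of the continuous functions min 1 (n dist(x,
  complement)), and open sets form a generator closed under intersection.\<close>

lemma measure_eqI_bounded_continuous:
  fixes M N :: "'a::metric_space measure"
  assumes fin: "finite_measure M" "finite_measure N"
    and sets: "sets M = sets borel" "sets N = sets borel"
    and eq: "\<And>\<psi> :: 'a \<Rightarrow> real. continuous_on UNIV \<psi> \<Longrightarrow> (\<And>x. 0 \<le> \<psi> x) \<Longrightarrow> (\<And>x. \<psi> x \<le> 1)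
      \<Longrightarrow> (\<integral>\<^sup>+ x. ennreal (\<psi> x) \<partial>M) = (\<integral>\<^sup>+ x. ennreal (\<psi> x) \<partial>N)"
  shows "M = N"
proof -
  have open_eq: "emeasure M U = emeasure N U" if U: "open U" for U
  \<comment> \<open>The whole space is separate: its complement is empty, and \<open>infdist\<close>
    to the empty set is 0, so the cutoffs would vanish.\<close>
  proof (cases "U = UNIV")
    case True
    then show ?thesis
      using eq[of "\<lambda>_. 1"] sets_eq_imp_space_eq[OF sets(1)] sets_eq_imp_space_eq[OF sets(2)] by simp
  next
    case False
    then have ne: "- U \<noteq> {}" by auto
    define \<psi> where "\<psi> n x = min 1 (real n * infdist x (- U))" for n x
    have \<psi>: "continuous_on UNIV (\<psi> n)" "0 \<le> \<psi> n x" "\<psi> n x \<le> 1" for n x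
      unfolding \<psi>_def by (auto intro!: continuous_intros simp: infdist_nonneg)
    have conv: "(\<lambda>n. ennreal (\<psi> n x)) \<longlonglongrightarrow> indicator U x" for x
    proof (cases "x \<in> U")
      case True
      then have pos: "0 < infdist x (- U)"
        using U ne by (intro infdist_pos_not_in_closed) auto
      obtain k :: nat where k: "1 < real k * infdist x (- U)"
        using reals_Archimedean3[OF pos] by blast
      have "\<psi> n x = 1" if "k \<le> n" for n
      proof -
        have "real k * infdist x (- U) \<le> real n * infdist x (- U)"
          using that by (intro mult_right_mono) (auto simp: infdist_nonneg)
        then show ?thesis using k by (simp add: \<psi>_def)
      qed
      then have "eventually (\<lambda>n. ennreal (\<psi> n x) = indicator U x) sequentially"
        using True by (auto simp: eventually_sequentially)
      then show ?thesis by (rule tendsto_eventually)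
    next
      case False
      then show ?thesis by (simp add: \<psi>_def)
    qed
    have lim: "(\<lambda>n. \<integral>\<^sup>+ x. ennreal (\<psi> n x) \<partial>K) \<longlonglongrightarrow> emeasure K U"
      if K: "finite_measure K" and s [measurable_cong]: "sets K = sets borel" for K
    proof -
      interpret finite_measure K by fact
      have [measurable]: "\<psi> n \<in> borel_measurable borel" for n
        using \<psi>(1) by (rule borel_measurable_continuous_onI)
      have [measurable]: "U \<in> sets borel" using U by simp
      have "(\<lambda>n. \<integral>\<^sup>+ x. ennreal (\<psi> n x) \<partial>K) \<longlonglongrightarrow> (\<integral>\<^sup>+ x. indicator U x \<partial>K)"
      proof (rule nn_integral_dominated_convergence[where w="\<lambda>_. 1"])
        show "AE x in K. ennreal (\<psi> n x) \<le> 1" for n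
          using \<psi>(3) ennreal_leI[of "\<psi> n _" 1] by simp
        show "(\<integral>\<^sup>+ x. 1 \<partial>K) < \<infinity>" by (simp add: less_top[symmetric] emeasure_finite)
        show "AE x in K. (\<lambda>n. ennreal (\<psi> n x)) \<longlonglongrightarrow> indicator U x"
          using conv by simp
      qed measurable
      then show ?thesis using U s by simp
    qed
    have "(\<lambda>n. \<integral>\<^sup>+ x. ennreal (\<psi> n x) \<partial>M) = (\<lambda>n. \<integral>\<^sup>+ x. ennreal (\<psi> n x) \<partial>N)"
      using eq[OF \<psi>] by blast
    then show ?thesis
      using lim[OF fin(1) sets(1)] lim[OF fin(2) sets(2)] by (metis LIMSEQ_unique)
  qed
  show ?thesis
  proof (rule measure_eqI_generator_eq[where E="{U. open U}" and \<Omega>=UNIV and A="\<lambda>_. UNIV"])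
    show "Int_stable {U::'a set. open U}" by (auto simp: Int_stable_def)
    show "sets M = sigma_sets UNIV {U. open U}" "sets N = sigma_sets UNIV {U. open U}"
      using sets by (auto simp: borel_def)
    show "emeasure M UNIV \<noteq> \<infinity>"
      using finite_measure.emeasure_finite[OF fin(1)] by simp
  qed (use open_eq in auto)
qed

text \<open>Testing with a modulated Gaussian expresses the Gaussian integral of the measure around
  \<open>a\<close> by data in which the measure no longer occurs.\<close>

lemma has_fourier_transform_gaussian:
  fixes \<mu> :: "(real^'n::finite) measure"
  assumes \<mu>: "has_fourier_transform \<mu> f" and l: "0 < l"
  shows "integrable \<mu> (\<lambda>\<xi>. exp (- ((norm (\<xi> - a))\<^sup>2 / (2 * l))))"
    and "complex_of_real (LINT \<xi>|\<mu>. exp (- ((norm (\<xi> - a))\<^sup>2 / (2 * l)))) =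
      (LINT x|lborel. complex_of_real (f x) * modulated_gaussian l a x) / sqrt (2 * pi / l) ^ CARD('n)"
proof -
  let ?A = "sqrt (2 * pi / l) ^ CARD('n)"
  have A: "?A \<noteq> 0" using l by simp
  have F: "fourier (modulated_gaussian l a) = (\<lambda>\<xi>. complex_of_real (?A * exp (- ((norm (\<xi> - a))\<^sup>2 / (2 * l)))))"
    using fourier_modulated_gaussian[OF l] by blast
  have H: "integrable \<mu> (fourier (modulated_gaussian l a))"
    "(LINT x|lborel. complex_of_real (f x) * modulated_gaussian l a x) = (LINT \<xi>|\<mu>. fourier (modulated_gaussian l a) \<xi>)"
    using \<mu> schwartz_fun_modulated_gaussian[OF l] unfolding has_fourier_transform_def by blast+
  have "integrable \<mu> (\<lambda>\<xi>. ?A * exp (- ((norm (\<xi> - a))\<^sup>2 / (2 * l))))"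
    using H(1) unfolding F by (simp only: complex_of_real_integrable_eq)
  then have "integrable \<mu> (\<lambda>\<xi>. 1 / ?A * (?A * exp (- ((norm (\<xi> - a))\<^sup>2 / (2 * l)))))"
    by (rule integrable_mult_right)
  then show int: "integrable \<mu> (\<lambda>\<xi>. exp (- ((norm (\<xi> - a))\<^sup>2 / (2 * l))))"
    using A by simp
  show "complex_of_real (LINT \<xi>|\<mu>. exp (- ((norm (\<xi> - a))\<^sup>2 / (2 * l)))) =
      (LINT x|lborel. complex_of_real (f x) * modulated_gaussian l a x) / ?A"
  proof -
    have "(LINT \<xi>|\<mu>. complex_of_real (?A * exp (- ((norm (\<xi> - a))\<^sup>2 / (2 * l)))))
        = complex_of_real (?A * (LINT \<xi>|\<mu>. exp (- ((norm (\<xi> - a))\<^sup>2 / (2 * l)))))"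
      by (simp only: integral_complex_of_real integral_mult_right_zero)
    then show ?thesis
      unfolding H(2) F using A by (simp only: of_real_mult) simp
  qed
qed

text \<open>Completing the square. Up to a factor free of \<xi>, a centred Gaussian of variance 1
  times one of variance t at \<open>a\<close> is a Gaussian of variance t / (1 + t) at a / (1 + t),
  so weighted measures have Gaussian transforms of the same kind.\<close>

lemma gaussian_product:
  fixes \<xi> a :: "'a::real_inner"
  assumes "0 < t"
  shows "exp (- ((norm \<xi>)\<^sup>2 / 2)) * exp (- ((norm (\<xi> - a))\<^sup>2 / (2 * t)))
    = exp (- ((norm a)\<^sup>2 / (2 * (1 + t)))) * exp (- ((norm (\<xi> - (1 / (1 + t)) *\<^sub>R a))\<^sup>2 / (2 * (t / (1 + t)))))"
proof -
  have "(norm \<xi>)\<^sup>2 / 2 + (norm (\<xi> - a))\<^sup>2 / (2 * t)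
      = (norm a)\<^sup>2 / (2 * (1 + t)) + (norm (\<xi> - (1 / (1 + t)) *\<^sub>R a))\<^sup>2 / (2 * (t / (1 + t)))"
    using assms add_pos_pos[of 1 t] unfolding power2_norm_eq_inner
    by (simp add: inner_diff_left inner_diff_right inner_commute[of a \<xi>] divide_simps) (simp add: algebra_simps power2_eq_square)
  then show ?thesis
    unfolding mult_exp_exp by (simp add: algebra_simps)
qed

text \<open>The two measures can be infinite, so they are compared after weighting with the Gaussian
  \<open>w\<close>. The weighted measures are finite and have equal Gaussian transforms; since
  \<open>w\<close> vanishes nowhere, the density 1 / w undoes the weighting.\<close>

lemma fourier_transform_unique:
  fixes \<mu> \<nu> :: "(real^'n::finite) measure"
  assumes \<mu>: "has_fourier_transform \<mu> f" and \<nu>: "has_fourier_transform \<nu> f"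
  shows "\<mu> = \<nu>"
proof -
  have sets [measurable_cong]: "sets \<mu> = sets borel" "sets \<nu> = sets borel"
    using \<mu> \<nu> by (auto simp: has_fourier_transform_def tempered_measure_def)
  define w where "w \<xi> = exp (- ((norm \<xi>)\<^sup>2 / 2))" for \<xi> :: "real^'n"
  have [measurable]: "w \<in> borel_measurable borel" unfolding w_def[abs_def] by measurable
  have eq: "(\<integral>\<^sup>+ \<xi>. ennreal (exp (- ((norm (\<xi> - a))\<^sup>2 / (2 * l)))) \<partial>\<mu>)
     = (\<integral>\<^sup>+ \<xi>. ennreal (exp (- ((norm (\<xi> - a))\<^sup>2 / (2 * l)))) \<partial>\<nu>)" if "0 < l" for l a
  proof -
    have "complex_of_real (LINT \<xi>|\<mu>. exp (- ((norm (\<xi> - a))\<^sup>2 / (2 * l))))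
        = complex_of_real (LINT \<xi>|\<nu>. exp (- ((norm (\<xi> - a))\<^sup>2 / (2 * l))))"
      using has_fourier_transform_gaussian(2)[OF \<mu> that] has_fourier_transform_gaussian(2)[OF \<nu> that] by simp
    then have "(LINT \<xi>|\<mu>. exp (- ((norm (\<xi> - a))\<^sup>2 / (2 * l)))) = (LINT \<xi>|\<nu>. exp (- ((norm (\<xi> - a))\<^sup>2 / (2 * l))))"
      by (simp only: of_real_eq_iff)
    then show ?thesis
      using has_fourier_transform_gaussian(1)[OF \<mu> that] has_fourier_transform_gaussian(1)[OF \<nu> that]
      by (simp add: nn_integral_eq_integral)
  qed
  have fin: "finite_measure (density K (\<lambda>\<xi>. ennreal (w \<xi>)))"
    if K: "has_fourier_transform K f" and [measurable_cong]: "sets K = sets borel" for K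
  proof
    have "(\<integral>\<^sup>+ \<xi>. ennreal (w \<xi>) \<partial>K) < \<infinity>"
      using has_fourier_transform_gaussian(1)[OF K, of 1 0] by (simp add: w_def integrable_iff_bounded)
    then show "emeasure (density K (\<lambda>\<xi>. ennreal (w \<xi>))) (space (density K (\<lambda>\<xi>. ennreal (w \<xi>)))) \<noteq> \<infinity>"
      by (subst emeasure_density) (auto simp: less_top cong: nn_integral_cong_simp)
  qed
  have "density \<mu> (\<lambda>\<xi>. ennreal (w \<xi>)) = density \<nu> (\<lambda>\<xi>. ennreal (w \<xi>))"
  proof (rule measure_eqI_bounded_continuous)
    fix \<psi> :: "real^'n \<Rightarrow> real"
    assume \<psi>: "continuous_on UNIV \<psi>" "\<And>x. 0 \<le> \<psi> x" "\<And>x. \<psi> x \<le> 1"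
    show "(\<integral>\<^sup>+ x. ennreal (\<psi> x) \<partial>density \<mu> (\<lambda>\<xi>. ennreal (w \<xi>))) = (\<integral>\<^sup>+ x. ennreal (\<psi> x) \<partial>density \<nu> (\<lambda>\<xi>. ennreal (w \<xi>)))"
    proof (rule nn_integral_eq_if_gaussian_transform_eq[OF fin[OF \<mu> sets(1)] fin[OF \<nu> sets(2)] _ _ _ \<psi>])
      fix t :: real and a :: "real^'n" assume t: "0 < t"
      have *: "(\<integral>\<^sup>+ \<xi>. ennreal (exp (- ((norm (\<xi> - a))\<^sup>2 / (2 * t)))) \<partial>density K (\<lambda>\<xi>. ennreal (w \<xi>)))
        = ennreal (exp (- ((norm a)\<^sup>2 / (2 * (1 + t))))) *
          (\<integral>\<^sup>+ \<xi>. ennreal (exp (- ((norm (\<xi> - (1 / (1 + t)) *\<^sub>R a))\<^sup>2 / (2 * (t / (1 + t)))))) \<partial>K)"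
        if [measurable_cong]: "sets K = sets borel" for K
        by (subst nn_integral_density, measurable, subst nn_integral_cmult[symmetric], measurable)
           (simp add: w_def gaussian_product[OF t] flip: ennreal_mult')
      show "(\<integral>\<^sup>+ \<xi>. ennreal (exp (- ((norm (\<xi> - a))\<^sup>2 / (2 * t)))) \<partial>density \<mu> (\<lambda>\<xi>. ennreal (w \<xi>)))
          = (\<integral>\<^sup>+ \<xi>. ennreal (exp (- ((norm (\<xi> - a))\<^sup>2 / (2 * t)))) \<partial>density \<nu> (\<lambda>\<xi>. ennreal (w \<xi>)))"
        unfolding *[OF sets(1)] *[OF sets(2)] using t by (subst eq) auto
    qed (simp_all add: sets)
  qed (use fin \<mu> \<nu> sets in auto)
  then have "density (density \<mu> (\<lambda>\<xi>. ennreal (w \<xi>))) (\<lambda>\<xi>. ennreal (1 / w \<xi>))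
      = density (density \<nu> (\<lambda>\<xi>. ennreal (w \<xi>))) (\<lambda>\<xi>. ennreal (1 / w \<xi>))"
    by simp
  moreover have "density (density K (\<lambda>\<xi>. ennreal (w \<xi>))) (\<lambda>\<xi>. ennreal (1 / w \<xi>)) = K"
    if [measurable_cong]: "sets K = sets borel" for K
    by (subst density_density_eq) (auto simp: w_def density_1 simp flip: ennreal_mult')
  ultimately show ?thesis using sets by metis
qed

section \<open>The Fourier transform of the Riesz kernel\<close>

text \<open>Both sides are iterated integrals of the same absolutely integrable function of (x,
  \<zeta>).\<close>

lemma fourier_multiplication:
  fixes \<phi> \<psi> :: "real^'n::finite \<Rightarrow> complex"
  assumes \<phi>: "integrable lborel \<phi>" and \<psi>: "integrable lborel \<psi>"
  shows "(LINT x|lborel. fourier \<psi> x * \<phi> x) = (LINT \<zeta>|lborel. \<psi> \<zeta> * fourier \<phi> \<zeta>)"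
proof -
  let ?f = "\<lambda>x \<zeta>. \<psi> \<zeta> * exp (- \<i> * complex_of_real (x \<bullet> \<zeta>)) * \<phi> x"
  have [measurable]: "\<phi> \<in> borel_measurable borel" "\<psi> \<in> borel_measurable borel"
    using \<phi> \<psi> by (auto dest: borel_measurable_integrable)
  have int: "integrable (lborel \<Otimes>\<^sub>M lborel) (\<lambda>(x, \<zeta>). ?f x \<zeta>)"
    unfolding integrable_iff_bounded
  proof
    have "(\<integral>\<^sup>+ p. ennreal (norm (case p of (x, \<zeta>) \<Rightarrow> ?f x \<zeta>)) \<partial>(lborel \<Otimes>\<^sub>M lborel))
        = (\<integral>\<^sup>+ x. (\<integral>\<^sup>+ \<zeta>. ennreal (norm (\<phi> x)) * ennreal (norm (\<psi> \<zeta>)) \<partial>lborel) \<partial>lborel)"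
      by (subst lborel.nn_integral_fst[symmetric])
         (auto intro!: nn_integral_cong simp: norm_mult norm_exp_eq_Re mult.commute simp flip: ennreal_mult)
    also have "\<dots> = (\<integral>\<^sup>+ x. ennreal (norm (\<phi> x)) \<partial>lborel) * (\<integral>\<^sup>+ \<zeta>. ennreal (norm (\<psi> \<zeta>)) \<partial>lborel)"
      by (simp add: nn_integral_cmult nn_integral_multc)
    also have "\<dots> < \<infinity>"
      using \<phi> \<psi> by (simp add: integrable_iff_bounded ennreal_mult_less_top)
    finally show "(\<integral>\<^sup>+ p. ennreal (norm (case p of (x, \<zeta>) \<Rightarrow> ?f x \<zeta>)) \<partial>(lborel \<Otimes>\<^sub>M lborel)) < \<infinity>" .
  qed measurable
  have "(LINT x|lborel. fourier \<psi> x * \<phi> x) = (LINT x|lborel. (LINT \<zeta>|lborel. ?f x \<zeta>))"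
    unfolding fourier_def by simp
  also have "\<dots> = (LINT \<zeta>|lborel. (LINT x|lborel. ?f x \<zeta>))"
    by (rule lborel_pair.Fubini_integral[OF int, symmetric])
  also have "\<dots> = (LINT \<zeta>|lborel. \<psi> \<zeta> * fourier \<phi> \<zeta>)"
    unfolding fourier_def
    by (subst integral_mult_right_zero[symmetric]) (simp add: mult_ac inner_commute)
  finally show ?thesis .
qed

text \<open>The multiplication formula for the Gaussian of precision 1 / t. Its transform is the
  Gaussian on the left times (2 \<pi> t)^(n/2), and this factor is moved to the other side.\<close>

lemma gaussian_parseval:
  fixes \<phi> :: "real^'n::finite \<Rightarrow> complex"
  assumes \<phi>: "integrable lborel \<phi>" and t: "0 < t"
  shows "(LINT x|lborel. complex_of_real (exp (- (t * (norm x)\<^sup>2 / 2))) * \<phi> x)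
    = (LINT \<zeta>|lborel. complex_of_real ((2 * pi * t) powr (- (CARD('n) / 2)) * exp (- ((norm \<zeta>)\<^sup>2 / (2 * t)))) * fourier \<phi> \<zeta>)"
proof -
  have l: "0 < 1 / t" using t by simp
  let ?A = "sqrt (2 * pi * t) ^ CARD('n)"
  have A: "0 < ?A" using t by simp
  have Ap: "(2 * pi * t) powr (- (CARD('n) / 2)) = 1 / ?A"
    using t by (simp add: powr_minus_divide powr_half_sqrt[symmetric] powr_realpow[symmetric] powr_powr)
  have F: "fourier (modulated_gaussian (1 / t) 0) x = complex_of_real (?A * exp (- (t * (norm x)\<^sup>2 / 2)))" for x :: "real^'n"
    using fourier_modulated_gaussian[OF l, of 0 x] t by (simp add: mult.commute)
  have G: "modulated_gaussian (1 / t) 0 \<zeta> = complex_of_real (exp (- ((norm \<zeta>)\<^sup>2 / (2 * t))))" for \<zeta> :: "real^'n"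
    unfolding modulated_gaussian_def by (simp add: exp_of_real[symmetric] mult.commute)
  have "(LINT x|lborel. complex_of_real (?A * exp (- (t * (norm x)\<^sup>2 / 2))) * \<phi> x)
      = (LINT \<zeta>|lborel. complex_of_real (exp (- ((norm \<zeta>)\<^sup>2 / (2 * t)))) * fourier \<phi> \<zeta>)"
    using fourier_multiplication[OF \<phi> modulated_gaussian_integral(1)[OF l, of 0]] unfolding F G .
  then have "complex_of_real ?A * (LINT x|lborel. complex_of_real (exp (- (t * (norm x)\<^sup>2 / 2))) * \<phi> x)
      = (LINT \<zeta>|lborel. complex_of_real (exp (- ((norm \<zeta>)\<^sup>2 / (2 * t)))) * fourier \<phi> \<zeta>)"
    unfolding of_real_mult mult.assoc integral_mult_right_zero .
  then have "(LINT x|lborel. complex_of_real (exp (- (t * (norm x)\<^sup>2 / 2))) * \<phi> x)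
      = complex_of_real (1 / ?A) * (LINT \<zeta>|lborel. complex_of_real (exp (- ((norm \<zeta>)\<^sup>2 / (2 * t)))) * fourier \<phi> \<zeta>)"
    using A t by (simp add: eq_divide_eq mult.commute del: of_real_power)
  also have "\<dots> = (LINT \<zeta>|lborel. complex_of_real ((2 * pi * t) powr (- (CARD('n) / 2)) * exp (- ((norm \<zeta>)\<^sup>2 / (2 * t)))) * fourier \<phi> \<zeta>)"
    unfolding Ap of_real_mult by (simp only: mult.assoc integral_mult_right_zero)
  finally show ?thesis .
qed

text \<open>Fubini, with absolute integrability read off from W because the kernel is nonnegative.
  The mixture identity is required only almost everywhere: for Riesz kernels the mixture diverges at
  the origin, where \<open>powr\<close> has the value 0.\<close>

lemma integral_superposition:
  fixes k :: "real \<Rightarrow> 'a::euclidean_space \<Rightarrow> real" and \<phi> :: "'a \<Rightarrow> complex"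
  assumes meas [measurable]: "(\<lambda>(t, x). k t x) \<in> borel_measurable (borel \<Otimes>\<^sub>M borel)"
    and [measurable]: "W \<in> borel_measurable borel" "\<phi> \<in> borel_measurable borel"
    and nn: "\<And>t x. 0 \<le> k t x" "\<And>x. 0 \<le> W x"
    and W: "AE x in lborel. (\<integral>\<^sup>+ t. ennreal (k t x) \<partial>lborel) = ennreal (W x)"
    and int: "integrable lborel (\<lambda>x. complex_of_real (W x) * \<phi> x)"
  shows "(LINT t|lborel. (LINT x|lborel. complex_of_real (k t x) * \<phi> x)) = (LINT x|lborel. complex_of_real (W x) * \<phi> x)"
proof -
  let ?f = "\<lambda>x t. complex_of_real (k t x) * \<phi> x"
  have m [measurable]: "(\<lambda>(x, t). k t x) \<in> borel_measurable (borel \<Otimes>\<^sub>M borel)"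
    using measurable_compose[OF measurable_pair_swap' meas] by (simp add: case_prod_beta)
  have [measurable]: "(\<lambda>t. k t x) \<in> borel_measurable borel" for x
    using measurable_compose[OF measurable_Pair2' meas] by simp
  have int2: "integrable (lborel \<Otimes>\<^sub>M lborel) (\<lambda>(x, t). ?f x t)"
    unfolding integrable_iff_bounded
  proof
    show "(\<lambda>(x, t). ?f x t) \<in> borel_measurable (lborel \<Otimes>\<^sub>M lborel)" by measurable
    have "(\<integral>\<^sup>+ p. ennreal (norm (case p of (x, t) \<Rightarrow> ?f x t)) \<partial>(lborel \<Otimes>\<^sub>M lborel))
        = (\<integral>\<^sup>+ x. (\<integral>\<^sup>+ t. ennreal (norm (?f x t)) \<partial>lborel) \<partial>lborel)"
      by (subst lborel.nn_integral_fst[symmetric]) auto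
    also have "\<dots> = (\<integral>\<^sup>+ x. ennreal (norm (complex_of_real (W x) * \<phi> x)) \<partial>lborel)"
    proof (rule nn_integral_cong_AE, use W in eventually_elim)
      case (elim x)
      have "(\<integral>\<^sup>+ t. ennreal (norm (?f x t)) \<partial>lborel) = (\<integral>\<^sup>+ t. ennreal (k t x) * ennreal (norm (\<phi> x)) \<partial>lborel)"
        using nn by (simp add: norm_mult ennreal_mult)
      also have "\<dots> = ennreal (W x) * ennreal (norm (\<phi> x))"
        by (subst nn_integral_multc) (auto simp: elim)
      finally show ?case using nn by (simp add: norm_mult ennreal_mult)
    qed
    also have "\<dots> < \<infinity>" using int by (simp add: integrable_iff_bounded)
    finally show "(\<integral>\<^sup>+ p. ennreal (norm (case p of (x, t) \<Rightarrow> ?f x t)) \<partial>(lborel \<Otimes>\<^sub>M lborel)) < \<infinity>" .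
  qed
  have "(LINT t|lborel. (LINT x|lborel. ?f x t)) = (LINT x|lborel. (LINT t|lborel. ?f x t))"
    by (rule lborel_pair.Fubini_integral[OF int2])
  also have "\<dots> = (LINT x|lborel. complex_of_real (W x) * \<phi> x)"
  proof (rule integral_cong_AE)
    show "AE x in lborel. (LINT t|lborel. ?f x t) = complex_of_real (W x) * \<phi> x"
      using W
    proof eventually_elim
      case (elim x)
      have "(LINT t|lborel. k t x) = W x"
        using nn elim by (subst integral_eq_nn_integral) auto
      then show ?case by simp
    qed
    show "(\<lambda>x. complex_of_real (W x) * \<phi> x) \<in> borel_measurable lborel" by measurable
    show "(\<lambda>x. LINT t|lborel. ?f x t) \<in> borel_measurable lborel"
      by (intro lborel.borel_measurable_lebesgue_integral) measurable
  qed
  finally show ?thesis .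
qed

section \<open>Scalar integrals for the mixing measures\<close>

text \<open>This produces the powers of the norm: c = |x|^2 and q = a/2 give |x|^(-a), while c = 1 /
  |\<zeta>|^2 and q = (a - n)/2 give |\<zeta>|^(a - n).\<close>

lemma nn_integral_Ioi_scale:
  fixes h :: "real \<Rightarrow> real"
  assumes [measurable]: "h \<in> borel_measurable borel" and c: "0 < c"
  shows "(\<integral>\<^sup>+ t\<in>{0<..}. ennreal (t powr (q - 1) * h (c * t)) \<partial>lborel)
    = ennreal (c powr (- q)) * (\<integral>\<^sup>+ t\<in>{0<..}. ennreal (t powr (q - 1) * h t) \<partial>lborel)"
proof -
  have "(\<integral>\<^sup>+ t\<in>{0<..}. ennreal (t powr (q - 1) * h t) \<partial>lborel)
      = ennreal \<bar>c\<bar> * (\<integral>\<^sup>+ t. ennreal ((0 + c * t) powr (q - 1) * h (0 + c * t)) * indicator {0<..} (0 + c * t) \<partial>lborel)"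
    using c by (intro nn_integral_real_affine) auto
  also have "(\<integral>\<^sup>+ t. ennreal ((0 + c * t) powr (q - 1) * h (0 + c * t)) * indicator {0<..} (0 + c * t) \<partial>lborel)
     = (\<integral>\<^sup>+ t. ennreal (c powr (q - 1)) * (ennreal (t powr (q - 1) * h (c * t)) * indicator {0<..} t) \<partial>lborel)"
    using c by (intro nn_integral_cong)
      (auto simp: indicator_def powr_mult zero_less_mult_iff mult.assoc ennreal_mult' simp flip: mult.assoc)
  also have "\<dots> = ennreal (c powr (q - 1)) * (\<integral>\<^sup>+ t\<in>{0<..}. ennreal (t powr (q - 1) * h (c * t)) \<partial>lborel)"
    by (intro nn_integral_cmult) measurable
  finally have "ennreal (c powr (- q)) * (\<integral>\<^sup>+ t\<in>{0<..}. ennreal (t powr (q - 1) * h t) \<partial>lborel)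
     = ennreal (c powr (- q) * (c * c powr (q - 1))) * (\<integral>\<^sup>+ t\<in>{0<..}. ennreal (t powr (q - 1) * h (c * t)) \<partial>lborel)"
    using c by (simp add: ennreal_mult' mult.assoc)
  also have "c powr (- q) * (c * c powr (q - 1)) = 1"
    using c by (simp add: powr_diff powr_minus)
  finally show ?thesis by simp
qed

lemma nn_integral_Ioi_finite:
  fixes f :: "real \<Rightarrow> real"
  assumes "\<And>t. 0 < t \<Longrightarrow> t \<le> 1 \<Longrightarrow> f t \<le> A * t powr p" "\<And>t. 1 \<le> t \<Longrightarrow> f t \<le> B * t powr q"
    and "-1 < p" "q < -1" "0 \<le> A" "0 \<le> B"
  shows "(\<integral>\<^sup>+ t\<in>{0<..}. ennreal (f t) \<partial>lborel) < \<infinity>"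
proof -
  have "(\<integral>\<^sup>+ t\<in>{0<..}. ennreal (f t) \<partial>lborel)
      \<le> (\<integral>\<^sup>+ t. ennreal A * (ennreal (t powr p) * indicator {0..1} t) + ennreal B * (ennreal (t powr q) * indicator {1..} t) \<partial>lborel)"
  proof (rule nn_integral_mono)
    fix t :: real
    consider "t \<le> 0" | "0 < t" "t < 1" | "1 \<le> t" by linarith
    then show "ennreal (f t) * indicator {0<..} t \<le>
       ennreal A * (ennreal (t powr p) * indicator {0..1} t) + ennreal B * (ennreal (t powr q) * indicator {1..} t)"
    proof cases
      case 2
      then show ?thesis using ennreal_leI[OF assms(1)[of t]] assms(5) by (simp add: ennreal_mult indicator_def)
    next
      case 3
      then have "ennreal (f t) \<le> ennreal B * ennreal (t powr q)"
        using ennreal_leI[OF assms(2)[of t]] assms(6) by (simp add: ennreal_mult)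
      then show ?thesis using 3 by (simp add: add_increasing)
    qed auto
  qed
  also have "\<dots> = ennreal A * (\<integral>\<^sup>+ t\<in>{0..1}. ennreal (t powr p) \<partial>lborel) + ennreal B * (\<integral>\<^sup>+ t\<in>{1..}. ennreal (t powr q) \<partial>lborel)"
    by (subst nn_integral_add) (auto simp: nn_integral_cmult)
  also have "\<dots> < \<infinity>"
  proof -
    have "(\<integral>\<^sup>+ t\<in>{0..1}. ennreal (t powr p) \<partial>lborel) = ennreal (1 powr (p + 1) / (p + 1))"
      using assms by (intro nn_integral_has_integral_lebesgue' has_integral_powr_from_0) auto
    moreover have "(\<integral>\<^sup>+ t\<in>{1..}. ennreal (t powr q) \<partial>lborel) = ennreal (- (1 powr (q + 1)) / (q + 1))"
      using assms by (intro nn_integral_has_integral_lebesgue' has_integral_powr_to_inf) auto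
    ultimately show ?thesis by (simp add: ennreal_mult_less_top)
  qed
  finally show ?thesis .
qed

text \<open>It makes the normalising constants of both mixtures nonzero, so that their quotient is a
  positive number.\<close>

lemma nn_integral_Ioi_pos:
  fixes f :: "real \<Rightarrow> real"
  assumes [measurable]: "f \<in> borel_measurable borel" and pos: "\<And>t. 0 < t \<Longrightarrow> 0 < f t"
  shows "(\<integral>\<^sup>+ t\<in>{0<..}. ennreal (f t) \<partial>lborel) \<noteq> 0"
proof
  assume "(\<integral>\<^sup>+ t\<in>{0<..}. ennreal (f t) \<partial>lborel) = 0"
  then have "AE t in lborel. ennreal (f t) * indicator {0<..} t = 0"
    by (subst (asm) nn_integral_0_iff_AE) auto
  then have "AE t in lborel. t \<notin> {1..2::real}"
  proof eventually_elim
    case (elim t)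
    show ?case
    proof
      assume "t \<in> {1..2}"
      then show False using elim pos[of t] by (simp add: ennreal_eq_0_iff)
    qed
  qed
  then have "{1..2::real} \<in> null_sets lborel"
    by (subst AE_iff_null_sets) auto
  then show False by (auto dest: null_setsD1)
qed

lemma powr_le_exp:
  fixes q :: real
  obtains C where "0 \<le> C" "\<And>u. 1 \<le> u \<Longrightarrow> u powr q \<le> C * exp (u / 2)"
proof -
  obtain k :: nat where k: "q \<le> real k" using real_arch_simple by blast
  have "u powr q \<le> 2 ^ k * fact k * exp (u / 2)" if "1 \<le> u" for u :: real
  proof -
    have "u powr q \<le> u powr k" using that k by (intro powr_mono) auto
    also have "\<dots> = 2 ^ k * (u / 2) ^ k" using that by (simp add: powr_realpow power_divide)
    also have "\<dots> \<le> 2 ^ k * (fact k * exp (u / 2))"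
      using that by (intro mult_left_mono power_le_fact_exp) auto
    finally show ?thesis by (simp add: mult.assoc)
  qed
  then show ?thesis by (intro that[of "2 ^ k * fact k"]) auto
qed

text \<open>The integral is 2^q Gamma(q); only its finiteness matters.\<close>

lemma nn_integral_powr_exp_decay:
  assumes "0 < q"
  shows "(\<integral>\<^sup>+ t\<in>{0<..}. ennreal (t powr (q - 1) * exp (- (t / 2))) \<partial>lborel) < \<infinity>"
proof -
  obtain C where C: "0 \<le> C" "\<And>u. 1 \<le> u \<Longrightarrow> u powr (q + 1) \<le> C * exp (u / 2)"
    using powr_le_exp[of "q + 1"] by blast
  show ?thesis
  proof (rule nn_integral_Ioi_finite[where A=1 and p="q - 1" and B=C and q="-2"])
    fix t :: real
    show "t powr (q - 1) * exp (- (t / 2)) \<le> 1 * t powr (q - 1)" if "0 < t"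
      using that by (simp add: mult_left_le)
    show "t powr (q - 1) * exp (- (t / 2)) \<le> C * t powr - 2" if "1 \<le> t"
    proof -
      have "t powr (q - 1) = t powr (q + 1) * t powr (-2)"
        by (simp flip: powr_add)
      then have "t powr (q - 1) * exp (- (t / 2)) = t powr (q + 1) * exp (- (t / 2)) * t powr (-2)"
        by simp
      also have "\<dots> \<le> C * t powr (-2)"
        using C(2)[OF that] by (intro mult_right_mono) (auto simp: exp_minus field_simps)
      finally show ?thesis .
    qed
  qed (use assms C in auto)
qed

text \<open>Under t -> 1/t this is the preceding integral for -q. It is estimated directly, the
  exponential taming the singularity at 0 and q < 0 giving decay at infinity.\<close>

lemma nn_integral_powr_exp_inverse_decay:
  assumes "q < 0"
  shows "(\<integral>\<^sup>+ t\<in>{0<..}. ennreal (t powr (q - 1) * exp (- (1 / (2 * t)))) \<partial>lborel) < \<infinity>"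
proof -
  obtain C where C: "0 \<le> C" "\<And>u. 1 \<le> u \<Longrightarrow> u powr (1 - q) \<le> C * exp (u / 2)"
    using powr_le_exp[of "1 - q"] by blast
  show ?thesis
  proof (rule nn_integral_Ioi_finite[where A=C and p=0 and B=1 and q="q - 1"])
    fix t :: real
    show "t powr (q - 1) * exp (- (1 / (2 * t))) \<le> 1 * t powr (q - 1)" if "1 \<le> t"
      using that by (simp add: mult_left_le)
    show "t powr (q - 1) * exp (- (1 / (2 * t))) \<le> C * t powr 0" if t: "0 < t" "t \<le> 1"
    proof -
      have "t powr (q - 1) = (1 / t) powr (1 - q)"
        using t powr_minus_divide[of t "1 - q"] by (simp add: powr_divide)
      also have "\<dots> \<le> C * exp (1 / t / 2)"
        using t by (intro C) auto
      finally show ?thesis using t by (simp add: exp_minus field_simps)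
    qed
  qed (use assms C in auto)
qed

lemma integrable_norm_powr_times:
  fixes g :: "'a::euclidean_space \<Rightarrow> complex"
  assumes p: "0 < p" "p < real DIM('a)" and k: "DIM('a) < p + 2 * real k"
    and [measurable]: "g \<in> borel_measurable borel" and bound: "\<And>x. norm (g x) \<le> C / (1 + (norm x)\<^sup>2) ^ k"
  shows "integrable lborel (\<lambda>x. complex_of_real (norm x powr (- p)) * g x)"
proof (rule Bochner_Integration.integrable_bound)
  show "integrable lborel (\<lambda>x::'a. C * (norm x powr (- p) * (1 + (norm x)\<^sup>2) powr (- real k)))"
  proof (intro integrable_mult_right integrableI_nonneg)
    show "(\<integral>\<^sup>+ x. ennreal (norm (x::'a) powr (- p) * (1 + (norm x)\<^sup>2) powr (- real k)) \<partial>lborel) < \<infinity>"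
      using assms by (intro nn_integral_norm_powr_weight_finite)
  qed auto
  have "norm (complex_of_real (norm x powr (- p)) * g x) \<le> norm (C * (norm x powr (- p) * (1 + (norm x)\<^sup>2) powr (- real k)))" for x :: 'a
  proof -
    have "norm (complex_of_real (norm x powr (- p)) * g x) \<le> norm x powr (- p) * (C / (1 + (norm x)\<^sup>2) ^ k)"
      unfolding norm_mult using mult_left_mono[OF bound[of x], of "norm x powr (- p)"] by simp
    also have "\<dots> = C * (norm x powr (- p) * (1 + (norm x)\<^sup>2) powr (- real k))"
      by (simp add: powr_minus powr_realpow add_pos_nonneg divide_inverse mult_ac)
    also have "\<dots> \<le> norm \<dots>" by simp
    finally show ?thesis .
  qed
  then show "AE x in lborel. norm (complex_of_real (norm x powr (- p)) * g x) \<le> norm (C * (norm x powr (- p) * (1 + (norm x)\<^sup>2) powr (- real k)))"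
    by simp
qed measurable

lemma riesz_kernel_parseval:
  fixes a :: real
  assumes a: "0 < a" "a < CARD('n::finite)"
  obtains K :: real where "0 < K"
    "\<And>\<phi> :: real^'n \<Rightarrow> complex. schwartz_fun \<phi> \<Longrightarrow>
      integrable lborel (\<lambda>x. complex_of_real (norm x powr (- a)) * \<phi> x) \<and>
      integrable lborel (\<lambda>\<zeta>. complex_of_real (norm \<zeta> powr (a - CARD('n))) * fourier \<phi> \<zeta>) \<and>
      (LINT x|lborel. complex_of_real (norm x powr (- a)) * \<phi> x) =
        complex_of_real K * (LINT \<zeta>|lborel. complex_of_real (norm \<zeta> powr (a - CARD('n))) * fourier \<phi> \<zeta>)"
proof -
  let ?n = "real CARD('n)"
  define L1 where "L1 = (\<integral>\<^sup>+ t\<in>{0<..}. ennreal (t powr (a / 2 - 1) * exp (- (t / 2))) \<partial>lborel)"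
  define K1 where "K1 = (\<integral>\<^sup>+ t\<in>{0<..}. ennreal (t powr ((a - ?n) / 2 - 1) * exp (- (1 / (2 * t)))) \<partial>lborel)"
  \<comment> \<open>Finiteness of \<open>L1\<close> is where 0 < a enters, that of \<open>K1\<close>
    where a < n does.\<close>
  have L1: "L1 < \<infinity>" "L1 \<noteq> 0"
    unfolding L1_def using a by (intro nn_integral_powr_exp_decay nn_integral_Ioi_pos; auto)+
  have K1: "K1 < \<infinity>" "K1 \<noteq> 0"
    unfolding K1_def using a by (intro nn_integral_powr_exp_inverse_decay nn_integral_Ioi_pos; auto)+
  define l where "l = enn2real L1"
  define c where "c = (2 * pi) powr (- (?n / 2)) * enn2real K1"
  have l: "0 < l" "L1 = ennreal l" using L1 by (auto simp: l_def enn2real_positive_iff zero_less_iff_neq_zero)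
  have c: "0 < c" using K1 by (auto simp: c_def enn2real_positive_iff zero_less_iff_neq_zero)
  \<comment> \<open>For each t > 0 the second kernel is what the first becomes on the Fourier side.
    The factor (2 \<pi> t)^(-n/2) gained there shifts the mixing exponent from a/2 - 1 to (a - n)/2
    - 1.\<close>
  define kL where "kL t x = indicator {0<..} t * (t powr (a / 2 - 1) * exp (- (t * (norm x)\<^sup>2 / 2)))" for t and x :: "real^'n"
  define kK where "kK t \<zeta> = indicator {0<..} t * (t powr (a / 2 - 1) * ((2 * pi * t) powr (- (?n / 2)) * exp (- ((norm \<zeta>)\<^sup>2 / (2 * t)))))" for t and \<zeta> :: "real^'n"
  have kL: "(\<integral>\<^sup>+ t. ennreal (kL t x) \<partial>lborel) = ennreal (l * norm x powr (- a))" if "x \<noteq> 0" for x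
  proof -
    have "(\<integral>\<^sup>+ t. ennreal (kL t x) \<partial>lborel) = (\<integral>\<^sup>+ t\<in>{0<..}. ennreal (t powr (a / 2 - 1) * exp (- ((norm x)\<^sup>2 * t / 2))) \<partial>lborel)"
      by (intro nn_integral_cong) (auto simp: kL_def indicator_def mult.commute)
    also have "\<dots> = ennreal (((norm x)\<^sup>2) powr (- (a / 2))) * L1"
      unfolding L1_def using that by (intro nn_integral_Ioi_scale[where h="\<lambda>u. exp (- (u / 2))"]) auto
    also have "((norm x)\<^sup>2) powr (- (a / 2)) = norm x powr (- a)"
      using that by (simp add: powr_powr flip: powr_numeral)
    finally show ?thesis using l by (simp add: ennreal_mult mult.commute)
  qed
  have kK: "(\<integral>\<^sup>+ t. ennreal (kK t \<zeta>) \<partial>lborel) = ennreal (c * norm \<zeta> powr (a - ?n))" if "\<zeta> \<noteq> 0" for \<zeta>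
  proof -
    have "(\<integral>\<^sup>+ t. ennreal (kK t \<zeta>) \<partial>lborel) = (\<integral>\<^sup>+ t. ennreal ((2 * pi) powr (- (?n / 2))) *
        (ennreal (t powr ((a - ?n) / 2 - 1) * exp (- (1 / (2 * (1 / (norm \<zeta>)\<^sup>2 * t))))) * indicator {0<..} t) \<partial>lborel)"
    proof (intro nn_integral_cong)
      fix t :: real
      have "t powr (a / 2 - 1) * (2 * pi * t) powr (- (?n / 2)) = (2 * pi) powr (- (?n / 2)) * t powr ((a - ?n) / 2 - 1)" if "0 < t"
      proof -
        have "(a - ?n) / 2 - 1 = (a / 2 - 1) + (- (?n / 2))" by (simp add: diff_divide_distrib)
        then show ?thesis using that by (simp only: powr_add) (simp add: powr_mult)
      qed
      then show "ennreal (kK t \<zeta>) = ennreal ((2 * pi) powr (- (?n / 2))) *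
        (ennreal (t powr ((a - ?n) / 2 - 1) * exp (- (1 / (2 * (1 / (norm \<zeta>)\<^sup>2 * t))))) * indicator {0<..} t)"
        by (auto simp: kK_def indicator_def mult.assoc simp flip: ennreal_mult')
    qed
    also have "\<dots> = ennreal ((2 * pi) powr (- (?n / 2))) * (\<integral>\<^sup>+ t\<in>{0<..}. ennreal (t powr ((a - ?n) / 2 - 1) * exp (- (1 / (2 * (1 / (norm \<zeta>)\<^sup>2 * t))))) \<partial>lborel)"
      by (intro nn_integral_cmult) measurable
    also have "(\<integral>\<^sup>+ t\<in>{0<..}. ennreal (t powr ((a - ?n) / 2 - 1) * exp (- (1 / (2 * (1 / (norm \<zeta>)\<^sup>2 * t))))) \<partial>lborel)
        = ennreal ((1 / (norm \<zeta>)\<^sup>2) powr (- ((a - ?n) / 2))) * K1"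
      unfolding K1_def using that by (intro nn_integral_Ioi_scale[where h="\<lambda>u. exp (- (1 / (2 * u)))"]) auto
    also have "(1 / (norm \<zeta>)\<^sup>2) powr (- ((a - ?n) / 2)) = norm \<zeta> powr (a - ?n)"
    proof -
      have "1 / (norm \<zeta>)\<^sup>2 = norm \<zeta> powr (-2)"
        using that by (simp add: powr_minus_divide powr_numeral)
      moreover have "- 2 * - ((a - ?n) / 2) = a - ?n" by (simp add: field_simps)
      ultimately show ?thesis by (simp only: powr_powr)
    qed
    also have "K1 = ennreal (enn2real K1)" using K1 by simp
    finally show ?thesis by (simp add: c_def ennreal_mult' mult_ac)
  qed
  have measL: "(\<lambda>(t, x). kL t x) \<in> borel_measurable (borel \<Otimes>\<^sub>M borel)" unfolding kL_def by measurable
  have measK: "(\<lambda>(t, x). kK t x) \<in> borel_measurable (borel \<Otimes>\<^sub>M borel)" unfolding kK_def by measurable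
  have AE0: "AE x in lborel. x \<noteq> (0::real^'n)" by (rule AE_lborel_singleton)
  have "integrable lborel (\<lambda>x. complex_of_real (norm x powr (- a)) * \<phi> x) \<and>
      integrable lborel (\<lambda>\<zeta>. complex_of_real (norm \<zeta> powr (a - ?n)) * fourier \<phi> \<zeta>) \<and>
      (LINT x|lborel. complex_of_real (norm x powr (- a)) * \<phi> x) =
        complex_of_real (c / l) * (LINT \<zeta>|lborel. complex_of_real (norm \<zeta> powr (a - ?n)) * fourier \<phi> \<zeta>)"
    if \<phi>: "schwartz_fun \<phi>" for \<phi> :: "real^'n \<Rightarrow> complex"
  proof -
    have [measurable]: "\<phi> \<in> borel_measurable borel" by (rule schwartz_fun_measurable[OF \<phi>])
    have [measurable]: "fourier \<phi> \<in> borel_measurable borel" by (rule fourier_measurable) measurable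
    obtain C1 where C1: "\<And>x. norm (\<phi> x) \<le> C1 / (1 + (norm x)\<^sup>2) ^ CARD('n)"
      using schwartz_fun_decay[OF \<phi>] by metis
    obtain C2 where C2: "\<And>x. norm (fourier \<phi> x) \<le> C2 / (1 + (norm x)\<^sup>2) ^ CARD('n)"
      using fourier_decay[OF \<phi>] by metis
    have int1: "integrable lborel (\<lambda>x. complex_of_real (norm x powr (- a)) * \<phi> x)"
      using a by (intro integrable_norm_powr_times[OF _ _ _ _ C1]) auto
    have int2: "integrable lborel (\<lambda>\<zeta>. complex_of_real (norm \<zeta> powr (- (?n - a))) * fourier \<phi> \<zeta>)"
      using a by (intro integrable_norm_powr_times[OF _ _ _ _ C2]) auto
    then have int2: "integrable lborel (\<lambda>\<zeta>. complex_of_real (norm \<zeta> powr (a - ?n)) * fourier \<phi> \<zeta>)"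
      by simp
    have "l * (LINT x|lborel. complex_of_real (norm x powr (- a)) * \<phi> x)
        = (LINT x|lborel. complex_of_real (l * norm x powr (- a)) * \<phi> x)"
      by (simp add: mult.assoc)
    also have "\<dots> = (LINT t|lborel. (LINT x|lborel. complex_of_real (kL t x) * \<phi> x))"
    proof (rule integral_superposition[OF measL, where W="\<lambda>x. l * norm x powr (- a)" and \<phi>=\<phi>, symmetric])
      show "AE x in lborel. (\<integral>\<^sup>+ t. ennreal (kL t x) \<partial>lborel) = ennreal (l * norm x powr (- a))"
        using AE0 by eventually_elim (rule kL)
      show "integrable lborel (\<lambda>x. complex_of_real (l * norm x powr (- a)) * \<phi> x)"
        using int1 by (simp add: mult.assoc)
    qed (use l in \<open>auto simp: kL_def\<close>)
    also have "\<dots> = (LINT t|lborel. (LINT \<zeta>|lborel. complex_of_real (kK t \<zeta>) * fourier \<phi> \<zeta>))"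
    proof (rule Bochner_Integration.integral_cong[OF refl])
      fix t :: real
      show "(LINT x|lborel. complex_of_real (kL t x) * \<phi> x) = (LINT \<zeta>|lborel. complex_of_real (kK t \<zeta>) * fourier \<phi> \<zeta>)"
      proof (cases "0 < t")
        case True
        have "(LINT x|lborel. complex_of_real (kL t x) * \<phi> x)
          = complex_of_real (t powr (a / 2 - 1)) * (LINT x|lborel. complex_of_real (exp (- (t * (norm x)\<^sup>2 / 2))) * \<phi> x)"
          unfolding integral_mult_right_zero[symmetric] using True by (simp add: kL_def mult.assoc)
        also have "\<dots> = complex_of_real (t powr (a / 2 - 1)) *
           (LINT \<zeta>|lborel. complex_of_real ((2 * pi * t) powr (- (?n / 2)) * exp (- ((norm \<zeta>)\<^sup>2 / (2 * t)))) * fourier \<phi> \<zeta>)"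
          using gaussian_parseval[OF schwartz_fun_integrable[OF \<phi>] True] by simp
        also have "\<dots> = (LINT \<zeta>|lborel. complex_of_real (kK t \<zeta>) * fourier \<phi> \<zeta>)"
          unfolding integral_mult_right_zero[symmetric] using True by (simp add: kK_def mult.assoc)
        finally show ?thesis .
      qed (simp add: kL_def kK_def)
    qed
    also have "\<dots> = (LINT \<zeta>|lborel. complex_of_real (c * norm \<zeta> powr (a - ?n)) * fourier \<phi> \<zeta>)"
    proof (rule integral_superposition[OF measK, where W="\<lambda>\<zeta>. c * norm \<zeta> powr (a - ?n)" and \<phi>="fourier \<phi>"])
      show "AE x in lborel. (\<integral>\<^sup>+ t. ennreal (kK t x) \<partial>lborel) = ennreal (c * norm x powr (a - ?n))"
        using AE0 by eventually_elim (rule kK)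
      show "integrable lborel (\<lambda>x. complex_of_real (c * norm x powr (a - ?n)) * fourier \<phi> x)"
        using int2 by (simp add: mult.assoc)
    qed (use c in \<open>auto simp: kK_def\<close>)
    also have "\<dots> = c * (LINT \<zeta>|lborel. complex_of_real (norm \<zeta> powr (a - ?n)) * fourier \<phi> \<zeta>)"
      by (simp add: mult.assoc)
    finally have "(LINT x|lborel. complex_of_real (norm x powr (- a)) * \<phi> x) =
        complex_of_real (c / l) * (LINT \<zeta>|lborel. complex_of_real (norm \<zeta> powr (a - ?n)) * fourier \<phi> \<zeta>)"
      using l by (simp add: field_simps)
    with int1 int2 show ?thesis by blast
  qed
  moreover have "0 < c / l" using c l by simp
  ultimately show ?thesis by (rule that[rotated])
qed

text \<open>\<open>K\<close> is fixed before the scalar \<open>c\<close>, so the same constant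
  serves every multiple: c = 1 identifies \<mu>, and a ratio of two such constants gives the
  transform of the weighted measure.\<close>

lemma riesz_kernel_fourier_transform:
  fixes a :: real
  assumes a: "0 < a" "a < CARD('n::finite)"
  obtains K :: real where "0 < K"
    "\<And>c. 0 \<le> c \<Longrightarrow> has_fourier_transform
       (density lborel (\<lambda>\<zeta>::real^'n. ennreal (c * K * norm \<zeta> powr (a - CARD('n))))) (\<lambda>x. c * norm x powr (- a))"
proof -
  let ?n = "real CARD('n)"
  obtain K :: real where K: "0 < K" and
    P: "\<And>\<phi> :: real^'n \<Rightarrow> complex. schwartz_fun \<phi> \<Longrightarrow>
      integrable lborel (\<lambda>x. complex_of_real (norm x powr (- a)) * \<phi> x) \<and>
      integrable lborel (\<lambda>\<zeta>. complex_of_real (norm \<zeta> powr (a - CARD('n))) * fourier \<phi> \<zeta>) \<and>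
      (LINT x|lborel. complex_of_real (norm x powr (- a)) * \<phi> x) =
        complex_of_real K * (LINT \<zeta>|lborel. complex_of_real (norm \<zeta> powr (a - CARD('n))) * fourier \<phi> \<zeta>)"
    by (rule riesz_kernel_parseval[OF a]) blast
  have "has_fourier_transform (density lborel (\<lambda>\<zeta>::real^'n. ennreal (c * K * norm \<zeta> powr (a - ?n)))) (\<lambda>x. c * norm x powr (- a))"
    (is "has_fourier_transform ?\<nu> _") if c: "0 \<le> c" for c
    unfolding has_fourier_transform_def
  proof (intro conjI allI impI)
    have cK: "0 \<le> c * K" "0 \<le> c * (K * norm x powr (a - ?n))" for x :: "real^'n" using c K by simp_all
    have "(\<integral>\<^sup>+ x. ennreal (1 / (1 + (norm x)\<^sup>2) ^ CARD('n)) \<partial>?\<nu>)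
        = (\<integral>\<^sup>+ x. ennreal (c * K * norm (x::real^'n) powr (a - ?n)) * ennreal (1 / (1 + (norm x)\<^sup>2) ^ CARD('n)) \<partial>lborel)"
      by (rule nn_integral_density) measurable
    also have "\<dots> = (\<integral>\<^sup>+ x. ennreal (c * K) * ennreal (norm (x::real^'n) powr (- (?n - a)) * (1 + (norm x)\<^sup>2) powr (- ?n)) \<partial>lborel)"
    proof (rule nn_integral_cong)
      fix x :: "real^'n"
      have "(1 + (norm x)\<^sup>2) powr (- ?n) = 1 / (1 + (norm x)\<^sup>2) ^ CARD('n)"
        by (simp add: powr_minus_divide powr_realpow add_pos_nonneg)
      then show "ennreal (c * K * norm x powr (a - ?n)) * ennreal (1 / (1 + (norm x)\<^sup>2) ^ CARD('n))
          = ennreal (c * K) * ennreal (norm x powr (- (?n - a)) * (1 + (norm x)\<^sup>2) powr (- ?n))"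
        using cK by (simp add: ennreal_mult'[symmetric])
    qed
    also have "\<dots> = ennreal (c * K) * (\<integral>\<^sup>+ x. ennreal (norm (x::real^'n) powr (- (?n - a)) * (1 + (norm x)\<^sup>2) powr (- ?n)) \<partial>lborel)"
      by (rule nn_integral_cmult) measurable
    also have "\<dots> < \<infinity>"
      using nn_integral_norm_powr_weight_finite[where 'a="real^'n", of "?n - a" ?n] a by (simp add: ennreal_mult_less_top)
    finally show "tempered_measure ?\<nu>"
      unfolding tempered_measure_def by auto
    fix \<phi> :: "real^'n \<Rightarrow> complex" assume \<phi>: "schwartz_fun \<phi>"
    have [measurable]: "fourier \<phi> \<in> borel_measurable borel"
      by (intro fourier_measurable schwartz_fun_measurable \<phi>)
    show "integrable lborel (\<lambda>x. complex_of_real (c * norm x powr (- a)) * \<phi> x)"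
      using P[OF \<phi>] by (simp add: mult.assoc)
    show "integrable ?\<nu> (fourier \<phi>)"
      using P[OF \<phi>] cK by (subst integrable_density) (auto simp: scaleR_conv_of_real mult.assoc)
    have "(LINT \<xi>|?\<nu>. fourier \<phi> \<xi>) = c * K * (LINT \<zeta>|lborel. complex_of_real (norm \<zeta> powr (a - ?n)) * fourier \<phi> \<zeta>)"
      using cK by (subst integral_density) (auto simp: scaleR_conv_of_real mult.assoc)
    also have "\<dots> = c * (LINT x|lborel. complex_of_real (norm x powr (- a)) * \<phi> x)"
      using P[OF \<phi>] by simp
    also have "\<dots> = (LINT x|lborel. complex_of_real (c * norm x powr (- a)) * \<phi> x)"
      by (simp add: mult.assoc)
    finally show "(LINT x|lborel. complex_of_real (c * norm x powr (- a)) * \<phi> x) = (LINT \<xi>|?\<nu>. fourier \<phi> \<xi>)" ..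
  qed
  with K show ?thesis by (rule that)
qed

text \<open>It replaces the weight of (i) by the one whose integrals are known. The factor 2 bounds
  2^p, which comes from 1 + r^2 <= 2 max(1, r^2).\<close>

lemma inverse_one_plus_powr_le:
  fixes r p :: real
  assumes "0 \<le> r" "0 < p" "p < 1"
  shows "1 / (1 + r powr (2 * p)) \<le> 2 * (1 + r\<^sup>2) powr (- p)"
proof -
  have "(1 + r\<^sup>2) powr p \<le> 2 * (1 + r powr (2 * p))"
  proof (cases "r \<le> 1")
    case True
    then have "r\<^sup>2 \<le> 1" using assms by (simp add: power_le_one)
    then have "(1 + r\<^sup>2) powr p \<le> 2 powr p" using assms by (intro powr_mono2) auto
    also have "\<dots> \<le> 2" using assms powr_mono[of p 1 2] by simp
    finally show ?thesis using powr_ge_zero[of r "2 * p"] unfolding distrib_left by linarith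
  next
    case False
    then have "1 \<le> r\<^sup>2" by (simp add: one_le_power)
    then have "(1 + r\<^sup>2) powr p \<le> (2 * r powr 2) powr p" using False assms by (intro powr_mono2) (auto simp: powr_numeral)
    also have "\<dots> = 2 powr p * r powr (2 * p)" unfolding powr_powr[symmetric] using assms by (intro powr_mult)
    also have "\<dots> \<le> 2 * r powr (2 * p)" using assms powr_mono[of p 1 2] by (intro mult_right_mono) auto
    finally show ?thesis by simp
  qed
  moreover have "0 < (1 + r\<^sup>2) powr p" "0 < 1 + r powr (2 * p)"
    using add_pos_nonneg[of 1 "r\<^sup>2"] add_pos_nonneg[of 1 "r powr (2 * p)"] by auto
  ultimately show ?thesis by (simp add: powr_minus field_simps)
qed

lemma locally_integrable_norm_powr:
  assumes "0 < a" "a < real CARD('n)"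
  shows "locally_integrable (\<lambda>x::real^'n::finite. c * norm x powr (- a))"
  unfolding locally_integrable_def
proof (intro allI impI)
  fix K :: "(real^'n) set" assume K: "compact K"
  have [measurable]: "K \<in> sets borel" using K by (simp add: borel_compact)
  obtain R where R: "0 < R" "K \<subseteq> cball 0 R"
    using compact_imp_bounded[OF K] unfolding bounded_pos by (auto simp: subset_eq)
  have "integrable lborel (\<lambda>x::real^'n. indicator (cball 0 R) x * norm x powr (- a))"
  proof (rule integrableI_nonneg)
    have "(\<integral>\<^sup>+ x. ennreal (indicator (cball 0 R) x * norm (x::real^'n) powr (- a)) \<partial>lborel)
        = (\<integral>\<^sup>+ x\<in>cball 0 R. ennreal (norm (x::real^'n) powr (- a)) \<partial>lborel)"
      by (intro nn_integral_cong) (auto simp: indicator_def)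
    also have "\<dots> < \<infinity>"
      using nn_integral_cball_norm_powr[where 'a="real^'n", of a R] nn_integral_cball_norm_powr_finite[where 'a="real^'n", of a] assms R
      by (simp add: ennreal_mult_less_top)
    finally show "(\<integral>\<^sup>+ x. ennreal (indicator (cball 0 R) x * norm (x::real^'n) powr (- a)) \<partial>lborel) < \<infinity>" .
  qed auto
  then have "integrable lborel (\<lambda>x::real^'n. c * (indicator (cball 0 R) x * norm x powr (- a)))"
    by (rule integrable_mult_right)
  then show "set_integrable lborel K (\<lambda>x. c * norm x powr (- a))"
    unfolding set_integrable_def
  proof (rule Bochner_Integration.integrable_bound)
    show "AE x in lborel. norm (indicat_real K x *\<^sub>R (c * norm x powr - a)) \<le> norm (c * (indicator (cball 0 R) x * norm x powr - a))"
      using R(2) by (intro AE_I2) (auto simp: indicator_def abs_mult)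
  qed measurable
qed

section \<open>The spectral measure and the four estimates\<close>

theorem proposition5p2:
  fixes T \<beta> :: real and f :: "real^3 \<Rightarrow> real" and \<mu> :: "(real^3) measure"
  assumes "0 < T" and "0 < \<beta>" and "\<beta> < 2"
    and "f = (\<lambda>x. norm x powr (- \<beta>))"
    and "is_spectral_measure f \<mu>"
  shows
    "(\<forall>\<gamma>. 0 < \<gamma> \<and> \<gamma> < (2 - \<beta>) / 2 \<longrightarrow>
        (\<exists>g. (\<forall>x. 0 \<le> g x) \<and> locally_integrable g \<and>
             has_fourier_transform (density \<mu> (\<lambda>\<zeta>. ennreal (norm \<zeta> powr (2 * \<gamma>)))) g) \<and>
        (\<integral>\<^sup>+ \<zeta>. ennreal (1 / (1 + norm \<zeta> powr (2 - 2 * \<gamma>))) \<partial>\<mu>) < \<infinity>)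
     \<and>
     (\<exists>C::real. \<forall>h. 0 < h \<and> h \<le> 2 * T \<longrightarrow>
        (\<integral>\<^sup>+ z \<in> cball 0 h. ennreal (f z / norm z) \<partial>lborel) \<le> ennreal (C * h powr (2 - \<beta>)))
     \<and>
     (\<forall>\<rho>\<^sub>1. 0 < \<rho>\<^sub>1 \<and> \<rho>\<^sub>1 < min (2 - \<beta>) 1 \<longrightarrow>
        (\<exists>C::real. \<forall>h. 0 < h \<and> h \<le> 1 \<longrightarrow>
          (\<integral>\<^sup>+ s \<in> {0..T}. (\<integral>\<^sup>+ \<eta>. (\<integral>\<^sup>+ \<xi>.
              ennreal (\<bar>f (s *\<^sub>R (\<xi> + \<eta>) + h *\<^sub>R (\<xi> + \<eta>)) - f (s *\<^sub>R (\<xi> + \<eta>) + h *\<^sub>R \<eta>)\<bar> * s)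
            \<partial>sphere_measure) \<partial>sphere_measure) \<partial>lborel)
          \<le> ennreal (C * h powr \<rho>\<^sub>1)))
     \<and>
     (\<forall>\<rho>\<^sub>2. 0 < \<rho>\<^sub>2 \<and> \<rho>\<^sub>2 < 2 - \<beta> \<longrightarrow>
        (\<exists>C::real. \<forall>h. 0 < h \<and> h \<le> 1 \<longrightarrow>
          (\<integral>\<^sup>+ s \<in> {0..T}. (\<integral>\<^sup>+ \<eta>. (\<integral>\<^sup>+ \<xi>.
              ennreal (\<bar>f (s *\<^sub>R (\<xi> + \<eta>) + h *\<^sub>R (\<xi> + \<eta>)) - f (s *\<^sub>R (\<xi> + \<eta>) + h *\<^sub>R \<xi>)
                        - f (s *\<^sub>R (\<xi> + \<eta>) + h *\<^sub>R \<eta>) + f (s *\<^sub>R (\<xi> + \<eta>))\<bar> * s\<^sup>2)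
            \<partial>sphere_measure) \<partial>sphere_measure) \<partial>lborel)
          \<le> ennreal (C * h powr \<rho>\<^sub>2)))"
proof (intro conjI allI impI)
  have \<beta>3: "0 < \<beta>" "\<beta> < real CARD(3)" using assms(2,3) by auto
  obtain K :: real where K: "0 < K" and FT: "\<And>c. 0 \<le> c \<Longrightarrow> has_fourier_transform
       (density lborel (\<lambda>\<zeta>::real^3. ennreal (c * K * norm \<zeta> powr (\<beta> - CARD(3))))) (\<lambda>x. c * norm x powr (- \<beta>))"
    by (rule riesz_kernel_fourier_transform[OF \<beta>3]) blast
  have \<mu>: "\<mu> = density lborel (\<lambda>\<zeta>. ennreal (K * norm \<zeta> powr (\<beta> - 3)))"
    using fourier_transform_unique[of \<mu> f] FT[of 1] assms(4,5)
    by (simp add: is_spectral_measure_def)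
  fix \<gamma> :: real assume \<gamma>: "0 < \<gamma> \<and> \<gamma> < (2 - \<beta>) / 2"
  \<comment> \<open>The weight raises the exponent of the density to a - 3, and the bound on
    \<gamma> keeps a below 2, hence in the range 0 < a < 3 of the Riesz transform.\<close>
  define a where "a = \<beta> + 2 * \<gamma>"
  have a: "0 < a" "a < 2" using \<gamma> assms(2) by (auto simp: a_def)
  then have a3: "0 < a" "a < real CARD(3)" by auto
  obtain L :: real where L: "0 < L" and FT': "\<And>c. 0 \<le> c \<Longrightarrow> has_fourier_transform
       (density lborel (\<lambda>\<zeta>::real^3. ennreal (c * L * norm \<zeta> powr (a - CARD(3))))) (\<lambda>x. c * norm x powr (- a))"
    by (rule riesz_kernel_fourier_transform[OF a3]) blast
  have "density \<mu> (\<lambda>\<zeta>. ennreal (norm \<zeta> powr (2 * \<gamma>)))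
      = density lborel (\<lambda>\<zeta>. ennreal (K * norm \<zeta> powr (\<beta> - 3)) * ennreal (norm \<zeta> powr (2 * \<gamma>)))"
    unfolding \<mu> by (rule density_density_eq) measurable
  \<comment> \<open>The factor K / L * L stays uncancelled to match the transform for
    \<open>a\<close> with c = K / L.\<close>
  also have "(\<lambda>\<zeta>::real^3. ennreal (K * norm \<zeta> powr (\<beta> - 3)) * ennreal (norm \<zeta> powr (2 * \<gamma>)))
      = (\<lambda>\<zeta>. ennreal (K / L * L * norm \<zeta> powr (a - 3)))"
  proof
    fix \<zeta> :: "real^3"
    have "norm \<zeta> powr (\<beta> - 3) * norm \<zeta> powr (2 * \<gamma>) = norm \<zeta> powr (a - 3)"
      unfolding powr_add[symmetric] by (simp add: a_def algebra_simps)
    then show "ennreal (K * norm \<zeta> powr (\<beta> - 3)) * ennreal (norm \<zeta> powr (2 * \<gamma>)) = ennreal (K / L * L * norm \<zeta> powr (a - 3))"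
      using K L by (simp add: ennreal_mult'[symmetric] mult.assoc)
  qed
  finally have "has_fourier_transform (density \<mu> (\<lambda>\<zeta>. ennreal (norm \<zeta> powr (2 * \<gamma>)))) (\<lambda>x. K / L * norm x powr (- a))"
    using FT'[of "K / L"] K L by simp
  moreover have "locally_integrable (\<lambda>x::real^3. K / L * norm x powr (- a))"
    by (rule locally_integrable_norm_powr) (use a in auto)
  ultimately show "\<exists>g. (\<forall>x. 0 \<le> g x) \<and> locally_integrable g \<and>
             has_fourier_transform (density \<mu> (\<lambda>\<zeta>. ennreal (norm \<zeta> powr (2 * \<gamma>)))) g"
    using K L by (intro exI[of _ "\<lambda>x. K / L * norm x powr (- a)"]) auto
  have "(\<integral>\<^sup>+ \<zeta>. ennreal (1 / (1 + norm \<zeta> powr (2 - 2 * \<gamma>))) \<partial>\<mu>)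
      = (\<integral>\<^sup>+ \<zeta>. ennreal (K * norm (\<zeta>::real^3) powr (\<beta> - 3)) * ennreal (1 / (1 + norm \<zeta> powr (2 - 2 * \<gamma>))) \<partial>lborel)"
    unfolding \<mu> by (rule nn_integral_density) measurable
  also have "\<dots> \<le> (\<integral>\<^sup>+ \<zeta>. ennreal (2 * K) * ennreal (norm (\<zeta>::real^3) powr (- (3 - \<beta>)) * (1 + (norm \<zeta>)\<^sup>2) powr (- (1 - \<gamma>))) \<partial>lborel)"
  proof (rule nn_integral_mono)
    fix \<zeta> :: "real^3"
    have "1 / (1 + norm \<zeta> powr (2 - 2 * \<gamma>)) \<le> 2 * (1 + (norm \<zeta>)\<^sup>2) powr (- (1 - \<gamma>))"
      using inverse_one_plus_powr_le[of "norm \<zeta>" "1 - \<gamma>"] \<gamma> assms(2) by (simp add: algebra_simps)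
    then have "K * norm \<zeta> powr (\<beta> - 3) * (1 / (1 + norm \<zeta> powr (2 - 2 * \<gamma>)))
        \<le> K * norm \<zeta> powr (\<beta> - 3) * (2 * (1 + (norm \<zeta>)\<^sup>2) powr (- (1 - \<gamma>)))"
      using K by (intro mult_left_mono) auto
    also have "\<dots> = 2 * K * (norm \<zeta> powr (- (3 - \<beta>)) * (1 + (norm \<zeta>)\<^sup>2) powr (- (1 - \<gamma>)))"
      by simp
    finally show "ennreal (K * norm \<zeta> powr (\<beta> - 3)) * ennreal (1 / (1 + norm \<zeta> powr (2 - 2 * \<gamma>)))
        \<le> ennreal (2 * K) * ennreal (norm \<zeta> powr (- (3 - \<beta>)) * (1 + (norm \<zeta>)\<^sup>2) powr (- (1 - \<gamma>)))"
      using K by (subst (1 2) ennreal_mult'[symmetric]) (auto intro: ennreal_leI)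
  qed
  also have "\<dots> = ennreal (2 * K) * (\<integral>\<^sup>+ \<zeta>. ennreal (norm (\<zeta>::real^3) powr (- (3 - \<beta>)) * (1 + (norm \<zeta>)\<^sup>2) powr (- (1 - \<gamma>))) \<partial>lborel)"
    by (rule nn_integral_cmult) measurable
  \<comment> \<open>Convergence at infinity requires (3 - \<beta>) + 2 (1 - \<gamma>) > 3, which is
    exactly \<gamma> < (2 - \<beta>) / 2.\<close>
  also have "\<dots> < \<infinity>"
    using nn_integral_norm_powr_weight_finite[where 'a="real^3", of "3 - \<beta>" "1 - \<gamma>"] \<gamma> assms(2,3)
    by (simp add: ennreal_mult_less_top field_simps)
  finally show "(\<integral>\<^sup>+ \<zeta>. ennreal (1 / (1 + norm \<zeta> powr (2 - 2 * \<gamma>))) \<partial>\<mu>) < \<infinity>" .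
next
  define I where "I = (\<integral>\<^sup>+ z\<in>cball 0 1. ennreal (norm (z::real^3) powr (- (\<beta> + 1))) \<partial>lborel)"
  have I: "I = ennreal (enn2real I)"
    using nn_integral_cball_norm_powr_finite[where 'a="real^3", of "\<beta> + 1"] assms(2,3) by (simp add: I_def)
  have "(\<integral>\<^sup>+ z \<in> cball 0 h. ennreal (f z / norm z) \<partial>lborel) \<le> ennreal (enn2real I * h powr (2 - \<beta>))"
    if h: "0 < h" for h
  proof -
    \<comment> \<open>The identity includes z = 0, where both sides are 0 by the conventions for
      \<open>powr\<close> and division.\<close>
    have "f z / norm z = norm z powr (- (\<beta> + 1))" for z :: "real^3"
    proof (cases "z = 0")
      case False
      have "- (\<beta> + 1) = - \<beta> - 1" by simp
      then show ?thesis using False by (simp only: powr_diff) (simp add: assms(4))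
    qed (simp add: assms(4))
    then have "(\<integral>\<^sup>+ z \<in> cball 0 h. ennreal (f z / norm z) \<partial>lborel) = ennreal (h powr (3 - (\<beta> + 1))) * I"
      unfolding I_def using nn_integral_cball_norm_powr[where 'a="real^3", of "\<beta> + 1" h] h assms(2,3) by simp
    also have "\<dots> = ennreal (h powr (2 - \<beta>)) * ennreal (enn2real I)"
      using I by simp
    finally show ?thesis by (simp add: ennreal_mult'[symmetric] mult.commute)
  qed
  then show "\<exists>C::real. \<forall>h. 0 < h \<and> h \<le> 2 * T \<longrightarrow>
        (\<integral>\<^sup>+ z \<in> cball 0 h. ennreal (f z / norm z) \<partial>lborel) \<le> ennreal (C * h powr (2 - \<beta>))"
    by blast
next
  fix \<rho> :: real assume \<rho>: "0 < \<rho> \<and> \<rho> < min (2 - \<beta>) 1"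
  \<comment> \<open>The weight is written \<open>s ^ 1\<close> to fit the pattern
    \<open>s ^ k\<close> of the general bound.\<close>
  have "\<exists>C::real. \<forall>h. 0 < h \<and> h \<le> 1 \<longrightarrow>
          (\<integral>\<^sup>+ s \<in> {0..T}. (\<integral>\<^sup>+ \<eta>. (\<integral>\<^sup>+ \<xi>.
              ennreal (\<bar>f (s *\<^sub>R (\<xi> + \<eta>) + h *\<^sub>R (\<xi> + \<eta>)) - f (s *\<^sub>R (\<xi> + \<eta>) + h *\<^sub>R \<eta>)\<bar> * s ^ 1)
            \<partial>sphere_measure) \<partial>sphere_measure) \<partial>lborel)
          \<le> ennreal (C * h powr \<rho>)"
  proof (rule triple_sphere_integral_bound[where p="\<beta> + \<rho>" and K=9])
    fix h s :: real and \<eta> \<xi> :: "real^3"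
    assume "0 < h" "0 < s" "norm \<eta> = 1" "norm \<xi> = 1" "\<xi> + \<eta> \<noteq> 0"
    then show "\<bar>f (s *\<^sub>R (\<xi> + \<eta>) + h *\<^sub>R (\<xi> + \<eta>)) - f (s *\<^sub>R (\<xi> + \<eta>) + h *\<^sub>R \<eta>)\<bar>
        \<le> 9 * (h powr \<rho> * (s powr (- (\<beta> + \<rho>)) * norm (\<xi> + \<eta>) powr (- (\<beta> + \<rho>))))"
      unfolding assms(4) using \<rho> assms(2,3) by (intro riesz_difference_bounds(1)) auto
  qed (use assms(1,2) \<rho> in auto)
  then show "\<exists>C::real. \<forall>h. 0 < h \<and> h \<le> 1 \<longrightarrow>
          (\<integral>\<^sup>+ s \<in> {0..T}. (\<integral>\<^sup>+ \<eta>. (\<integral>\<^sup>+ \<xi>.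
              ennreal (\<bar>f (s *\<^sub>R (\<xi> + \<eta>) + h *\<^sub>R (\<xi> + \<eta>)) - f (s *\<^sub>R (\<xi> + \<eta>) + h *\<^sub>R \<eta>)\<bar> * s)
            \<partial>sphere_measure) \<partial>sphere_measure) \<partial>lborel)
          \<le> ennreal (C * h powr \<rho>)"
    by (simp only: power_one_right)
next
  fix \<rho> :: real assume \<rho>: "0 < \<rho> \<and> \<rho> < 2 - \<beta>"
  show "\<exists>C::real. \<forall>h. 0 < h \<and> h \<le> 1 \<longrightarrow>
          (\<integral>\<^sup>+ s \<in> {0..T}. (\<integral>\<^sup>+ \<eta>. (\<integral>\<^sup>+ \<xi>.
              ennreal (\<bar>f (s *\<^sub>R (\<xi> + \<eta>) + h *\<^sub>R (\<xi> + \<eta>)) - f (s *\<^sub>R (\<xi> + \<eta>) + h *\<^sub>R \<xi>)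
                        - f (s *\<^sub>R (\<xi> + \<eta>) + h *\<^sub>R \<eta>) + f (s *\<^sub>R (\<xi> + \<eta>))\<bar> * s\<^sup>2)
            \<partial>sphere_measure) \<partial>sphere_measure) \<partial>lborel)
          \<le> ennreal (C * h powr \<rho>)"
  \<comment> \<open>Here k = 2, and \<rho> < 2 - \<beta> gives both \<rho> <= 2 for the second
    difference and p < 2 for the sphere.\<close>
  proof (rule triple_sphere_integral_bound[where p="\<beta> + \<rho>" and K=80])
    fix h s :: real and \<eta> \<xi> :: "real^3"
    assume "0 < h" "0 < s" "norm \<eta> = 1" "norm \<xi> = 1" "\<xi> + \<eta> \<noteq> 0"
    then show "\<bar>f (s *\<^sub>R (\<xi> + \<eta>) + h *\<^sub>R (\<xi> + \<eta>)) - f (s *\<^sub>R (\<xi> + \<eta>) + h *\<^sub>R \<xi>)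
                        - f (s *\<^sub>R (\<xi> + \<eta>) + h *\<^sub>R \<eta>) + f (s *\<^sub>R (\<xi> + \<eta>))\<bar>
        \<le> 80 * (h powr \<rho> * (s powr (- (\<beta> + \<rho>)) * norm (\<xi> + \<eta>) powr (- (\<beta> + \<rho>))))"
      unfolding assms(4) using \<rho> assms(2,3) by (intro riesz_difference_bounds(2)) auto
  qed (use assms(1,2) \<rho> in auto)
qed

end
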